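(* Let $d\ge1$ be an integer, $s>0$, $T>0$, and let $\psi$ be a Friedrichs mollifier on $\mathbb{R}^d$. Let $a,b\in L^\infty(\mathbb{R}^d)$ be non-negative, $u_0\in H^s(\mathbb{R}^d)$ and $u_1\in L^2(\mathbb{R}^d)$. Let $(a_\varepsilon)_\varepsilon=(a\ast\psi_\varepsilon)_\varepsilon$ and $(b_\varepsilon)_\varepsilon=(b\ast\psi_\varepsilon)_\varepsilon$ be regularising families for the coefficients satisfying $$\|a_\varepsilon-a\|_{L^\infty}\to0\quad\text{and}\quad\|b_\varepsilon-b\|_{L^\infty}\to0\qquad(\varepsilon\to0),$$ and let $(u_{0,\varepsilon})_\varepsilon=(u_0\ast\psi_\varepsilon)_\varepsilon$, $(u_{1,\varepsilon})_\varepsilon=(u_1\ast\psi_\varepsilon)_\varepsilon$ be regularising families for the initial data. For $\varepsilon\in(0,1]$ let $u_\varepsilon\in C([0,T];H^s(\mathbb{R}^d))\cap C^1([0,T];L^2(\mathbb{R}^d))$ be the solution of $$\partial_t^2u_\varepsilon+(-\Delta)^su_\varepsilon+a_\varepsilon(x)u_\varepsilon+b_\varepsilon(x)\partial_tu_\varepsilon=0\ \text{on }[0,T]\times\mathbb{R}^d,\quad u_\varepsilon(0,\cdot)=u_{0,\varepsilon},\ \partial_tu_\varepsilon(0,\cdot)=u_{1,\varepsilon},$$ and let $u\in C([0,T];H^s(\mathbb{R}^d))\cap C^1([0,T];L^2(\mathbb{R}^d))$ be the classical solution, i.e. the unique solution in this class of $$u_{tt}+(-\Delta)^su+a(x)u+b(x)u_t=0\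 \text{on }[0,T]\times\mathbb{R}^d,\quad u(0,\cdot)=u_0,\ u_t(0,\cdot)=u_1.$$ Then, for every $t\in[0,T]$, $u_\varepsilon(t,\cdot)\to u(t,\cdot)$ in $L^2(\mathbb{R}^d)$ as $\varepsilon\to0$.
   Context: A Friedrichs mollifier is a non-negative $\psi\in C_0^\infty(\mathbb{R}^d)$ with $\int_{\mathbb{R}^d}\psi(x)\,dx=1$. The associated mollifying net is $\psi_\varepsilon(x)=\varepsilon^{-d}\psi(x/\varepsilon)$, $\varepsilon\in(0,1]$. The fractional Laplacian is $(-\Delta)^s f=\mathcal{F}^{-1}(|\xi|^{2s}\widehat f)$, and $H^s(\mathbb{R}^d)=\{f\in L^2(\mathbb{R}^d): (-\Delta)^{s/2}f\in L^2(\mathbb{R}^d)\}$ with norm $\|f\|_{H^s}=\|f\|_{L^2}+\|(-\Delta)^{s/2}f\|_{L^2}$. The equations are understood in the sense of distributions on $(0,T)\times\mathbb{R}^d$. *)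

theory Defs
  imports "HOL-Analysis.Analysis" "HOL-Probability.Essential_Supremum"
begin

text \<open>Elements of \<open>L\<^sup>2\<close> and \<open>L\<^sup>\<infinity>\<close> are represented by Borel functions with
  respect to Lebesgue measure; every class has such a representative, and equalities between
  classes are stated almost everywhere.\<close>

subsection \<open>Test functions and mollifiers\<close>

primrec Ck :: "nat \<Rightarrow> ('a::euclidean_space \<Rightarrow> 'b::real_normed_vector) \<Rightarrow> bool" where
  "Ck 0 f \<longleftrightarrow> continuous_on UNIV f"
| "Ck (Suc k) f \<longleftrightarrow> (\<forall>x. f differentiable at x) \<and> (\<forall>v. Ck k (\<lambda>x. frechet_derivative f (at x) v))"

definition test_functions :: "'a::euclidean_space set \<Rightarrow> ('a \<Rightarrow> 'b::real_normed_vector) set" where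
  "test_functions \<Omega> = {\<phi>. (\<forall>k. Ck k \<phi>) \<and> compact (closure {x. \<phi> x \<noteq> 0}) \<and> closure {x. \<phi> x \<noteq> 0} \<subseteq> \<Omega>}"

definition friedrichs_mollifier :: "('a::euclidean_space \<Rightarrow> real) \<Rightarrow> bool" where
  "friedrichs_mollifier \<psi> \<longleftrightarrow>
     \<psi> \<in> test_functions UNIV \<and> (\<forall>x. \<psi> x \<ge> 0) \<and> (LINT x|lborel. \<psi> x) = 1"

definition mollifying_net :: "('a::euclidean_space \<Rightarrow> real) \<Rightarrow> real \<Rightarrow> 'a \<Rightarrow> real" where
  "mollifying_net \<psi> \<epsilon> x = \<psi> (x /\<^sub>R \<epsilon>) / \<epsilon> ^ DIM('a)"

definition convol :: "('a::euclidean_space \<Rightarrow> 'b::{banach, second_countable_topology}) \<Rightarrow> ('a \<Rightarrow> real) \<Rightarrow> 'a \<Rightarrow> 'b"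
  where "convol f \<psi> x = (LINT y|lborel. \<psi> (x - y) *\<^sub>R f y)"

subsection \<open>The spaces \<open>L\<^sup>\<infinity>\<close> and \<open>L\<^sup>2\<close>\<close>

definition Linf_norm :: "('a::euclidean_space \<Rightarrow> real) \<Rightarrow> ereal" where
  "Linf_norm f = esssup lborel (\<lambda>x. ereal \<bar>f x\<bar>)"

definition Linf :: "('a::euclidean_space \<Rightarrow> real) set" where
  "Linf = {f. f \<in> borel_measurable lborel \<and> Linf_norm f < \<infinity>}"

definition L2 :: "('a::euclidean_space \<Rightarrow> complex) set" where
  "L2 = {f. f \<in> borel_measurable lborel \<and> integrable lborel (\<lambda>x. (cmod (f x))\<^sup>2)}"

definition L2_norm :: "('a::euclidean_space \<Rightarrow> complex) \<Rightarrow> real" where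
  "L2_norm f = sqrt (LINT x|lborel. (cmod (f x))\<^sup>2)"

text \<open>The membership conditions are needed because the integral in \<^const>\<open>L2_norm\<close> is \<open>0\<close> by
  convention for functions outside \<open>L\<^sup>2\<close>.\<close>

definition L2_lim :: "('i \<Rightarrow> 'a::euclidean_space \<Rightarrow> complex) \<Rightarrow> ('a \<Rightarrow> complex) \<Rightarrow> 'i filter \<Rightarrow> bool" where
  "L2_lim F l net \<longleftrightarrow> l \<in> L2 \<and> (\<forall>\<^sub>F i in net. F i \<in> L2) \<and>
     ((\<lambda>i. L2_norm (\<lambda>x. F i x - l x)) \<longlongrightarrow> 0) net"

subsection \<open>Fourier transform, fractional Laplacian, Sobolev spaces\<close>

text \<open>Plancherel's extension to \<open>L\<^sup>2\<close> of
  \<open>f \<mapsto> (\<lambda>\<xi>. \<integral> exp (-i x\<cdot>\<xi>) f(x) dx)\<close>, as the \<open>L\<^sup>2\<close>-limit of the transforms of truncations. With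
  this normalisation \<open>|\<xi>|\<^sup>2\<close> is the symbol of the negative Laplacian.\<close>

definition has_fourier :: "('a::euclidean_space \<Rightarrow> complex) \<Rightarrow> ('a \<Rightarrow> complex) \<Rightarrow> bool" where
  "has_fourier f g \<longleftrightarrow> f \<in> L2 \<and>
     L2_lim (\<lambda>R \<xi>. LINT x:cball 0 R|lborel. cis (- (x \<bullet> \<xi>)) * f x) g (at_top :: real filter)"

definition has_inv_fourier :: "('a::euclidean_space \<Rightarrow> complex) \<Rightarrow> ('a \<Rightarrow> complex) \<Rightarrow> bool" where
  "has_inv_fourier g f \<longleftrightarrow> g \<in> L2 \<and>
     L2_lim (\<lambda>R x. (LINT \<xi>:cball 0 R|lborel. cis (x \<bullet> \<xi>) * g \<xi>) / of_real ((2 * pi) ^ DIM('a)))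
       f (at_top :: real filter)"

text \<open>\<open>has_frac_laplacian r f h\<close>: the function \<open>(-\<Delta>)\<^sup>r f\<close> belongs to \<open>L\<^sup>2\<close> and equals \<open>h\<close>
  almost everywhere.\<close>

definition has_frac_laplacian ::
  "real \<Rightarrow> ('a::euclidean_space \<Rightarrow> complex) \<Rightarrow> ('a \<Rightarrow> complex) \<Rightarrow> bool" where
  "has_frac_laplacian r f h \<longleftrightarrow>
     (\<exists>g. has_fourier f g \<and> has_inv_fourier (\<lambda>\<xi>. of_real (norm \<xi> powr (2 * r)) * g \<xi>) h)"

definition frac_laplacian :: "real \<Rightarrow> ('a::euclidean_space \<Rightarrow> complex) \<Rightarrow> 'a \<Rightarrow> complex" where
  "frac_laplacian r f = (SOME h. has_frac_laplacian r f h)"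

definition Hs :: "real \<Rightarrow> ('a::euclidean_space \<Rightarrow> complex) set" where
  "Hs s = {f \<in> L2. \<exists>h\<in>L2. has_frac_laplacian (s / 2) f h}"

definition Hs_norm :: "real \<Rightarrow> ('a::euclidean_space \<Rightarrow> complex) \<Rightarrow> real" where
  "Hs_norm s f = L2_norm f + L2_norm (frac_laplacian (s / 2) f)"

subsection \<open>Solutions of the Cauchy problem\<close>

definition C_Hs :: "real \<Rightarrow> real \<Rightarrow> (real \<Rightarrow> 'a::euclidean_space \<Rightarrow> complex) \<Rightarrow> bool" where
  "C_Hs T s u \<longleftrightarrow> (\<forall>t\<in>{0..T}. u t \<in> Hs s \<and>
     ((\<lambda>\<tau>. Hs_norm s (\<lambda>x. u \<tau> x - u t x)) \<longlongrightarrow> 0) (at t within {0..T}))"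

text \<open>\<open>u \<in> C\<^sup>1([0,T]; L\<^sup>2)\<close> with derivative \<open>v\<close>, one-sided at the end points.\<close>

definition C1_L2 ::
  "real \<Rightarrow> (real \<Rightarrow> 'a::euclidean_space \<Rightarrow> complex) \<Rightarrow> (real \<Rightarrow> 'a \<Rightarrow> complex) \<Rightarrow> bool" where
  "C1_L2 T u v \<longleftrightarrow> (\<forall>t\<in>{0..T}. u t \<in> L2 \<and>
     L2_lim (\<lambda>\<tau> x. (u \<tau> x - u t x) /\<^sub>R (\<tau> - t)) (v t) (at t within {0..T}) \<and>
     L2_lim v (v t) (at t within {0..T}))"

definition dt :: "(real \<times> 'a \<Rightarrow> complex) \<Rightarrow> real \<times> 'a \<Rightarrow> complex" where
  "dt \<phi> = (\<lambda>(t, x). vector_derivative (\<lambda>\<tau>. \<phi> (\<tau>, x)) (at t))"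

text \<open>\<open>u\<^sub>t\<^sub>t + (-\<Delta>)\<^sup>s u + a u + b u\<^sub>t = 0\<close> in the sense of distributions on \<open>(0,T) \<times> \<real>\<^sup>d\<close>, where \<open>v\<close>
  stands for \<open>u\<^sub>t\<close>. As \<open>(-\<Delta>)\<^sup>s u(t)\<close> need not be a function, it acts by transposition: its value on a
  test function \<open>\<phi>\<close> is the integral of \<open>u(t) (-\<Delta>)\<^sup>s\<phi>\<close>; no sign or conjugate appears because the
  symbol is even and real. The iterated integral is used because each \<open>u t\<close> is a representative of an
  \<open>L\<^sup>2\<close> class, so that \<open>u\<close> need not be jointly measurable; the inner integral is
  continuous in \<open>t\<close>.\<close>

definition wave_eq ::
  "real \<Rightarrow> real \<Rightarrow> ('a::euclidean_space \<Rightarrow> real) \<Rightarrow> ('a \<Rightarrow> real) \<Rightarrow>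
   (real \<Rightarrow> 'a \<Rightarrow> complex) \<Rightarrow> (real \<Rightarrow> 'a \<Rightarrow> complex) \<Rightarrow> bool" where
  "wave_eq T s a b u v \<longleftrightarrow> (\<forall>\<phi> \<in> test_functions ({0<..<T} \<times> UNIV).
     (LINT t:{0<..<T}|lborel. (LINT x|lborel.
        u t x * dt (dt \<phi>) (t, x) + u t x * frac_laplacian s (\<lambda>y. \<phi> (t, y)) x
        + of_real (a x) * u t x * \<phi> (t, x) + of_real (b x) * v t x * \<phi> (t, x))) = 0)"

definition is_solution ::
  "real \<Rightarrow> real \<Rightarrow> ('a::euclidean_space \<Rightarrow> real) \<Rightarrow> ('a \<Rightarrow> real) \<Rightarrow>
   ('a \<Rightarrow> complex) \<Rightarrow> ('a \<Rightarrow> complex) \<Rightarrow> (real \<Rightarrow> 'a \<Rightarrow> complex) \<Rightarrow> bool" where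
  "is_solution T s a b u0 u1 u \<longleftrightarrow> C_Hs T s u \<and>
     (\<exists>v. C1_L2 T u v \<and> wave_eq T s a b u v \<and>
          (AE x in lborel. u 0 x = u0 x) \<and> (AE x in lborel. v 0 x = u1 x))"

end

theory Submission
  imports Defs "HOL-Probability.Characteristic_Functions"
begin

text \<open>Let \<open>w = u\<^sub>\<epsilon> - u\<close> and \<open>v = w\<^sub>t\<close>. Subtracting the two equations shows that \<open>w\<close> solves
  \<open>w\<^sub>t\<^sub>t + (-\<Delta>)\<^sup>s w + F = 0\<close> with
  \<open>F = a\<^sub>\<epsilon> w + b\<^sub>\<epsilon> v + (a\<^sub>\<epsilon> - a) u + (b\<^sub>\<epsilon> - b) u\<^sub>t\<close> and initial data \<open>u\<^sub>0 * \<psi>\<^sub>\<epsilon> - u\<^sub>0\<close>,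
  \<open>u\<^sub>1 * \<psi>\<^sub>\<epsilon> - u\<^sub>1\<close>. Pairing with \<open>v\<close> gives the energy inequality
  \<open>\<parallel>v(t)\<parallel>\<^sup>2 \<le> \<parallel>v(0)\<parallel>\<^sup>2 + \<parallel>(-\<Delta>)\<^bsup>s/2\<^esup> w(0)\<parallel>\<^sup>2 + 2 \<integral> \<parallel>F\<parallel> \<parallel>v\<parallel>\<close>, and Gronwall's lemma bounds
  \<open>\<parallel>w(t)\<parallel>\<^sup>2 + \<parallel>v(t)\<parallel>\<^sup>2\<close> by a constant times the initial energy plus
  \<open>(\<parallel>a\<^sub>\<epsilon> - a\<parallel>\<^sub>\<infinity> + \<parallel>b\<^sub>\<epsilon> - b\<parallel>\<^sub>\<infinity>)\<^sup>2\<close> (lemma \<open>stability_estimate\<close>). Both terms tend to \<open>0\<close>: the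
  second by hypothesis, the first because mollifiers are approximate identities on \<open>L\<^sup>2\<close>
  (\<open>Conv_mollifier_tendsto\<close>) and because convolution with \<open>\<psi>\<^sub>\<epsilon>\<close> multiplies the Fourier transform of
  \<open>u\<^sub>0\<close> by a function that is bounded by \<open>1\<close> and tends to \<open>1\<close> (\<open>initial_energy_tendsto\<close>).

  A distributional solution is too rough to be paired with its own time derivative, so the argument
  is carried out for the equation convolved in space with a smooth even kernel \<open>k\<close>. There the
  fractional Laplacian turns into the bounded operator \<open>A\<^sub>k\<close> with Fourier multiplier
  \<open>|\<xi>|\<^bsup>2s\<^esup> k^(\<xi>)\<close>, and \<open>k * v\<close> is differentiable in \<open>L\<^sup>2\<close> with derivative \<open>-(A\<^sub>k w + k * F)\<close>
  (\<open>mollified_equation\<close>). Hence \<open>\<langle>v, k * v\<rangle> + \<langle>w, A\<^sub>k w\<rangle>\<close> is differentiable with derivative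
  \<open>-2 \<langle>k * F, v\<rangle>\<close> (\<open>energy_identity\<close>). If \<open>k\<close> is the autocorrelation of a mollifier then
  \<open>0 \<le> k^ \<le> 1\<close>, so \<open>\<langle>w, A\<^sub>k w\<rangle>\<close> is non-negative and at most
  \<open>\<parallel>(-\<Delta>)\<^bsup>s/2\<^esup> w\<parallel>\<^sup>2\<close>; shrinking \<open>k\<close> to a point mass gives the energy inequality
  (\<open>energy_estimate\<close>).

  Three tools carry this. The space \<open>L\<^sup>2\<close> is made into a type of class \<open>banach\<close> and
  \<open>real_inner\<close>, so that derivatives and integrals of \<open>L\<^sup>2\<close>-valued functions of time are available. On
  it, the Fourier transform of the definitions becomes a bounded linear operator; its boundedness
  follows from a Bessel inequality proved with Gaussian weights (\<open>weighted_bessel\<close>), and moving it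
  across an inner product uses the multiplication formula. Finally, testing the equation with
  products \<open>\<theta>(t) g(x)\<close> and the du Bois-Reymond lemma in time (\<open>weak_second_derivative\<close>) turns
  the distributional equation into an identity that holds at every time.\<close>

section \<open>The Hilbert space \<open>L\<^sup>2\<close>\<close>

lemma L2_D: 
  assumes "f \<in> L2"
  shows "f \<in> borel_measurable borel" "integrable lborel (\<lambda>x. (cmod (f x))\<^sup>2)"
  using assms by (auto simp: L2_def)

lemma L2_I: "f \<in> borel_measurable borel \<Longrightarrow> integrable lborel (\<lambda>x. (cmod (f x))\<^sup>2) \<Longrightarrow> f \<in> L2"
  by (auto simp: L2_def)

lemma L2_bound:
  assumes "f \<in> borel_measurable borel" "integrable lborel g" "AE x in lborel. (cmod (f x))\<^sup>2 \<le> g x"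
  shows "f \<in> L2"
  by (rule L2_I[OF assms(1)], rule Bochner_Integration.integrable_bound[OF assms(2)])
     (use assms in auto)

lemma L2_integrable_mult:
  assumes "f \<in> L2" "g \<in> L2"
  shows "integrable lborel (\<lambda>x. f x * g x)"
proof (rule Bochner_Integration.integrable_bound)
  show "integrable lborel (\<lambda>x. (cmod (f x))\<^sup>2 + (cmod (g x))\<^sup>2)"
    using L2_D[OF assms(1)] L2_D[OF assms(2)] by auto
  show "(\<lambda>x. f x * g x) \<in> borel_measurable lborel"
    using L2_D[OF assms(1)] L2_D[OF assms(2)] by auto
  have "cmod a * cmod b \<le> (cmod a)\<^sup>2 + (cmod b)\<^sup>2" for a b :: complex
  proof -
    have "2 * cmod a * cmod b \<le> (cmod a)\<^sup>2 + (cmod b)\<^sup>2" by (rule sum_squares_bound)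
    moreover have "0 \<le> cmod a * cmod b" by simp
    ultimately show ?thesis by linarith
  qed
  then show "AE x in lborel. norm (f x * g x) \<le> norm ((cmod (f x))\<^sup>2 + (cmod (g x))\<^sup>2)"
    by (intro AE_I2) (simp add: norm_mult)
qed

lemma L2_zero [simp]: "(\<lambda>x. 0) \<in> L2" by (simp add: L2_def)

lemma L2_add:
  assumes "f \<in> L2" "g \<in> L2"
  shows "(\<lambda>x. f x + g x) \<in> L2"
proof (rule L2_bound)
  show "integrable lborel (\<lambda>x. 2 * ((cmod (f x))\<^sup>2 + (cmod (g x))\<^sup>2))"
    using L2_D[OF assms(1)] L2_D[OF assms(2)] by auto
  have "(cmod (a + b))\<^sup>2 \<le> 2 * ((cmod a)\<^sup>2 + (cmod b)\<^sup>2)" for a b :: complex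
  proof -
    have "(cmod (a + b))\<^sup>2 \<le> (cmod a + cmod b)\<^sup>2" by (simp add: norm_triangle_ineq power_mono)
    also have "\<dots> \<le> 2 * ((cmod a)\<^sup>2 + (cmod b)\<^sup>2)"
      using sum_squares_bound[of "cmod a" "cmod b"] by (simp add: power2_sum)
    finally show ?thesis .
  qed
  then show "AE x in lborel. (cmod (f x + g x))\<^sup>2 \<le> 2 * ((cmod (f x))\<^sup>2 + (cmod (g x))\<^sup>2)"
    by auto
  show "(\<lambda>x. f x + g x) \<in> borel_measurable borel"
    using L2_D[OF assms(1)] L2_D[OF assms(2)] by auto
qed

text \<open>These are the symbols of the bounded multiplication operators below: coefficients, Fourier
  multipliers, and the constant \<open>\<i>\<close>.\<close>
definition ess_bdd :: "('a::euclidean_space \<Rightarrow> complex) \<Rightarrow> bool" where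
  "ess_bdd m \<longleftrightarrow> m \<in> borel_measurable borel \<and> (\<exists>C. AE x in lborel. cmod (m x) \<le> C)"

lemma ess_bdd_I: "m \<in> borel_measurable borel \<Longrightarrow> (\<And>x. cmod (m x) \<le> C) \<Longrightarrow> ess_bdd m"
  unfolding ess_bdd_def by auto

lemma L2_mult:
  assumes m: "ess_bdd m" and f: "f \<in> L2"
  shows "(\<lambda>x. m x * f x) \<in> L2"
proof -
  obtain C where C: "AE x in lborel. cmod (m x) \<le> C" using m by (auto simp: ess_bdd_def)
  show ?thesis
  proof (rule L2_bound)
    show "integrable lborel (\<lambda>x. C\<^sup>2 * (cmod (f x))\<^sup>2)" using L2_D[OF f] by auto
    show "(\<lambda>x. m x * f x) \<in> borel_measurable borel" using L2_D[OF f] m by (auto simp: ess_bdd_def)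
    show "AE x in lborel. (cmod (m x * f x))\<^sup>2 \<le> C\<^sup>2 * (cmod (f x))\<^sup>2"
      using C by eventually_elim (auto simp: norm_mult power_mult_distrib intro!: mult_right_mono power_mono)
  qed
qed

lemma ess_bdd_const [simp]: "ess_bdd (\<lambda>x. c)" by (auto simp: ess_bdd_def)

lemma L2_cmult: "f \<in> L2 \<Longrightarrow> (\<lambda>x. c * f x) \<in> L2"
  by (rule L2_mult) simp

lemma L2_scaleR: "f \<in> L2 \<Longrightarrow> (\<lambda>x. c *\<^sub>R f x) \<in> L2"
  using L2_cmult[of f "of_real c"] by (simp add: scaleR_conv_of_real)

lemma L2_uminus: "f \<in> L2 \<Longrightarrow> (\<lambda>x. - f x) \<in> L2"
  using L2_cmult[of f "-1"] by simp

lemma L2_diff: "f \<in> L2 \<Longrightarrow> g \<in> L2 \<Longrightarrow> (\<lambda>x. f x - g x) \<in> L2"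
  using L2_add[OF _ L2_uminus, of f g] by simp

lemma cnj_measurable [measurable]: "cnj \<in> borel_measurable borel"
  by (intro borel_measurable_continuous_onI continuous_intros)

lemma L2_cnj: "f \<in> L2 \<Longrightarrow> (\<lambda>x. cnj (f x)) \<in> L2"
proof (rule L2_I)
  assume f: "f \<in> L2"
  show "(\<lambda>x. cnj (f x)) \<in> borel_measurable borel"
    by (rule measurable_compose[OF L2_D(1)[OF f] cnj_measurable])
  show "integrable lborel (\<lambda>x. (cmod (cnj (f x)))\<^sup>2)" using L2_D[OF f] by simp
qed

lemma L2_integrable_inner:
  assumes "f \<in> L2" "g \<in> L2"
  shows "integrable lborel (\<lambda>x. f x \<bullet> g x)"
proof -
  have "integrable lborel (\<lambda>x. Re (f x * cnj (g x)))"
    by (rule integrable_Re[OF L2_integrable_mult[OF assms(1) L2_cnj[OF assms(2)]]])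
  moreover have "(\<lambda>x. Re (f x * cnj (g x))) = (\<lambda>x. f x \<bullet> g x)"
    by (auto simp: inner_complex_def)
  ultimately show ?thesis by simp
qed

text \<open>Passing to classes modulo null sets makes \<open>L2_norm\<close> a norm, so that the general theory of
  inner product spaces, derivatives and integrals applies to \<open>L\<^sup>2\<close>-valued functions. The class of a
  function \<open>f\<close> is \<open>cls f\<close>; it is meaningful only for \<open>f \<in> L2\<close>.\<close>
quotient_type (overloaded) 'a l2 = "'a::euclidean_space \<Rightarrow> complex" /
  partial: "\<lambda>f g. f \<in> L2 \<and> g \<in> L2 \<and> (AE x in lborel. f x = g x)"
  morphisms rep_l2' cls
proof (rule part_equivpI)
  show "\<exists>f::'a \<Rightarrow> complex. f \<in> L2 \<and> f \<in> L2 \<and> (AE x in lborel. f x = f x)"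
    by (rule exI[of _ "\<lambda>x. 0"]) simp
  show "symp (\<lambda>f g::'a\<Rightarrow>complex. f \<in> L2 \<and> g \<in> L2 \<and> (AE x in lborel. f x = g x))"
    by (rule sympI) auto
  show "transp (\<lambda>f g::'a\<Rightarrow>complex. f \<in> L2 \<and> g \<in> L2 \<and> (AE x in lborel. f x = g x))"
    by (rule transpI) auto
qed

instantiation l2 :: (euclidean_space) real_inner
begin

lift_definition zero_l2 :: "'a l2" is "\<lambda>x. 0" by simp

lift_definition plus_l2 :: "'a l2 \<Rightarrow> 'a l2 \<Rightarrow> 'a l2" is "\<lambda>f g x. f x + g x"
  by (auto intro: L2_add)

lift_definition minus_l2 :: "'a l2 \<Rightarrow> 'a l2 \<Rightarrow> 'a l2" is "\<lambda>f g x. f x - g x"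
  by (auto intro: L2_diff)

lift_definition uminus_l2 :: "'a l2 \<Rightarrow> 'a l2" is "\<lambda>f x. - f x"
  by (auto intro: L2_uminus)

lift_definition scaleR_l2 :: "real \<Rightarrow> 'a l2 \<Rightarrow> 'a l2" is "\<lambda>c f x. c *\<^sub>R f x"
  by (auto intro: L2_scaleR)

lift_definition inner_l2 :: "'a l2 \<Rightarrow> 'a l2 \<Rightarrow> real" is "\<lambda>f g. LINT x|lborel. f x \<bullet> g x"
proof -
  fix f g h k :: "'a \<Rightarrow> complex"
  assume a: "f \<in> L2 \<and> g \<in> L2 \<and> (AE x in lborel. f x = g x)"
  assume b: "h \<in> L2 \<and> k \<in> L2 \<and> (AE x in lborel. h x = k x)"
  have "AE x in lborel. f x \<bullet> h x = g x \<bullet> k x"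
    using conjunct2[OF conjunct2[OF a]] conjunct2[OF conjunct2[OF b]] by eventually_elim simp
  then show "(LINT x|lborel. f x \<bullet> h x) = (LINT x|lborel. g x \<bullet> k x)"
    using a b L2_D(1)[of f] L2_D(1)[of g] L2_D(1)[of h] L2_D(1)[of k]
    by (intro integral_cong_AE) (auto intro!: borel_measurable_inner)
qed

definition norm_l2 :: "'a l2 \<Rightarrow> real" where "norm_l2 f = sqrt (f \<bullet> f)"
definition dist_l2 :: "'a l2 \<Rightarrow> 'a l2 \<Rightarrow> real" where "dist_l2 f g = norm (f - g)"
definition sgn_l2 :: "'a l2 \<Rightarrow> 'a l2" where "sgn_l2 f = scaleR (inverse (norm f)) f"
definition uniformity_l2 :: "('a l2 \<times> 'a l2) filter"
  where "uniformity_l2 = (INF e\<in>{0<..}. principal {(x, y). dist x y < e})"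
definition open_l2 :: "'a l2 set \<Rightarrow> bool"
  where "open_l2 U = (\<forall>x\<in>U. \<forall>\<^sub>F (x', y) in uniformity. x' = x \<longrightarrow> y \<in> U)"

instance
proof
  fix a b c :: "'a l2" and r t :: real
  show "a + b + c = a + (b + c)" by transfer (auto intro!: L2_add simp: algebra_simps)
  show "a + b = b + a" by transfer (auto intro!: L2_add simp: algebra_simps)
  show "0 + a = a" by transfer auto
  show "- a + a = 0" by transfer auto
  show "a - b = a + - b" by transfer (auto intro!: L2_add L2_diff L2_uminus)
  show "r *\<^sub>R (a + b) = r *\<^sub>R a + r *\<^sub>R b" by transfer (auto intro!: L2_add L2_scaleR simp: scaleR_add_right)
  show "(r + t) *\<^sub>R a = r *\<^sub>R a + t *\<^sub>R a" by transfer (auto intro!: L2_add L2_scaleR simp: scaleR_add_left)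
  show "r *\<^sub>R t *\<^sub>R a = (r * t) *\<^sub>R a" by transfer (auto intro!: L2_scaleR)
  show "1 *\<^sub>R a = a" by transfer auto
  show "dist a b = norm (a - b)" by (simp add: dist_l2_def)
  show "sgn a = inverse (norm a) *\<^sub>R a" by (simp add: sgn_l2_def)
  show "(uniformity :: ('a l2 \<times> 'a l2) filter) = (INF e\<in>{0<..}. principal {(x, y). dist x y < e})"
    by (simp add: uniformity_l2_def)
  show "open U = (\<forall>x\<in>U. \<forall>\<^sub>F (x', y) in uniformity. x' = x \<longrightarrow> y \<in> U)" for U :: "'a l2 set"
    by (simp add: open_l2_def)
  show "a \<bullet> b = b \<bullet> a" by transfer (simp add: inner_commute)
  show "(a + b) \<bullet> c = a \<bullet> c + b \<bullet> c"
    by transfer (auto simp: inner_add_left L2_integrable_inner)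
  show "(r *\<^sub>R a) \<bullet> b = r * (a \<bullet> b)" by transfer simp
  show "0 \<le> a \<bullet> a" by transfer simp
  show "(a \<bullet> a = 0) = (a = 0)"
  proof transfer
    fix f :: "'a \<Rightarrow> complex" assume f: "f \<in> L2 \<and> f \<in> L2 \<and> (AE x in lborel. f x = f x)"
    then have "(LINT x|lborel. f x \<bullet> f x) = 0 \<longleftrightarrow> (AE x in lborel. f x \<bullet> f x = 0)"
      by (intro integral_nonneg_eq_0_iff_AE) (auto intro: L2_integrable_inner)
    then show "((LINT x|lborel. f x \<bullet> f x) = 0) = (f \<in> L2 \<and> (\<lambda>x. 0) \<in> L2 \<and> (AE x in lborel. f x = 0))"
      using f by simp
  qed
  show "norm a = sqrt (a \<bullet> a)" by (simp add: norm_l2_def)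
qed

end

definition rep_l2 :: "'a::euclidean_space l2 \<Rightarrow> 'a \<Rightarrow> complex" where
  "rep_l2 F = (SOME f. f \<in> L2 \<and> cls f = F)"

lemma l2_cases: 
  obtains f where "f \<in> L2" "F = cls f"
proof -
  have "\<exists>f. f \<in> L2 \<and> F = cls f"
    by (induction F rule: l2.abs_induct) auto
  then show thesis using that by auto
qed

lemma rep_l2 [simp]: "rep_l2 F \<in> L2" "cls (rep_l2 F) = F"
proof -
  have "\<exists>f. f \<in> L2 \<and> cls f = F" by (rule l2_cases[of F]) auto
  from someI_ex[OF this] show "rep_l2 F \<in> L2" "cls (rep_l2 F) = F" by (auto simp: rep_l2_def)
qed

lemma cls_eq_iff: "f \<in> L2 \<Longrightarrow> g \<in> L2 \<Longrightarrow> cls f = cls g \<longleftrightarrow> (AE x in lborel. f x = g x)"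
  using Quotient_rel[OF Quotient_l2, of f g] by auto

lemma cls_eqI: "f \<in> L2 \<Longrightarrow> g \<in> L2 \<Longrightarrow> (AE x in lborel. f x = g x) \<Longrightarrow> cls f = cls g"
  by (simp add: cls_eq_iff)

lemma rep_cls: "f \<in> L2 \<Longrightarrow> AE x in lborel. rep_l2 (cls f) x = f x"
  using cls_eq_iff[of "rep_l2 (cls f)" f] by simp

lemma cls_zero: "cls (\<lambda>x. 0) = 0" by (simp add: zero_l2.abs_eq)
lemma cls_add: "f \<in> L2 \<Longrightarrow> g \<in> L2 \<Longrightarrow> cls (\<lambda>x. f x + g x) = cls f + cls g" 
  by (subst plus_l2.abs_eq) auto
lemma cls_diff: "f \<in> L2 \<Longrightarrow> g \<in> L2 \<Longrightarrow> cls (\<lambda>x. f x - g x) = cls f - cls g" 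
  by (subst minus_l2.abs_eq) auto
lemma cls_scaleR: "f \<in> L2 \<Longrightarrow> cls (\<lambda>x. c *\<^sub>R f x) = c *\<^sub>R cls f" 
  by (subst scaleR_l2.abs_eq) auto
lemma inner_cls: "f \<in> L2 \<Longrightarrow> g \<in> L2 \<Longrightarrow> cls f \<bullet> cls g = (LINT x|lborel. f x \<bullet> g x)" 
  by (subst inner_l2.abs_eq) auto
lemma norm_cls: "f \<in> L2 \<Longrightarrow> norm (cls f) = L2_norm f"
  by (simp add: norm_l2_def inner_cls L2_norm_def power2_norm_eq_inner)
lemma norm_cls_sq: "f \<in> L2 \<Longrightarrow> (norm (cls f))\<^sup>2 = (LINT x|lborel. (cmod (f x))\<^sup>2)"
  by (simp add: power2_norm_eq_inner inner_cls)

lemma norm_cls_le: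
  assumes "f \<in> L2" "g \<in> L2" "AE x in lborel. cmod (f x) \<le> c * cmod (g x)" "0 \<le> c"
  shows "norm (cls f) \<le> c * norm (cls g)"
proof -
  have "(norm (cls f))\<^sup>2 \<le> (LINT x|lborel. c\<^sup>2 * (cmod (g x))\<^sup>2)"
    unfolding norm_cls_sq[OF assms(1)]
  proof (rule integral_mono_AE)
    show "AE x in lborel. (cmod (f x))\<^sup>2 \<le> c\<^sup>2 * (cmod (g x))\<^sup>2"
      using assms(3) by eventually_elim (metis norm_ge_zero power_mono power_mult_distrib)
  qed (use assms L2_D in auto)
  also have "\<dots> = (c * norm (cls g))\<^sup>2"
    by (simp add: norm_cls_sq[OF assms(2)] power_mult_distrib)
  finally show ?thesis using assms(4) by (auto intro: power2_le_imp_le)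
qed

lemma nn_integral_norm_cls:
  "f \<in> L2 \<Longrightarrow> (\<integral>\<^sup>+x. ennreal ((cmod (f x))\<^sup>2) \<partial>lborel) = ennreal ((norm (cls f))\<^sup>2)"
  by (subst nn_integral_eq_integral) (auto simp: norm_cls_sq dest: L2_D)

text \<open>Fatou's lemma produces bounds for non-negative integrals; this turns such a bound into
  membership in \<open>L2\<close>.\<close>
lemma L2_nn_bound:
  assumes "f \<in> borel_measurable borel" "(\<integral>\<^sup>+x. ennreal ((cmod (f x))\<^sup>2) \<partial>lborel) \<le> ennreal (c\<^sup>2)" "0 \<le> c"
  shows "f \<in> L2" "norm (cls f) \<le> c"
proof -
  show f: "f \<in> L2"
    by (rule L2_I[OF assms(1)], rule integrableI_bounded)
       (use assms in \<open>auto simp: power2_eq_square[symmetric] intro: le_less_trans\<close>)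
  have "(norm (cls f))\<^sup>2 \<le> c\<^sup>2"
    using assms(2) unfolding nn_integral_norm_cls[OF f] by simp
  then show "norm (cls f) \<le> c" using assms(3) power2_le_imp_le by blast
qed

text \<open>The proof of Riesz and Fischer: along a subsequence with increments of norm at most \<open>2\<^sup>-\<^sup>k\<close>
  the representatives converge almost everywhere, and Fatou's lemma identifies the limit in norm.\<close>
instance l2 :: (euclidean_space) complete_space
proof
  fix X :: "nat \<Rightarrow> 'a l2" assume X: "Cauchy X"
  have "\<forall>k. \<exists>N. \<forall>m\<ge>N. \<forall>n\<ge>N. dist (X m) (X n) < (1/2)^k"
    using X by (auto simp: Cauchy_def)
  then obtain N where N: "\<And>k m n. m \<ge> N k \<Longrightarrow> n \<ge> N k \<Longrightarrow> dist (X m) (X n) < (1/2)^k"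
    by metis
  define r where "r k = (\<Sum>i\<le>k. N i) + k" for k
  have r: "strict_mono r" by (rule strict_monoI_Suc) (simp add: r_def)
  have rN: "r j \<ge> N k" if "j \<ge> k" for j k
  proof -
    have "N k \<le> (\<Sum>i\<le>j. N i)" using that by (intro member_le_sum) auto
    then show ?thesis by (simp add: r_def)
  qed
  define f where "f k = rep_l2 (X (r k))" for k
  have f: "f k \<in> L2" "cls (f k) = X (r k)" for k by (auto simp: f_def)
  note fm [measurable] = L2_D(1)[OF f(1)]
  have fd: "norm (cls (\<lambda>x. f i x - f j x)) \<le> (1/2)^k" if "k \<le> i" "k \<le> j" for i j k
    using N[OF rN[OF that(1)] rN[OF that(2)]] by (simp add: cls_diff f dist_norm)
  have nnd: "(\<integral>\<^sup>+x. ennreal ((cmod (f i x - f j x))\<^sup>2) \<partial>lborel) \<le> ennreal (((1/2)^k)\<^sup>2)" if "k \<le> i" "k \<le> j" for i j k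
    unfolding nn_integral_norm_cls[OF L2_diff[OF f(1) f(1)]]
    by (intro ennreal_leI power_mono fd that) auto
  \<comment> \<open>The squared increments have integral at most \<open>4\<^sup>-\<^sup>k\<close>, so weights \<open>2\<^sup>k\<close> still leave a convergent series.\<close>
  have "(\<integral>\<^sup>+x. (\<Sum>k. ennreal (2^k * (cmod (f (Suc k) x - f k x))\<^sup>2)) \<partial>lborel) 
      = (\<Sum>k. \<integral>\<^sup>+x. ennreal (2^k * (cmod (f (Suc k) x - f k x))\<^sup>2) \<partial>lborel)"
    by (rule nn_integral_suminf) measurable
  also have "\<dots> \<le> (\<Sum>k. ennreal ((1/2)^k))"
  proof (rule suminf_le)
    fix k
    have "(\<integral>\<^sup>+x. ennreal (2^k * (cmod (f (Suc k) x - f k x))\<^sup>2) \<partial>lborel)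
      = ennreal (2^k) * (\<integral>\<^sup>+x. ennreal ((cmod (f (Suc k) x - f k x))\<^sup>2) \<partial>lborel)"
      by (subst nn_integral_cmult[symmetric]) (auto simp: ennreal_mult'')
    also have "\<dots> \<le> ennreal (2^k) * ennreal (((1/2)^k)\<^sup>2)"
      by (intro mult_left_mono nnd) auto
    also have "\<dots> = ennreal ((1/2)^k)"
      by (simp add: ennreal_mult'[symmetric] power2_eq_square power_mult_distrib[symmetric] mult.assoc[symmetric]
        del: ennreal_power)
    finally show "(\<integral>\<^sup>+x. ennreal (2^k * (cmod (f (Suc k) x - f k x))\<^sup>2) \<partial>lborel) \<le> ennreal ((1/2)^k)" .
  qed auto
  also have "\<dots> = ennreal (\<Sum>k. (1/2)^k)"
    by (intro suminf_ennreal2) auto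
  finally have fin: "(\<integral>\<^sup>+x. (\<Sum>k. ennreal (2^k * (cmod (f (Suc k) x - f k x))\<^sup>2)) \<partial>lborel) < \<infinity>"
    using le_less_trans by fastforce
  have "AE x in lborel. (\<Sum>k. ennreal (2^k * (cmod (f (Suc k) x - f k x))\<^sup>2)) \<noteq> \<infinity>"
    using fin by (intro nn_integral_PInf_AE borel_measurable_suminf_order borel_measurable_times measurable_compose[OF _ measurable_ennreal]) auto
  then have conv: "AE x in lborel. convergent (\<lambda>k. f k x)"
  proof eventually_elim
    case (elim x)
    define S where "S = enn2real (\<Sum>k. ennreal (2^k * (cmod (f (Suc k) x - f k x))\<^sup>2))"
    have S: "ennreal S = (\<Sum>k. ennreal (2^k * (cmod (f (Suc k) x - f k x))\<^sup>2))"
      using elim by (simp add: S_def less_top)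
    have bd: "norm (f (Suc k) x - f k x) \<le> sqrt S * (sqrt (1/2))^k" for k
    proof -
      have "ennreal (2^k * (cmod (f (Suc k) x - f k x))\<^sup>2) \<le> ennreal S"
      proof -
        define a where "a k = ennreal (2^k * (cmod (f (Suc k) x - f k x))\<^sup>2)" for k
        have "sum a {k} \<le> suminf a" by (rule sum_le_suminf) auto
        then have "a k \<le> suminf a" by simp
        then show ?thesis unfolding S a_def .
      qed
      then have "2^k * (cmod (f (Suc k) x - f k x))\<^sup>2 \<le> S"
        by (subst (asm) ennreal_le_iff) (auto simp: S_def simp del: ennreal_mult_le_mult_iff)
      then have "(cmod (f (Suc k) x - f k x))\<^sup>2 \<le> S * (1/2)^k"
        by (simp add: field_simps)
      then have "sqrt ((cmod (f (Suc k) x - f k x))\<^sup>2) \<le> sqrt (S * (1/2)^k)"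
        by (rule real_sqrt_le_mono)
      then show ?thesis by (simp add: real_sqrt_mult real_sqrt_power)
    qed
    have sm: "summable (\<lambda>k. sqrt S * (sqrt (1/2))^k)"
      by (intro summable_mult summable_geometric) auto
    have "summable (\<lambda>k. f (Suc k) x - f k x)"
      by (rule summable_comparison_test'[OF sm, where N=0]) (rule bd)
    then have "convergent (\<lambda>n. \<Sum>k<n. f (Suc k) x - f k x)" by (simp add: summable_iff_convergent)
    then have "convergent (\<lambda>n. f n x - f 0 x)" by (simp only: sum_lessThan_telescope[of "\<lambda>k. f k x"])
    from convergent_add[OF this convergent_const[of "f 0 x"]] show ?case by simp
  qed
  define g where "g x = lim (\<lambda>k. f k x)" for x
  have gm [measurable]: "g \<in> borel_measurable borel"
    unfolding g_def by measurable
  have lim: "AE x in lborel. (\<lambda>k. f k x) \<longlonglongrightarrow> g x"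
    using conv by eventually_elim (simp add: g_def convergent_LIMSEQ_iff)
  have nng: "(\<integral>\<^sup>+x. ennreal ((cmod (f k x - g x))\<^sup>2) \<partial>lborel) \<le> ennreal (((1/2)^k)\<^sup>2)" for k
  proof -
    have "(\<integral>\<^sup>+x. ennreal ((cmod (f k x - g x))\<^sup>2) \<partial>lborel) = (\<integral>\<^sup>+x. liminf (\<lambda>j. ennreal ((cmod (f k x - f j x))\<^sup>2)) \<partial>lborel)"
    proof (rule nn_integral_cong_AE)
      show "AE x in lborel. ennreal ((cmod (f k x - g x))\<^sup>2) = liminf (\<lambda>j. ennreal ((cmod (f k x - f j x))\<^sup>2))"
        using lim
      proof eventually_elim
        case (elim x)
        have "(\<lambda>j. ennreal ((cmod (f k x - f j x))\<^sup>2)) \<longlonglongrightarrow> ennreal ((cmod (f k x - g x))\<^sup>2)"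
          by (intro tendsto_ennrealI tendsto_intros elim)
        then show ?case using lim_imp_Liminf[OF sequentially_bot] by metis
      qed
    qed
    also have "\<dots> \<le> liminf (\<lambda>j. (\<integral>\<^sup>+x. ennreal ((cmod (f k x - f j x))\<^sup>2) \<partial>lborel))"
      by (intro nn_integral_liminf) measurable
    also have "\<dots> \<le> liminf (\<lambda>j. ennreal (((1/2)^k)\<^sup>2))"
      by (rule Liminf_mono) (auto intro!: eventually_sequentiallyI[of k] nnd simp del: ennreal_power)
    also have "\<dots> = ennreal (((1/2)^k)\<^sup>2)" by (simp add: Liminf_const)
    finally show ?thesis .
  qed
  have fg: "(\<lambda>x. f k x - g x) \<in> L2" "norm (cls (\<lambda>x. f k x - g x)) \<le> (1/2)^k" for k
    using L2_nn_bound[OF _ nng[of k]] by auto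
  have g: "g \<in> L2"
    using L2_diff[OF f(1)[of 0] fg(1)[of 0]] by simp
  have "(\<lambda>k. X (r k)) \<longlonglongrightarrow> cls g"
  proof (rule LIM_zero_cancel, rule Lim_null_comparison)
    show "\<forall>\<^sub>F k in sequentially. norm (X (r k) - cls g) \<le> (1/2)^k"
      using fg(2) by (simp add: cls_diff f g)
    show "(\<lambda>k. (1/2)^k :: real) \<longlonglongrightarrow> 0" by (rule LIMSEQ_power_zero) auto
  qed
  then have "X \<longlonglongrightarrow> cls g"
    using Cauchy_converges_subseq[OF X r, of "cls g"] by (simp add: o_def)
  then show "convergent X" by (auto simp: convergent_def)
qed

instance l2 :: (euclidean_space) banach ..

subsection \<open>Multiplication operators\<close>

definition Mult :: "('a::euclidean_space \<Rightarrow> complex) \<Rightarrow> 'a l2 \<Rightarrow> 'a l2" where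
  "Mult m F = cls (\<lambda>x. m x * rep_l2 F x)"

lemma Mult_cls: 
  assumes m: "ess_bdd m" and f: "f \<in> L2"
  shows "Mult m (cls f) = cls (\<lambda>x. m x * f x)"
  unfolding Mult_def
  by (rule cls_eqI) (use rep_cls[OF f] in \<open>auto intro!: L2_mult m f\<close>)

lemma norm_Mult_le:
  assumes m: "ess_bdd m" and C: "AE x in lborel. cmod (m x) \<le> C" "0 \<le> C"
  shows "norm (Mult m F) \<le> C * norm F"
proof (rule l2_cases[of F])
  fix f assume f: "f \<in> L2" "F = cls f"
  have "AE x in lborel. cmod (m x * f x) \<le> C * cmod (f x)"
    using C(1) by eventually_elim (auto simp: norm_mult intro: mult_right_mono)
  then show ?thesis using norm_cls_le[OF L2_mult[OF m f(1)] f(1) _ C(2)] by (simp add: f Mult_cls m)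
qed

lemma bounded_linear_Mult:
  assumes m: "ess_bdd m"
  shows "bounded_linear (Mult m)"
proof -
  obtain C where C: "AE x in lborel. cmod (m x) \<le> C" using m by (auto simp: ess_bdd_def)
  then have C': "AE x in lborel. cmod (m x) \<le> max C 0" by auto
  show ?thesis
  proof (rule bounded_linear_intro)
    fix F G :: "'a l2" and c :: real
    obtain f g where f: "f \<in> L2" "F = cls f" and g: "g \<in> L2" "G = cls g"
      using l2_cases by metis
    have mf: "(\<lambda>x. m x * f x) \<in> L2" "(\<lambda>x. m x * g x) \<in> L2" using L2_mult m f g by auto
    show "Mult m (F + G) = Mult m F + Mult m G"
      using cls_add[OF mf] 
      by (simp add: f g m Mult_cls cls_add[symmetric] L2_add distrib_left)
    show "Mult m (c *\<^sub>R F) = c *\<^sub>R Mult m F"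
      using cls_scaleR[OF mf(1)] by (simp add: f m Mult_cls cls_scaleR[symmetric] L2_scaleR)
    show "norm (Mult m F) \<le> norm F * max C 0"
      using norm_Mult_le[OF m C'] by (simp add: mult.commute)
  qed
qed

lemma tendsto_cls_dominated_seq:
  fixes f :: "nat \<Rightarrow> 'a::euclidean_space \<Rightarrow> complex"
  assumes f: "\<And>i. f i \<in> L2" and g: "g \<in> L2" and h: "h \<in> L2"
    and lim: "AE x in lborel. (\<lambda>i. f i x) \<longlonglongrightarrow> g x"
    and dom: "\<And>i. AE x in lborel. cmod (f i x) \<le> cmod (h x)"
  shows "(\<lambda>i. cls (f i)) \<longlonglongrightarrow> cls g"
proof -
  have "((\<lambda>i. LINT x|lborel. (cmod (f i x - g x))\<^sup>2) \<longlonglongrightarrow> (LINT (x::'a)|lborel. 0))"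
  proof (rule integral_dominated_convergence[where w="\<lambda>x. (cmod (h x) + cmod (g x))\<^sup>2"])
    show "integrable lborel (\<lambda>x. (cmod (h x) + cmod (g x))\<^sup>2)"
    proof -
      have "(\<lambda>x. complex_of_real (cmod (h x)) + complex_of_real (cmod (g x))) \<in> L2"
        by (intro L2_add L2_I) (use L2_D[OF g] L2_D[OF h] in auto)
      from L2_D(2)[OF this] show ?thesis
        by (simp flip: of_real_add)
    qed
    show "AE x in lborel. norm ((cmod (f i x - g x))\<^sup>2) \<le> (cmod (h x) + cmod (g x))\<^sup>2" for i
      using dom[of i] by eventually_elim (auto intro!: power_mono order.trans[OF norm_triangle_ineq4])
    show "AE x in lborel. (\<lambda>i. (cmod (f i x - g x))\<^sup>2) \<longlonglongrightarrow> 0"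
      using lim by eventually_elim (auto intro!: tendsto_eq_intros)
  qed (use L2_D[OF g] L2_D[OF f] in auto)
  then have "((\<lambda>i. (norm (cls (f i) - cls g))\<^sup>2) \<longlonglongrightarrow> 0)"
    by (simp add: norm_cls_sq L2_diff f g flip: cls_diff)
  then have "((\<lambda>i. sqrt ((norm (cls (f i) - cls g))\<^sup>2)) \<longlonglongrightarrow> sqrt 0)"
    by (rule tendsto_real_sqrt)
  then have "((\<lambda>i. norm (cls (f i) - cls g)) \<longlonglongrightarrow> 0)" by simp
  then show ?thesis by (simp add: LIM_zero_iff tendsto_norm_zero_iff)
qed

text \<open>A limit \<open>\<epsilon> \<down> 0\<close> is handled by the substitution \<open>\<epsilon> = 1/i\<close>; hence the real index, with a
  majorant only for \<open>i > 0\<close>.\<close>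
lemma tendsto_cls_dominated:
  fixes f :: "real \<Rightarrow> 'a::euclidean_space \<Rightarrow> complex"
  assumes f: "\<And>i. f i \<in> L2" and g: "g \<in> L2" and h: "h \<in> L2"
    and lim: "AE x in lborel. ((\<lambda>i. f i x) \<longlongrightarrow> g x) at_top"
    and dom: "\<And>i. i > 0 \<Longrightarrow> AE x in lborel. cmod (f i x) \<le> cmod (h x)"
  shows "((\<lambda>i. cls (f i)) \<longlongrightarrow> cls g) at_top"
proof (rule tendsto_at_topI_sequentially)
  fix X :: "nat \<Rightarrow> real" assume X: "filterlim X at_top sequentially"
  obtain N where N: "\<And>n. n \<ge> N \<Longrightarrow> X n > 0"
    using X unfolding filterlim_at_top_dense eventually_sequentially by blast
  show "(\<lambda>n. cls (f (X n))) \<longlonglongrightarrow> cls g"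
  proof (rule LIMSEQ_offset[where k=N], rule tendsto_cls_dominated_seq[OF f g h])
    show "AE x in lborel. cmod (f (X (i + N)) x) \<le> cmod (h x)" for i
      by (rule dom[OF N]) auto
    have X': "filterlim (\<lambda>n. X (n + N)) at_top sequentially"
      by (rule filterlim_compose[OF X filterlim_add_const_nat_at_top])
    show "AE x in lborel. (\<lambda>i. f (X (i + N)) x) \<longlonglongrightarrow> g x"
      using lim by eventually_elim (rule filterlim_compose[OF _ X'])
  qed
qed

section \<open>Convolution\<close>

subsection \<open>Affine changes of variables and Fubini\<close>

lemma nn_integral_lborel_affine:
  fixes f :: "'a::euclidean_space \<Rightarrow> ennreal"
  assumes [measurable]: "f \<in> borel_measurable borel" and c: "c \<noteq> 0"
  shows "(\<integral>\<^sup>+x. f x \<partial>lborel) = ennreal (\<bar>c\<bar> ^ DIM('a)) * (\<integral>\<^sup>+x. f (t + c *\<^sub>R x) \<partial>lborel)"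
  by (subst lborel_affine[OF c, of t])
     (simp add: nn_integral_density nn_integral_distr nn_integral_cmult)

lemma integrable_lborel_affine:
  fixes f :: "'a::euclidean_space \<Rightarrow> 'b::{banach, second_countable_topology}"
  assumes f: "integrable lborel f" and c: "c \<noteq> 0"
  shows "integrable lborel (\<lambda>x. f (t + c *\<^sub>R x))"
  using f f[THEN borel_measurable_integrable] c unfolding integrable_iff_bounded
  by (subst (asm) nn_integral_lborel_affine[where c=c and t=t]) (auto simp: ennreal_mult_less_top)

lemma integral_lborel_affine:
  fixes f :: "'a::euclidean_space \<Rightarrow> 'b::{banach, second_countable_topology}"
  assumes c: "c \<noteq> 0" 
  shows "(LINT x|lborel. f x) = \<bar>c\<bar> ^ DIM('a) *\<^sub>R (LINT x|lborel. f (t + c *\<^sub>R x))"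
proof (cases "integrable lborel f")
  case True
  note f[measurable] = True
  from c f f[THEN borel_measurable_integrable] f[THEN integrable_lborel_affine, of c t]
  show ?thesis
    by (subst lborel_affine[OF c, of t]) (simp add: integral_density integral_distr)
next
  case False
  have "\<not> integrable lborel (\<lambda>x. f (t + c *\<^sub>R x))"
  proof
    assume "integrable lborel (\<lambda>x. f (t + c *\<^sub>R x))"
    from integrable_lborel_affine[OF this, of "1/c" "- (1/c) *\<^sub>R t"] c
    have "integrable lborel (\<lambda>x. f (t + c *\<^sub>R (- (1 / c) *\<^sub>R t + (1 / c) *\<^sub>R x)))" by simp
    moreover have "t + c *\<^sub>R (- (1 / c) *\<^sub>R t + (1 / c) *\<^sub>R x) = x" for x
      using c by (simp only: scaleR_add_right scaleR_scaleR) simp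
    ultimately have "integrable lborel f" by simp
    with False show False by simp
  qed
  with False show ?thesis by (simp add: not_integrable_integral_eq)
qed

lemma nn_integral_lborel_reflect:
  fixes f :: "'a::euclidean_space \<Rightarrow> ennreal"
  assumes "f \<in> borel_measurable borel"
  shows "(\<integral>\<^sup>+y. f (x - y) \<partial>lborel) = (\<integral>\<^sup>+y. f y \<partial>lborel)"
  using nn_integral_lborel_affine[OF assms, of "-1" x] by simp

lemma nn_integral_lborel_shift:
  fixes f :: "'a::euclidean_space \<Rightarrow> ennreal"
  assumes "f \<in> borel_measurable borel"
  shows "(\<integral>\<^sup>+y. f (y - x) \<partial>lborel) = (\<integral>\<^sup>+y. f y \<partial>lborel)"
  using nn_integral_lborel_affine[OF assms, of "1" "-x"] by simp

lemma integral_lborel_reflect: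
  fixes f :: "'a::euclidean_space \<Rightarrow> 'b::{banach, second_countable_topology}"
  shows "(LINT y|lborel. f (x - y)) = (LINT y|lborel. f y)"
  using integral_lborel_affine[of "-1" f x] by simp

lemma integral_lborel_shift:
  fixes f :: "'a::euclidean_space \<Rightarrow> 'b::{banach, second_countable_topology}"
  shows "(LINT y|lborel. f (y - x)) = (LINT y|lborel. f y)"
  using integral_lborel_affine[of 1 f "-x"] by simp

lemma integrable_lborel_reflect:
  fixes f :: "'a::euclidean_space \<Rightarrow> 'b::{banach, second_countable_topology}"
  assumes "integrable lborel f" shows "integrable lborel (\<lambda>y. f (x - y))"
  using integrable_lborel_affine[OF assms, of "-1" x] by simp

lemma integrable_lborel_shift:
  fixes f :: "'a::euclidean_space \<Rightarrow> 'b::{banach, second_countable_topology}"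
  assumes "integrable lborel f" shows "integrable lborel (\<lambda>y. f (y - x))"
  using integrable_lborel_affine[OF assms, of 1 "-x"] by simp

text \<open>Every use of Fubini's theorem with an oscillating or bounded factor goes through this
  majorant.\<close>
lemma integrable_lborel_pair_bound:
  fixes h :: "'a::euclidean_space \<Rightarrow> 'b::euclidean_space \<Rightarrow> complex"
    and f :: "'a \<Rightarrow> complex" and g :: "'b \<Rightarrow> complex"
  assumes h: "case_prod h \<in> borel_measurable (lborel \<Otimes>\<^sub>M lborel)"
    and f: "integrable lborel f" and g: "integrable lborel g"
    and bd: "\<And>x y. cmod (h x y) \<le> C * (cmod (f x) * cmod (g y))"
  shows "integrable (lborel \<Otimes>\<^sub>M lborel) (case_prod h)"
proof (rule Bochner_Integration.integrable_bound[OF _ h])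
  note [measurable] = borel_measurable_integrable[OF f] borel_measurable_integrable[OF g]
  show "integrable (lborel \<Otimes>\<^sub>M lborel) (\<lambda>p. C * (cmod (f (fst p)) * cmod (g (snd p))))"
  proof (rule integrable_mult_right, rule lborel_pair.Fubini_integrable)
    show "integrable lborel (\<lambda>x. LINT y|lborel. norm (cmod (f (fst (x, y))) * cmod (g (snd (x, y)))))"
      using f by (simp add: norm_mult)
    show "AE x in lborel. integrable lborel (\<lambda>y. cmod (f (fst (x, y))) * cmod (g (snd (x, y))))"
      using g by simp
  qed measurable
  show "AE p in lborel \<Otimes>\<^sub>M lborel. norm (case_prod h p) \<le> norm (C * (cmod (f (fst p)) * cmod (g (snd p))))"
    using bd by (intro AE_I2) (auto intro: order.trans[OF _ abs_ge_self] simp: case_prod_beta)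
qed

subsection \<open>Truncation\<close>

definition bdd_supp :: "('a::euclidean_space \<Rightarrow> 'b::zero) \<Rightarrow> bool" where
  "bdd_supp f \<longleftrightarrow> (\<exists>R. \<forall>x. norm x > R \<longrightarrow> f x = 0)"

definition trunc :: "real \<Rightarrow> ('a::euclidean_space \<Rightarrow> complex) \<Rightarrow> 'a \<Rightarrow> complex" where
  "trunc R f x = indicator (cball 0 R) x * f x"

lemma ess_bdd_indicator: "A \<in> sets borel \<Longrightarrow> ess_bdd (indicator A)"
  by (rule ess_bdd_I[where C=1]) (auto simp: indicator_def)

lemma complex_indicator_measurable:
  "A \<in> sets borel \<Longrightarrow> (indicator A :: 'a::euclidean_space \<Rightarrow> complex) \<in> borel_measurable borel"
  using ess_bdd_indicator ess_bdd_def by blast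

lemma integrable_indicator_cball: "integrable lborel (indicator (cball (x::'a::euclidean_space) R) :: 'a \<Rightarrow> real)"
  using emeasure_lborel_cball_finite[of x R] by (auto simp: less_top)

lemma trunc_L2: "f \<in> L2 \<Longrightarrow> trunc R f \<in> L2"
  unfolding trunc_def by (intro L2_mult ess_bdd_indicator) auto

lemma trunc_bdd_supp: "bdd_supp (trunc R f)"
  unfolding bdd_supp_def trunc_def by (auto intro!: exI[of _ R])

lemma trunc_tendsto:
  assumes f: "f \<in> L2"
  shows "((\<lambda>R. cls (trunc R f)) \<longlongrightarrow> cls f) at_top"
proof (rule tendsto_cls_dominated[OF trunc_L2[OF f] f f])
  show "AE x in lborel. cmod (trunc i f x) \<le> cmod (f x)" for i
    by (intro AE_I2) (auto simp: trunc_def indicator_def)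
  show "AE x in lborel. ((\<lambda>i. trunc i f x) \<longlongrightarrow> f x) at_top"
  proof (intro AE_I2)
    fix x
    have "\<forall>\<^sub>F i in at_top. trunc i f x = f x"
      using eventually_ge_at_top[of "norm x"] by eventually_elim (auto simp: trunc_def indicator_def)
    then show "((\<lambda>i. trunc i f x) \<longlongrightarrow> f x) at_top"
      by (rule tendsto_eventually)
  qed
qed

lemma bdd_supp_L2_integrable:
  assumes f: "f \<in> L2" and "bdd_supp f"
  shows "integrable lborel f"
proof -
  obtain R where R: "\<And>x. norm x > R \<Longrightarrow> f x = 0" using assms by (auto simp: bdd_supp_def)
  have "(indicator (cball 0 R) :: 'a \<Rightarrow> complex) \<in> L2"
  proof (rule L2_bound[OF _ integrable_indicator_cball])
    show "AE x::'a in lborel. (cmod (indicator (cball 0 R) x))\<^sup>2 \<le> indicator (cball 0 R) x"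
      by (auto simp: indicator_def)
    show "(indicator (cball 0 R) :: 'a \<Rightarrow> complex) \<in> borel_measurable borel"
      by (rule complex_indicator_measurable) simp
  qed
  from L2_integrable_mult[OF this f]
  have "integrable lborel (\<lambda>x. indicator (cball 0 R) x * f x)" .
  also have "(\<lambda>x. indicator (cball 0 R) x * f x) = f"
  proof
    fix x show "indicator (cball 0 R) x * f x = f x"
      using R[of x] by (cases "norm x > R") (auto simp: indicator_def)
  qed
  finally show ?thesis .
qed

text \<open>Functions of bounded support are dense by truncation, and they are integrable. Identities
  between continuous operators therefore only need to be checked where all integrals converge
  absolutely.\<close>
lemma continuous_l2_eqI:
  fixes A B :: "'a::euclidean_space l2 \<Rightarrow> 'b::t2_space"
  assumes A: "continuous_on UNIV A" and B: "continuous_on UNIV B"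
    and eq: "\<And>f. f \<in> L2 \<Longrightarrow> integrable lborel f \<Longrightarrow> bdd_supp f \<Longrightarrow> A (cls f) = B (cls f)"
  shows "A F = B F"
proof -
  obtain f where f: "f \<in> L2" "F = cls f" by (rule l2_cases)
  have 1: "((\<lambda>R. A (cls (trunc R f))) \<longlongrightarrow> A F) at_top"
    unfolding f(2) by (rule continuous_on_tendsto_compose[OF A trunc_tendsto[OF f(1)]]) auto
  have 2: "((\<lambda>R. B (cls (trunc R f))) \<longlongrightarrow> B F) at_top"
    unfolding f(2) by (rule continuous_on_tendsto_compose[OF B trunc_tendsto[OF f(1)]]) auto
  have "A (cls (trunc R f)) = B (cls (trunc R f))" for R
    by (intro eq trunc_L2 bdd_supp_L2_integrable trunc_bdd_supp f)
  then show ?thesis using 1 2 tendsto_unique[OF trivial_limit_at_top_linorder] by simp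
qed

subsection \<open>Convolution operators\<close>

text \<open>Boundedness together with integrability puts \<open>k\<close> into \<open>L\<^sup>2\<close>, which makes the convolution with an
  \<open>L\<^sup>2\<close> function converge at every point.\<close>
definition kernel :: "('a::euclidean_space \<Rightarrow> real) \<Rightarrow> bool" where
  "kernel k \<longleftrightarrow> k \<in> borel_measurable borel \<and> integrable lborel k \<and> (\<exists>C. \<forall>x. \<bar>k x\<bar> \<le> C)"

lemma kernelD: 
  assumes "kernel k"
  shows "k \<in> borel_measurable borel" "integrable lborel k" "\<exists>C. \<forall>x. \<bar>k x\<bar> \<le> C"
  using assms by (auto simp: kernel_def)

lemma kernel_L2:
  assumes k: "kernel k"
  shows "(\<lambda>y. complex_of_real (k (x - y))) \<in> L2"
proof -
  obtain C where C: "\<And>x. \<bar>k x\<bar> \<le> C" using kernelD(3)[OF k] by auto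
  note [measurable] = kernelD(1)[OF k]
  show ?thesis
  proof (rule L2_bound)
    show "integrable lborel (\<lambda>y. C * \<bar>k (x - y)\<bar>)"
      using integrable_lborel_reflect[OF kernelD(2)[OF k], of x] by auto
    have "(k z)\<^sup>2 \<le> C * \<bar>k z\<bar>" for z
      using mult_right_mono[OF C[of z], of "\<bar>k z\<bar>"] by (simp add: power2_eq_square)
    then show "AE y in lborel. (cmod (complex_of_real (k (x - y))))\<^sup>2 \<le> C * \<bar>k (x - y)\<bar>"
      by simp
  qed measurable
qed

lemma convol_integrable:
  assumes k: "kernel k" and f: "f \<in> L2"
  shows "integrable lborel (\<lambda>y. k (x - y) *\<^sub>R (f y::complex))"
  using L2_integrable_mult[OF kernel_L2[OF k] f] by (simp add: scaleR_conv_of_real)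

lemma convol_measurable:
  fixes f :: "'a::euclidean_space \<Rightarrow> 'b::{banach, second_countable_topology}"
  assumes [measurable]: "k \<in> borel_measurable borel" "f \<in> borel_measurable borel"
  shows "convol f k \<in> borel_measurable borel"
proof -
  have "(\<lambda>x. LINT y|lborel. k (x - y) *\<^sub>R f y) \<in> borel_measurable lborel"
    by (rule lborel.borel_measurable_lebesgue_integral) measurable
  then show ?thesis by (simp add: convol_def[abs_def])
qed

text \<open>Young's inequality for an integrable kernel. Cauchy-Schwarz is applied to
  \<open>|k| |f| = |k|\<^bsup>1/2\<^esup> (|k|\<^bsup>1/2\<^esup> |f|)\<close>, and the double integral is then evaluated by Tonelli.\<close>
lemma convol_L2:
  assumes k: "kernel k" and f: "f \<in> L2"
  shows "convol f k \<in> L2" "norm (cls (convol f k)) \<le> (LINT x|lborel. \<bar>k x\<bar>) * norm (cls f)"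
proof -
  note [measurable] = kernelD(1)[OF k] L2_D(1)[OF f] convol_measurable[OF kernelD(1)[OF k] L2_D(1)[OF f]]
  define K where "K = (LINT x|lborel. \<bar>k x\<bar>)"
  have K0: "0 \<le> K" unfolding K_def by simp
  have kK: "(\<integral>\<^sup>+x. ennreal \<bar>k x\<bar> \<partial>lborel) = ennreal K"
    unfolding K_def using kernelD(2)[OF k] by (intro nn_integral_eq_integral) auto
  have pw: "ennreal ((cmod (convol f k x))\<^sup>2) \<le> ennreal K * (\<integral>\<^sup>+y. ennreal \<bar>k (x - y)\<bar> * ennreal ((cmod (f y))\<^sup>2) \<partial>lborel)" for x
  proof -
    have "ennreal (cmod (convol f k x)) \<le> (\<integral>\<^sup>+y. ennreal (cmod (k (x - y) *\<^sub>R f y)) \<partial>lborel)"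
      unfolding convol_def by (rule integral_norm_bound_ennreal[OF convol_integrable[OF k f]])
    also have "\<dots> = (\<integral>\<^sup>+y. ennreal (sqrt \<bar>k (x - y)\<bar>) * ennreal (sqrt \<bar>k (x - y)\<bar> * cmod (f y)) \<partial>lborel)"
      by (intro nn_integral_cong) (simp add: ennreal_mult'[symmetric] mult.assoc[symmetric])
    finally have "(ennreal (cmod (convol f k x)))\<^sup>2 \<le> \<dots>\<^sup>2"
      by (rule power_mono) simp
    also have "\<dots> \<le> (\<integral>\<^sup>+y. (ennreal (sqrt \<bar>k (x - y)\<bar>))\<^sup>2 \<partial>lborel) * (\<integral>\<^sup>+y. (ennreal (sqrt \<bar>k (x - y)\<bar> * cmod (f y)))\<^sup>2 \<partial>lborel)"
      by (rule Cauchy_Schwarz_nn_integral) measurable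
    also have "(\<integral>\<^sup>+y. (ennreal (sqrt \<bar>k (x - y)\<bar>))\<^sup>2 \<partial>lborel) = (\<integral>\<^sup>+y. ennreal \<bar>k (x - y)\<bar> \<partial>lborel)"
      by (simp add: ennreal_power)
    also have "\<dots> = ennreal K"
      using nn_integral_lborel_reflect[of "\<lambda>y. ennreal \<bar>k y\<bar>" x] kK by simp
    also have "(\<integral>\<^sup>+y. (ennreal (sqrt \<bar>k (x - y)\<bar> * cmod (f y)))\<^sup>2 \<partial>lborel) = (\<integral>\<^sup>+y. ennreal \<bar>k (x - y)\<bar> * ennreal ((cmod (f y))\<^sup>2) \<partial>lborel)"
      by (simp add: ennreal_power power_mult_distrib ennreal_mult')
    finally show ?thesis by (simp add: ennreal_power)
  qed
  have "(\<integral>\<^sup>+x. ennreal ((cmod (convol f k x))\<^sup>2) \<partial>lborel) \<le> (\<integral>\<^sup>+x. ennreal K * (\<integral>\<^sup>+y. ennreal \<bar>k (x - y)\<bar> * ennreal ((cmod (f y))\<^sup>2) \<partial>lborel) \<partial>lborel)"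
    by (rule nn_integral_mono) (rule pw)
  also have "\<dots> = ennreal K * (\<integral>\<^sup>+x. (\<integral>\<^sup>+y. ennreal \<bar>k (x - y)\<bar> * ennreal ((cmod (f y))\<^sup>2) \<partial>lborel) \<partial>lborel)"
    by (rule nn_integral_cmult) measurable
  also have "(\<integral>\<^sup>+x. (\<integral>\<^sup>+y. ennreal \<bar>k (x - y)\<bar> * ennreal ((cmod (f y))\<^sup>2) \<partial>lborel) \<partial>lborel)
     = (\<integral>\<^sup>+y. (\<integral>\<^sup>+x. ennreal \<bar>k (x - y)\<bar> * ennreal ((cmod (f y))\<^sup>2) \<partial>lborel) \<partial>lborel)"
    by (rule lborel_pair.Fubini') measurable
  also have "\<dots> = (\<integral>\<^sup>+y. ennreal K * ennreal ((cmod (f y))\<^sup>2) \<partial>lborel)"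
    using nn_integral_lborel_shift[of "\<lambda>y. ennreal \<bar>k y\<bar>"] kK by (simp add: nn_integral_multc)
  also have "\<dots> = ennreal K * ennreal ((norm (cls f))\<^sup>2)"
    by (simp add: nn_integral_cmult nn_integral_norm_cls[OF f] del: ennreal_power)
  also have "ennreal K * \<dots> = ennreal ((K * norm (cls f))\<^sup>2)"
    using K0 by (simp add: ennreal_mult'[symmetric] power_mult_distrib power2_eq_square mult_ac del: ennreal_power)
  finally have *: "(\<integral>\<^sup>+x. ennreal ((cmod (convol f k x))\<^sup>2) \<partial>lborel) \<le> ennreal ((K * norm (cls f))\<^sup>2)" .
  from L2_nn_bound[OF _ *] K0
  show "convol f k \<in> L2" "norm (cls (convol f k)) \<le> K * norm (cls f)" by auto
qed

lemma convol_cong_AE: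
  assumes "k \<in> borel_measurable borel" "f \<in> borel_measurable borel" "g \<in> borel_measurable borel"
    "AE x in lborel. f x = g x"
  shows "convol f k x = convol g k x"
proof -
  note [measurable] = assms(1-3)
  show ?thesis unfolding convol_def
    by (rule integral_cong_AE) (use assms(4) in \<open>auto\<close>)
qed

definition Conv :: "('a::euclidean_space \<Rightarrow> real) \<Rightarrow> 'a l2 \<Rightarrow> 'a l2" where
  "Conv k F = cls (convol (rep_l2 F) k)"

lemma Conv_cls:
  assumes k: "kernel k" and f: "f \<in> L2"
  shows "Conv k (cls f) = cls (convol f k)"
  unfolding Conv_def
  using convol_cong_AE[OF kernelD(1)[OF k] L2_D(1)[OF rep_l2(1)] L2_D(1)[OF f] rep_cls[OF f]]
  by (intro cls_eqI convol_L2 k f) auto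

lemma norm_Conv_le:
  assumes k: "kernel k" 
  shows "norm (Conv k F) \<le> (LINT x|lborel. \<bar>k x\<bar>) * norm F"
  by (rule l2_cases[of F]) (simp add: Conv_cls[OF k] convol_L2[OF k])

lemma bounded_linear_Conv:
  assumes k: "kernel k"
  shows "bounded_linear (Conv k)"
proof (rule bounded_linear_intro)
  fix F G :: "'a l2" and c :: real
  obtain f g where f: "f \<in> L2" "F = cls f" and g: "g \<in> L2" "G = cls g"
    using l2_cases by metis
  have "convol (\<lambda>x. f x + g x) k = (\<lambda>x. convol f k x + convol g k x)"
    by (simp add: convol_def fun_eq_iff scaleR_add_right convol_integrable[OF k] f g)
  then show "Conv k (F + G) = Conv k F + Conv k G"
    using cls_add[OF convol_L2(1)[OF k f(1)] convol_L2(1)[OF k g(1)]]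
    by (simp add: f g Conv_cls[OF k] cls_add[symmetric] L2_add)
  have "convol (\<lambda>x. c *\<^sub>R f x) k = (\<lambda>x. c *\<^sub>R convol f k x)"
  proof
    fix x
    have "k (x - y) *\<^sub>R c *\<^sub>R f y = c *\<^sub>R (k (x - y) *\<^sub>R f y)" for y by simp
    then show "convol (\<lambda>x. c *\<^sub>R f x) k x = c *\<^sub>R convol f k x"
      by (simp only: convol_def integral_scaleR_right)
  qed
  then show "Conv k (c *\<^sub>R F) = c *\<^sub>R Conv k F"
    using cls_scaleR[OF convol_L2(1)[OF k f(1)]] 
    by (simp add: f Conv_cls[OF k] cls_scaleR[symmetric] L2_scaleR)
  show "norm (Conv k F) \<le> norm F * (LINT x|lborel. \<bar>k x\<bar>)"
    using norm_Conv_le[OF k] by (simp add: mult.commute)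
qed

lemma Conv_Mult_const:
  assumes k: "kernel k"
  shows "Conv k (Mult (\<lambda>x. c) F) = Mult (\<lambda>x. c) (Conv k F)"
proof -
  obtain f where f: "f \<in> L2" "F = cls f" using l2_cases by metis
  have "convol (\<lambda>x. c * f x) k = (\<lambda>x. c * convol f k x)"
  proof
    fix x
    have "k (x - y) *\<^sub>R (c * f y) = c * (k (x - y) *\<^sub>R f y)" for y by simp
    then show "convol (\<lambda>x. c * f x) k x = c * convol f k x"
      by (simp only: convol_def integral_mult_right_zero)
  qed
  then show ?thesis
    by (simp add: f Conv_cls[OF k] Mult_cls L2_cmult convol_L2[OF k])
qed

lemma Conv_inner_commute:
  assumes k: "kernel k" and even: "\<And>x. k (- x) = k x"
  shows "Conv k F \<bullet> G = F \<bullet> Conv k G"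
proof (rule continuous_l2_eqI[where A="\<lambda>F. Conv k F \<bullet> G" and B="\<lambda>F. F \<bullet> Conv k G"])
  note cont = linear_continuous_on[OF bounded_linear_Conv[OF k]]
  show "continuous_on UNIV (\<lambda>F. Conv k F \<bullet> G)" "continuous_on UNIV (\<lambda>F. F \<bullet> Conv k G)"
    by (intro continuous_intros cont)+
  fix f :: "'a \<Rightarrow> complex" assume f: "f \<in> L2" "integrable lborel f"
  show "Conv k (cls f) \<bullet> G = cls f \<bullet> Conv k G"
  proof (rule continuous_l2_eqI[where A="\<lambda>G. Conv k (cls f) \<bullet> G" and B="\<lambda>G. cls f \<bullet> Conv k G"])
    show "continuous_on UNIV (\<lambda>G. Conv k (cls f) \<bullet> G)" "continuous_on UNIV (\<lambda>G. cls f \<bullet> Conv k G)"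
      by (intro continuous_intros cont)+
    fix g :: "'a \<Rightarrow> complex" assume g: "g \<in> L2" "integrable lborel g"
    obtain C where C: "\<And>x. \<bar>k x\<bar> \<le> C" using kernelD(3)[OF k] by auto
    note [measurable] = kernelD(1)[OF k] L2_D(1)[OF f(1)] L2_D(1)[OF g(1)]
    have "integrable (lborel \<Otimes>\<^sub>M lborel) (\<lambda>(x, y). complex_of_real (k (x - y)) * (g x * cnj (f y)))"
    proof (rule integrable_lborel_pair_bound[OF _ g(2) f(2)])
      show "(\<lambda>(x, y). complex_of_real (k (x - y)) * (g x * cnj (f y))) \<in> borel_measurable (lborel \<Otimes>\<^sub>M lborel)"
        by measurable
      show "cmod (complex_of_real (k (x - y)) * (g x * cnj (f y))) \<le> C * (cmod (g x) * cmod (f y))" for x y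
        using C by (auto simp: norm_mult intro!: mult_right_mono)
    qed
    then have "integrable (lborel \<Otimes>\<^sub>M lborel) (\<lambda>p. Re (case_prod (\<lambda>x y. complex_of_real (k (x - y)) * (g x * cnj (f y))) p))"
      by (rule integrable_Re)
    also have "(\<lambda>p. Re (case_prod (\<lambda>x y. complex_of_real (k (x - y)) * (g x * cnj (f y))) p))
       = (\<lambda>(x, y). k (x - y) * (f y \<bullet> g x))"
      by (auto simp: inner_complex_def algebra_simps)
    finally have int: "integrable (lborel \<Otimes>\<^sub>M lborel) (\<lambda>(x, y). k (x - y) * (f y \<bullet> g x))" .
    have "Conv k (cls f) \<bullet> cls g = (LINT x|lborel. LINT y|lborel. k (x - y) * (f y \<bullet> g x))"
      using convol_integrable[OF k f(1)]
      by (simp add: Conv_cls[OF k] f g inner_cls convol_L2[OF k] convol_def inner_left_distrib flip: integral_inner_left)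
    also have "\<dots> = (LINT y|lborel. LINT x|lborel. k (x - y) * (f y \<bullet> g x))"
      by (rule lborel_pair.Fubini_integral[symmetric]) (rule int)
    also have "\<dots> = (LINT y|lborel. LINT x|lborel. k (y - x) * (f y \<bullet> g x))"
    proof -
      have "k (x - y) = k (y - x)" for x y using even[of "y - x"] by simp
      then show ?thesis by (intro Bochner_Integration.integral_cong refl arg_cong2[where f="(*)"])
    qed
    also have "\<dots> = cls f \<bullet> Conv k (cls g)"
      using convol_integrable[OF k g(1)]
      by (simp add: Conv_cls[OF k] f g inner_cls convol_L2[OF k] convol_def flip: integral_inner_right)
    finally show "Conv k (cls f) \<bullet> cls g = cls f \<bullet> Conv k (cls g)" .
  qed
qed

subsection \<open>Mollifiers are approximate identities\<close>

lemma test_function_props: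
  fixes k :: "'a::euclidean_space \<Rightarrow> 'b::real_normed_vector"
  assumes "k \<in> test_functions \<Omega>"
  shows "continuous_on UNIV k" "compact (closure {x. k x \<noteq> 0})" "bdd_supp k" "Ck n k"
proof -
  have "Ck 0 k" using assms unfolding test_functions_def by blast
  then show "continuous_on UNIV k" by simp
  show c: "compact (closure {x. k x \<noteq> 0})" "Ck n k" using assms unfolding test_functions_def by blast+
  from bounded_subset[OF compact_imp_bounded[OF c(1)] closure_subset] have "bounded {x. k x \<noteq> 0}" .
  then obtain B where "\<And>x. k x \<noteq> 0 \<Longrightarrow> norm x \<le> B" unfolding bounded_iff by blast
  then show "bdd_supp k" unfolding bdd_supp_def by (meson not_le)
qed

lemma continuous_bdd_supp_bounded:
  fixes k :: "'a::euclidean_space \<Rightarrow> 'b::real_normed_vector"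
  assumes c: "continuous_on UNIV k" and b: "bdd_supp k"
  shows "\<exists>C. \<forall>x. norm (k x) \<le> C"
proof -
  obtain R where R: "\<And>x. norm x > R \<Longrightarrow> k x = 0" using b by (auto simp: bdd_supp_def)
  have "compact (k ` cball 0 R)"
    by (intro compact_continuous_image continuous_on_subset[OF c]) auto
  then obtain C where C: "\<And>x. norm x \<le> R \<Longrightarrow> norm (k x) \<le> C"
    by (force dest: compact_imp_bounded simp: bounded_iff)
  have "norm (k x) \<le> max C 0" for x
    using C[of x] R[of x] by (cases "norm x > R") auto
  then show ?thesis by blast
qed

lemma continuous_bdd_supp_L2:
  fixes k :: "'a::euclidean_space \<Rightarrow> complex"
  assumes c: "continuous_on UNIV k" and b: "bdd_supp k"
  shows "k \<in> L2"
proof -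
  obtain R where R: "\<And>x. norm x > R \<Longrightarrow> k x = 0" using b by (auto simp: bdd_supp_def)
  obtain C where C: "\<And>x. norm (k x) \<le> C" using continuous_bdd_supp_bounded[OF c b] by auto
  show ?thesis
  proof (rule L2_bound)
    show "k \<in> borel_measurable borel" by (rule borel_measurable_continuous_onI[OF c])
    show "integrable lborel (\<lambda>x::'a. C\<^sup>2 * indicator (cball 0 R) x)"
      by (intro integrable_mult_right integrable_indicator_cball)
    have "(cmod (k x))\<^sup>2 \<le> C\<^sup>2 * indicator (cball 0 R) x" for x
      using C[of x] R[of x] by (cases "norm x > R") (auto simp: indicator_def intro!: power_mono)
    then show "AE x in lborel. (cmod (k x))\<^sup>2 \<le> C\<^sup>2 * indicator (cball 0 R) x" by auto
  qed
qed

lemma kernelI: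
  assumes c: "continuous_on UNIV k" and b: "bdd_supp k"
  shows "kernel k"
proof -
  have c': "continuous_on UNIV (\<lambda>x. complex_of_real (k x))" by (intro continuous_intros c)
  have b': "bdd_supp (\<lambda>x. complex_of_real (k x))" using b by (auto simp: bdd_supp_def)
  have "integrable lborel (\<lambda>x. complex_of_real (k x))"
    by (rule bdd_supp_L2_integrable[OF continuous_bdd_supp_L2[OF c' b'] b'])
  then have "integrable lborel (\<lambda>x. Re (complex_of_real (k x)))" by (rule integrable_Re)
  then show ?thesis unfolding kernel_def
    using continuous_bdd_supp_bounded[OF c b] borel_measurable_continuous_onI[OF c] by simp
qed

lemma kernel_test_function: "k \<in> test_functions \<Omega> \<Longrightarrow> kernel k"
  using kernelI[OF test_function_props(1) test_function_props(3)] by blast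

lemma mollifying_net_kernel:
  assumes k: "kernel k" and e: "\<epsilon> > 0"
  shows "kernel (mollifying_net k \<epsilon>)"
proof -
  note [measurable] = kernelD(1)[OF k]
  obtain C where C: "\<And>x. \<bar>k x\<bar> \<le> C" using kernelD(3)[OF k] by auto
  have "integrable lborel (\<lambda>x. k (0 + inverse \<epsilon> *\<^sub>R x))"
    by (rule integrable_lborel_affine[OF kernelD(2)[OF k]]) (use e in simp)
  then have "integrable lborel (mollifying_net k \<epsilon>)"
    unfolding mollifying_net_def[abs_def] by (intro integrable_divide_zero) simp
  moreover have "\<bar>mollifying_net k \<epsilon> x\<bar> \<le> C / \<epsilon> ^ DIM('a)" for x
    using C e by (simp add: mollifying_net_def divide_right_mono)
  moreover have "mollifying_net k \<epsilon> \<in> borel_measurable borel" 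
    unfolding mollifying_net_def[abs_def] by measurable
  ultimately show ?thesis unfolding kernel_def by blast
qed

lemma integral_mollifying_net:
  fixes k :: "'a::euclidean_space \<Rightarrow> real"
  assumes e: "\<epsilon> > 0"
  shows "(LINT x|lborel. mollifying_net k \<epsilon> x) = (LINT x|lborel. k x)"
  using integral_lborel_affine[of "inverse \<epsilon>" k 0] e
  by (simp add: mollifying_net_def power_inverse divide_inverse mult.commute)

lemma friedrichsD:
  assumes "friedrichs_mollifier \<psi>"
  shows "\<psi> \<in> test_functions UNIV" "\<And>x. 0 \<le> \<psi> x" "(LINT x|lborel. \<psi> x) = 1" "kernel \<psi>"
  using assms kernel_test_function by (auto simp: friedrichs_mollifier_def)

lemma mollifying_net_props:
  assumes m: "friedrichs_mollifier \<psi>" and e: "\<epsilon> > 0"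
  shows "kernel (mollifying_net \<psi> \<epsilon>)" "\<And>x. 0 \<le> mollifying_net \<psi> \<epsilon> x"
    "(LINT x|lborel. mollifying_net \<psi> \<epsilon> x) = 1" "(LINT x|lborel. \<bar>mollifying_net \<psi> \<epsilon> x\<bar>) = 1"
proof -
  note p = friedrichsD[OF m]
  show "kernel (mollifying_net \<psi> \<epsilon>)" by (rule mollifying_net_kernel[OF p(4) e])
  show 1: "\<And>x. 0 \<le> mollifying_net \<psi> \<epsilon> x" using p(2) e by (simp add: mollifying_net_def)
  show 2: "(LINT x|lborel. mollifying_net \<psi> \<epsilon> x) = 1" using integral_mollifying_net[OF e, of \<psi>] p(3) by simp
  show "(LINT x|lborel. \<bar>mollifying_net \<psi> \<epsilon> x\<bar>) = 1" using 1 2 by simp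
qed

lemma Conv_mollifier_contraction:
  assumes m: "friedrichs_mollifier \<psi>" and e: "\<epsilon> > 0"
  shows "norm (Conv (mollifying_net \<psi> \<epsilon>) F) \<le> norm F"
  using norm_Conv_le[OF mollifying_net_props(1)[OF m e], of F] mollifying_net_props(4)[OF m e] by simp

lemma indicator_L2:
  assumes "A \<in> sets borel" "emeasure lborel A < \<infinity>"
  shows "(indicator A :: 'a::euclidean_space \<Rightarrow> complex) \<in> L2" 
    "(norm (cls (indicator A :: 'a::euclidean_space \<Rightarrow> complex)))\<^sup>2 = measure lborel A"
proof -
  have *: "(cmod (indicator A x))\<^sup>2 = indicator A x" for x :: 'a by (auto simp: indicator_def)
  show 1: "(indicator A :: 'a \<Rightarrow> complex) \<in> L2"
  proof (rule L2_I)
    show "(indicator A :: 'a \<Rightarrow> complex) \<in> borel_measurable borel"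
      by (rule complex_indicator_measurable[OF assms(1)])
    show "integrable lborel (\<lambda>x. (cmod (indicator A x))\<^sup>2)" unfolding * using assms by simp
  qed
  show "(norm (cls (indicator A :: 'a \<Rightarrow> complex)))\<^sup>2 = measure lborel A"
    using assms by (simp add: norm_cls_sq[OF 1] *)
qed

lemma mollify_open_pointwise:
  assumes m: "friedrichs_mollifier \<psi>" and U: "open U" "x \<in> U"
  shows "\<forall>\<^sub>F i in at_top. convol (indicator U) (mollifying_net \<psi> (inverse i)) x = (1::complex)"
proof -
  obtain R where R: "\<And>x. norm x > R \<Longrightarrow> \<psi> x = 0" 
    using test_function_props(3)[OF friedrichsD(1)[OF m]] by (auto simp: bdd_supp_def)
  obtain r where r: "r > 0" "ball x r \<subseteq> U" using U open_contains_ball by blast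
  have "\<forall>\<^sub>F i::real in at_top. i > max 1 (R / r)" by (rule eventually_gt_at_top)
  then show ?thesis
  proof eventually_elim
    case (elim i)
    then have i: "i > 0" "R < i * r" using r by (auto simp: field_simps)
    have "mollifying_net \<psi> (inverse i) (x - y) *\<^sub>R indicator U y = (complex_of_real (mollifying_net \<psi> (inverse i) (x - y)))" for y
    proof (cases "y \<in> U")
      case False
      then have "norm (x - y) \<ge> r" using r(2) by (force simp: dist_norm)
      then have "norm ((x - y) /\<^sub>R inverse i) > R" using i mult_left_mono[of r "norm (x - y)" i] by (auto intro: less_le_trans)
      from R[OF this] have "mollifying_net \<psi> (inverse i) (x - y) = 0" by (simp add: mollifying_net_def)
      then show ?thesis by simp
    qed (simp add: scaleR_conv_of_real)
    then have "convol (indicator U) (mollifying_net \<psi> (inverse i)) x = (LINT y|lborel. complex_of_real (mollifying_net \<psi> (inverse i) (x - y)))"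
      by (simp add: convol_def)
    also have "\<dots> = complex_of_real (LINT y|lborel. mollifying_net \<psi> (inverse i) (x - y))"
      by (rule integral_complex_of_real)
    also have "\<dots> = 1"
      using mollifying_net_props(3)[OF m, of "inverse i"] i by (simp add: integral_lborel_reflect)
    finally show ?case .
  qed
qed

text \<open>For an open set \<open>U\<close> the convolution \<open>1\<^sub>U * \<psi>\<^sub>\<epsilon>\<close> equals \<open>1\<close> at each point of \<open>U\<close> once \<open>\<epsilon>\<close> is
  small, so \<open>\<langle>1\<^sub>U * \<psi>\<^sub>\<epsilon>, 1\<^sub>U\<rangle>\<close> tends to \<open>\<parallel>1\<^sub>U\<parallel>\<^sup>2\<close>. As convolution is a contraction this forces
  convergence in norm.\<close>
lemma Conv_mollifier_open:
  fixes U :: "'a::euclidean_space set"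
  assumes m: "friedrichs_mollifier \<psi>" and U: "open U" "emeasure lborel U < \<infinity>"
  shows "((\<lambda>\<epsilon>. Conv (mollifying_net \<psi> \<epsilon>) (cls (indicator U))) \<longlongrightarrow> cls (indicator U)) (at_right 0)"
  unfolding filterlim_at_right_to_top
proof -
  define k where "k i = mollifying_net \<psi> (inverse i)" for i
  define F where "F = cls (indicator U :: 'a \<Rightarrow> complex)"
  have Us: "U \<in> sets borel" using U by simp
  note iU = indicator_L2[OF Us U(2)]
  have k: "kernel (k i)" "\<And>x. 0 \<le> k i x" "(LINT x|lborel. \<bar>k i x\<bar>) = 1" if "i > 0" for i
    using mollifying_net_props[OF m, of "inverse i"] that by (auto simp: k_def)
  have [measurable]: "k i \<in> borel_measurable borel" for i
    using kernelD(1)[OF friedrichsD(4)[OF m]] unfolding k_def mollifying_net_def[abs_def] by measurable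
  have "((\<lambda>i. LINT x|lborel. indicator U x *\<^sub>R convol (indicator U) (k i) x) \<longlongrightarrow> (LINT x|lborel. indicator U x *\<^sub>R (1::complex))) at_top"
  proof (rule integral_dominated_convergence_at_top[where w="indicator U"])
    show "AE x in lborel. ((\<lambda>i. indicator U x *\<^sub>R convol (indicator U) (k i) x) \<longlongrightarrow> indicator U x *\<^sub>R (1::complex)) at_top"
    proof (intro AE_I2)
      fix x
      show "((\<lambda>i. indicator U x *\<^sub>R convol (indicator U) (k i) x) \<longlongrightarrow> indicator U x *\<^sub>R (1::complex)) at_top"
        using mollify_open_pointwise[OF m U(1), of x]
        by (cases "x \<in> U") (auto simp: k_def intro: tendsto_eventually)
    qed
    show "\<forall>\<^sub>F i in at_top. AE x in lborel. norm (indicator U x *\<^sub>R (convol (indicator U) (k i) x :: complex)) \<le> indicator U x"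
      using eventually_gt_at_top[of 0]
    proof eventually_elim
      case (elim i)
      show ?case
      proof (intro AE_I2)
        fix x
        have "cmod (convol (indicator U) (k i) x) \<le> (LINT y|lborel. \<bar>k i (x - y)\<bar>)"
          unfolding convol_def
        proof (rule order.trans[OF integral_norm_bound], rule integral_mono)
          show "integrable lborel (\<lambda>y. cmod (k i (x - y) *\<^sub>R (indicator U y :: complex)))"
            by (rule integrable_norm[OF convol_integrable[OF k(1)[OF elim] iU(1)]])
          show "integrable lborel (\<lambda>y. \<bar>k i (x - y)\<bar>)"
            using integrable_lborel_reflect[OF kernelD(2)[OF k(1)[OF elim]]] by auto
        qed (auto simp: indicator_def)
        also have "\<dots> = 1" using k(3)[OF elim] by (simp add: integral_lborel_reflect[of "\<lambda>y. \<bar>k i y\<bar>"])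
        finally show "norm (indicator U x *\<^sub>R (convol (indicator U) (k i) x :: complex)) \<le> indicator U x"
          by (auto simp: indicator_def)
      qed
    qed
    have [measurable]: "(indicator U :: 'a \<Rightarrow> complex) \<in> borel_measurable borel" by (rule L2_D(1)[OF iU(1)])
    show "(\<lambda>x. indicator U x *\<^sub>R convol (indicator U) (k t) x :: complex) \<in> borel_measurable lborel" for t
      using Us by (auto intro!: borel_measurable_scaleR convol_measurable)
  qed (use Us U(2) in auto)
  then have "((\<lambda>i. Re (LINT x|lborel. indicator U x *\<^sub>R convol (indicator U) (k i) x)) \<longlongrightarrow> Re (LINT x|lborel. indicator U x *\<^sub>R (1::complex))) at_top"
    by (rule tendsto_Re)
  moreover have "Re (LINT x|lborel. indicator U x *\<^sub>R (1::complex)) = measure lborel U"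
    using Us U(2) by (simp add: scaleR_conv_of_real)
  moreover have "\<forall>\<^sub>F i in at_top. Re (LINT x|lborel. indicator U x *\<^sub>R convol (indicator U) (k i) x) = Conv (k i) F \<bullet> F"
    using eventually_gt_at_top[of 0]
  proof eventually_elim
    case (elim i)
    have c: "convol (indicator U) (k i) \<in> L2" by (rule convol_L2(1)[OF k(1)[OF elim] iU(1)])
    have int: "integrable lborel (\<lambda>x. convol (indicator U) (k i) x * indicator U x :: complex)"
      by (rule L2_integrable_mult[OF c iU(1)])
    have "Conv (k i) F \<bullet> F = (LINT x|lborel. Re (convol (indicator U) (k i) x * indicator U x))"
      by (simp add: F_def Conv_cls[OF k(1)[OF elim] iU(1)] inner_cls[OF c iU(1)])
         (auto intro!: Bochner_Integration.integral_cong simp: inner_complex_def indicator_def)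
    also have "\<dots> = Re (LINT x|lborel. convol (indicator U) (k i) x * indicator U x)"
      by (rule integral_Re[OF int])
    also have "(\<lambda>x. convol (indicator U) (k i) x * indicator U x) = (\<lambda>x. indicator U x *\<^sub>R (convol (indicator U) (k i) x :: complex))"
      by (auto simp: indicator_def)
    finally show ?case ..
  qed
  ultimately have "((\<lambda>i. Conv (k i) F \<bullet> F) \<longlongrightarrow> (norm F)\<^sup>2) at_top"
    by (simp add: tendsto_cong F_def iU(2))
  from tendsto_diff[OF tendsto_const[of "2 * (norm F)\<^sup>2"] tendsto_mult[OF tendsto_const[of 2] this]]
  have lim: "((\<lambda>i. 2 * (norm F)\<^sup>2 - 2 * (Conv (k i) F \<bullet> F)) \<longlongrightarrow> 0) at_top" by simp
  have "((\<lambda>i. (norm (Conv (k i) F - F))\<^sup>2) \<longlongrightarrow> 0) at_top"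
  proof (rule Lim_null_comparison[OF _ lim])
    show "\<forall>\<^sub>F i in at_top. norm ((norm (Conv (k i) F - F))\<^sup>2) \<le> 2 * (norm F)\<^sup>2 - 2 * (Conv (k i) F \<bullet> F)"
      using eventually_gt_at_top[of 0]
    proof eventually_elim
      case (elim i)
      have "(norm (Conv (k i) F - F))\<^sup>2 = (norm (Conv (k i) F))\<^sup>2 - 2 * (Conv (k i) F \<bullet> F) + (norm F)\<^sup>2"
        by (simp add: power2_norm_eq_inner inner_diff_left inner_diff_right inner_commute)
      moreover have "(norm (Conv (k i) F))\<^sup>2 \<le> (norm F)\<^sup>2"
        using Conv_mollifier_contraction[OF m, of "inverse i" F] elim by (intro power_mono) (auto simp: k_def)
      ultimately have "(norm (Conv (k i) F - F))\<^sup>2 \<le> 2 * (norm F)\<^sup>2 - 2 * (Conv (k i) F \<bullet> F)" by linarith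
      then show ?case by (simp only: real_norm_def abs_of_nonneg[OF zero_le_power2])
    qed
  qed
  then have "((\<lambda>i. sqrt ((norm (Conv (k i) F - F))\<^sup>2)) \<longlongrightarrow> sqrt 0) at_top" by (rule tendsto_real_sqrt)
  then have "((\<lambda>i. norm (Conv (k i) F - F)) \<longlongrightarrow> 0) at_top" by simp
  then show "((\<lambda>x. Conv (mollifying_net \<psi> (inverse x)) (cls (indicator U))) \<longlongrightarrow> cls (indicator U)) at_top"
    by (simp add: LIM_zero_iff tendsto_norm_zero_iff k_def F_def)
qed

text \<open>The operators are contractions, so the set of functions for which they converge to the
  identity is closed.\<close>
lemma Conv_mollifier_closed:
  fixes F :: "'a::euclidean_space l2"
  assumes m: "friedrichs_mollifier \<psi>" 
    and approx: "\<And>e. e > 0 \<Longrightarrow> \<exists>G. norm (G - F) < e \<and> ((\<lambda>\<epsilon>. Conv (mollifying_net \<psi> \<epsilon>) G) \<longlongrightarrow> G) (at_right 0)"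
  shows "((\<lambda>\<epsilon>. Conv (mollifying_net \<psi> \<epsilon>) F) \<longlongrightarrow> F) (at_right 0)"
proof (rule tendstoI)
  fix e :: real assume e: "e > 0"
  then obtain G where G: "norm (G - F) < e / 3" "((\<lambda>\<epsilon>. Conv (mollifying_net \<psi> \<epsilon>) G) \<longlongrightarrow> G) (at_right 0)"
    using approx[of "e/3"] by auto
  have "\<forall>\<^sub>F \<epsilon> in at_right 0. dist (Conv (mollifying_net \<psi> \<epsilon>) G) G < e / 3"
    using e by (intro tendstoD[OF G(2)]) auto
  then show "\<forall>\<^sub>F \<epsilon> in at_right 0. dist (Conv (mollifying_net \<psi> \<epsilon>) F) F < e"
    using eventually_at_right_less[of "0::real"]
  proof eventually_elim
    case (elim \<epsilon>)
    let ?C = "Conv (mollifying_net \<psi> \<epsilon>)"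
    interpret C: bounded_linear ?C by (rule bounded_linear_Conv[OF mollifying_net_props(1)[OF m elim(2)]])
    have "norm (?C F - ?C G) \<le> norm (F - G)"
      using Conv_mollifier_contraction[OF m elim(2), of "F - G"] by (simp add: C.diff)
    also have "\<dots> < e / 3" using G(1) by (simp add: norm_minus_commute)
    finally have 1: "dist (?C F) (?C G) < e / 3" by (simp add: dist_norm)
    have 2: "dist G F < e / 3" using G(1) by (simp add: dist_norm)
    show ?case using 1 2 elim(1) dist_triangle[of "?C F" F "?C G"] dist_triangle[of "?C G" F G] by linarith
  qed
qed

lemma Conv_mollifier_indicator:
  fixes A :: "'a::euclidean_space set"
  assumes m: "friedrichs_mollifier \<psi>" and A: "A \<in> sets borel" "emeasure lborel A < \<infinity>"
  shows "((\<lambda>\<epsilon>. Conv (mollifying_net \<psi> \<epsilon>) (cls (indicator A))) \<longlongrightarrow> cls (indicator A)) (at_right 0)"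
proof (rule Conv_mollifier_closed[OF m])
  fix e :: real assume e: "e > 0"
  obtain T where T: "open T" "A \<subseteq> T" "emeasure lebesgue (T - A) < ennreal (e\<^sup>2)"
    using sets_lebesgue_outer_open[of A "e\<^sup>2"] A(1) e by auto
  have Ts: "T \<in> sets borel" "T - A \<in> sets borel" using T(1) A(1) by auto
  have small: "emeasure lborel (T - A) < ennreal (e\<^sup>2)" using T(3) Ts by simp
  have "emeasure lborel T \<le> emeasure lborel A + emeasure lborel (T - A)"
    using emeasure_subadditive[of A lborel "T - A"] A(1) Ts T(2) by (simp add: Un_absorb1)
  also have "\<dots> < \<infinity>" using A(2) small by (auto simp: ennreal_add_less_top intro: less_trans)
  finally have Tf: "emeasure lborel T < \<infinity>" .
  have TAf: "emeasure lborel (T - A) < \<infinity>" using small by (auto intro: less_trans)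
  have "cls (indicator T) - cls (indicator A) = cls (\<lambda>x. indicator T x - indicator A x)"
    using cls_diff[OF indicator_L2(1)[OF Ts(1) Tf] indicator_L2(1)[OF A]] by simp
  also have "(\<lambda>x. indicator T x - indicator A x) = (indicator (T - A) :: 'a \<Rightarrow> complex)"
    using T(2) by (auto simp: indicator_def fun_eq_iff)
  finally have "(norm (cls (indicator T) - cls (indicator A :: 'a \<Rightarrow> complex)))\<^sup>2 = measure lborel (T - A)"
    using indicator_L2(2)[OF Ts(2) TAf] by simp
  also have "\<dots> < e\<^sup>2" 
  proof -
    have "emeasure lborel (T - A) = ennreal (measure lborel (T - A))"
      using TAf by (intro emeasure_eq_ennreal_measure) auto
    with small show ?thesis by (simp add: ennreal_less_iff)
  qed
  finally have "norm (cls (indicator T) - cls (indicator A :: 'a \<Rightarrow> complex)) < e" 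
    using e power_less_imp_less_base less_imp_le by blast
  then show "\<exists>G. norm (G - cls (indicator A :: 'a \<Rightarrow> complex)) < e \<and> ((\<lambda>\<epsilon>. Conv (mollifying_net \<psi> \<epsilon>) G) \<longlongrightarrow> G) (at_right 0)"
    using Conv_mollifier_open[OF m T(1) Tf] by blast
qed

lemma Conv_mollifier_const_mult:
  assumes m: "friedrichs_mollifier \<psi>" and lim: "((\<lambda>\<epsilon>. Conv (mollifying_net \<psi> \<epsilon>) F) \<longlongrightarrow> F) (at_right 0)"
  shows "((\<lambda>\<epsilon>. Conv (mollifying_net \<psi> \<epsilon>) (Mult (\<lambda>x. c) F)) \<longlongrightarrow> Mult (\<lambda>x. c) F) (at_right 0)"
proof (rule Lim_transform_eventually)
  show "((\<lambda>\<epsilon>. Mult (\<lambda>x. c) (Conv (mollifying_net \<psi> \<epsilon>) F)) \<longlongrightarrow> Mult (\<lambda>x. c) F) (at_right 0)"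
    by (rule bounded_linear.tendsto[OF bounded_linear_Mult[OF ess_bdd_const] lim])
  show "\<forall>\<^sub>F \<epsilon> in at_right 0. Mult (\<lambda>x. c) (Conv (mollifying_net \<psi> \<epsilon>) F) = Conv (mollifying_net \<psi> \<epsilon>) (Mult (\<lambda>x. c) F)"
    using eventually_at_right_less[of "0::real"]
    by eventually_elim (simp add: Conv_Mult_const mollifying_net_props[OF m])
qed

text \<open>Mollification converges on indicators of open sets, by outer regularity on indicators of sets
  of finite measure, by linearity on simple functions, and by density everywhere.\<close>
theorem Conv_mollifier_tendsto:
  fixes F :: "'a::euclidean_space l2"
  assumes m: "friedrichs_mollifier \<psi>" 
  shows "((\<lambda>\<epsilon>. Conv (mollifying_net \<psi> \<epsilon>) F) \<longlongrightarrow> F) (at_right 0)"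
proof (rule Conv_mollifier_closed[OF m])
  fix e :: real assume e: "e > 0"
  obtain f where f: "f \<in> L2" "F = cls f" by (rule l2_cases)
  have "\<exists>s. (\<forall>i. simple_function lborel (s i)) \<and> (\<forall>x\<in>space lborel. (\<lambda>i. s i x) \<longlonglongrightarrow> f x) \<and>
    (\<forall>i. \<forall>x\<in>space lborel. dist (s i x) 0 \<le> 2 * dist (f x) 0)"
    by (rule borel_measurable_implies_sequence_metric) (use L2_D[OF f(1)] in simp)
  then obtain s where s: "\<And>i. simple_function lborel (s i)" "\<And>x. (\<lambda>i. s i x) \<longlonglongrightarrow> f x"
    "\<And>i x. cmod (s i x) \<le> 2 * cmod (f x)" by auto
  have sm [measurable]: "s i \<in> borel_measurable borel" for i
    using borel_measurable_simple_function[OF s(1)[of i]] by simp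
  have f2: "(\<lambda>x. 2 * f x) \<in> L2" by (rule L2_cmult[OF f(1)])
  have s2: "s i \<in> L2" for i
  proof (rule L2_bound[OF sm L2_D(2)[OF f2]], rule AE_I2)
    fix x
    have "cmod (s i x) \<le> cmod (2 * f x)" using s(3)[of i x] by (simp add: norm_mult)
    then show "(cmod (s i x))\<^sup>2 \<le> (cmod (2 * f x))\<^sup>2" by (rule power_mono) simp
  qed
  have "(\<lambda>i. cls (s i)) \<longlonglongrightarrow> F" unfolding f(2)
    by (rule tendsto_cls_dominated_seq[OF s2 f(1) f2]) (use s in \<open>auto simp: norm_mult\<close>)
  from tendstoD[OF this e] obtain i where i: "norm (cls (s i) - F) < e"
    by (auto simp: dist_norm eventually_sequentially)
  have "((\<lambda>\<epsilon>. Conv (mollifying_net \<psi> \<epsilon>) (cls (s i))) \<longlongrightarrow> cls (s i)) (at_right 0)"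
  proof -
    define A where "A y = s i -` {y}" for y
    have A: "A y \<in> sets borel" for y unfolding A_def
      using measurable_sets[OF sm[of i], of "{y}"] by simp
    have fin: "finite (range (s i))" using simple_functionD(1)[OF s(1)[of i]] by simp
    have Af: "emeasure lborel (A y) < \<infinity>" if "y \<noteq> 0" for y
    proof -
      have "ennreal ((cmod y)\<^sup>2) * emeasure lborel (A y) = (\<integral>\<^sup>+x. ennreal ((cmod y)\<^sup>2) * indicator (A y) x \<partial>lborel)"
        using A by (simp add: nn_integral_cmult_indicator)
      also have "\<dots> \<le> (\<integral>\<^sup>+x. ennreal ((cmod (s i x))\<^sup>2) \<partial>lborel)"
        by (intro nn_integral_mono) (auto simp: A_def indicator_def)
      also have "\<dots> < \<infinity>" by (simp add: nn_integral_norm_cls[OF s2] del: ennreal_power)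
      finally show ?thesis using that by (auto simp: ennreal_mult_less_top)
    qed
    let ?P = "\<lambda>G. ((\<lambda>\<epsilon>. Conv (mollifying_net \<psi> \<epsilon>) G) \<longlongrightarrow> G) (at_right 0)"
    have ind: "(\<lambda>x. \<Sum>y\<in>Y. y * indicator (A y) x) \<in> L2 \<and> ?P (cls (\<lambda>x. \<Sum>y\<in>Y. y * indicator (A y) x))"
      if "finite Y" "0 \<notin> Y" for Y
      using that
    proof (induction Y rule: finite_induct)
      case empty
      have "\<forall>\<^sub>F \<epsilon> in at_right 0. (0::'a l2) = Conv (mollifying_net \<psi> \<epsilon>) 0"
        using eventually_at_right_less[of "0::real"]
        by eventually_elim (simp add: bounded_linear_Conv mollifying_net_props[OF m] linear_simps(3))
      then show ?case by (auto simp: cls_zero intro: Lim_transform_eventually[OF tendsto_const])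
    next
      case (insert y Y)
      then have y: "y \<noteq> 0" by auto
      have 1: "indicator (A y) \<in> L2" by (rule indicator_L2[OF A Af[OF y]])
      have 2: "(\<lambda>x. y * indicator (A y) x) \<in> L2" by (rule L2_cmult[OF 1])
      have 3: "?P (cls (\<lambda>x. y * indicator (A y) x))"
        using Conv_mollifier_const_mult[OF m Conv_mollifier_indicator[OF m A Af[OF y]], of y]
        by (simp add: Mult_cls 1)
      have IH: "(\<lambda>x. \<Sum>y\<in>Y. y * indicator (A y) x) \<in> L2" "?P (cls (\<lambda>x. \<Sum>y\<in>Y. y * indicator (A y) x))"
        using insert by auto
      have eq: "(\<lambda>x. \<Sum>y\<in>insert y Y. y * indicator (A y) x) = (\<lambda>x. y * indicator (A y) x + (\<Sum>y\<in>Y. y * indicator (A y) x))"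
        by (simp only: sum.insert[OF insert.hyps])
      have "\<forall>\<^sub>F \<epsilon> in at_right 0. Conv (mollifying_net \<psi> \<epsilon>) (cls (\<lambda>x. y * indicator (A y) x)) + 
          Conv (mollifying_net \<psi> \<epsilon>) (cls (\<lambda>x. \<Sum>y\<in>Y. y * indicator (A y) x)) = 
          Conv (mollifying_net \<psi> \<epsilon>) (cls (\<lambda>x. y * indicator (A y) x) + cls (\<lambda>x. \<Sum>y\<in>Y. y * indicator (A y) x))"
        using eventually_at_right_less[of "0::real"]
        by eventually_elim (simp add: bounded_linear_Conv mollifying_net_props[OF m] linear_simps(1))
      then have "?P (cls (\<lambda>x. y * indicator (A y) x) + cls (\<lambda>x. \<Sum>y\<in>Y. y * indicator (A y) x))"
        by (rule Lim_transform_eventually[OF tendsto_add[OF 3 IH(2)]])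
      then show ?case unfolding eq using L2_add[OF 2 IH(1)] by (simp add: cls_add[OF 2 IH(1)])
    qed
    have "s i x = (\<Sum>y\<in>range (s i) - {0}. y * indicator (A y) x)" for x
    proof -
      have "(\<Sum>y\<in>range (s i) - {0}. y * indicator (A y) x) = (\<Sum>y\<in>range (s i) - {0}. if y = s i x then y else 0)"
        by (intro sum.cong) (auto simp: A_def indicator_def)
      also have "\<dots> = s i x" using fin by (subst sum.delta) auto
      finally show ?thesis ..
    qed
    then have "s i = (\<lambda>x. \<Sum>y\<in>range (s i) - {0}. y * indicator (A y) x)" by (rule ext)
    then show ?thesis using ind[of "range (s i) - {0}"] fin by simp
  qed
  then show "\<exists>G. norm (G - F) < e \<and> ((\<lambda>\<epsilon>. Conv (mollifying_net \<psi> \<epsilon>) G) \<longlongrightarrow> G) (at_right 0)"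
    using i by blast
qed

section \<open>The Fourier transform\<close>

subsection \<open>Integrable functions\<close>

definition FT :: "('a::euclidean_space \<Rightarrow> complex) \<Rightarrow> 'a \<Rightarrow> complex" where
  "FT f \<xi> = (LINT x|lborel. cis (- (x \<bullet> \<xi>)) * f x)"

lemma cis_measurable [measurable]: "cis \<in> borel_measurable borel"
  by (intro borel_measurable_continuous_onI continuous_intros)

lemma cis_inner_measurable [measurable]:
  "(\<lambda>(x::'a::euclidean_space, \<xi>). cis (- (x \<bullet> \<xi>))) \<in> borel_measurable (lborel \<Otimes>\<^sub>M lborel)"
  "(\<lambda>x::'a::euclidean_space. cis (- (x \<bullet> \<xi>))) \<in> borel_measurable borel"
  "(\<lambda>x::'a::euclidean_space. cis (x \<bullet> \<xi>)) \<in> borel_measurable borel"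
  "(\<lambda>x::'a::euclidean_space. cis (\<xi> \<bullet> x)) \<in> borel_measurable borel"
proof -
  show "(\<lambda>(x::'a::euclidean_space, \<xi>). cis (- (x \<bullet> \<xi>))) \<in> borel_measurable (lborel \<Otimes>\<^sub>M lborel)"
    by measurable
  show "(\<lambda>x::'a::euclidean_space. cis (- (x \<bullet> \<xi>))) \<in> borel_measurable borel"
    "(\<lambda>x::'a::euclidean_space. cis (x \<bullet> \<xi>)) \<in> borel_measurable borel"
    "(\<lambda>x::'a::euclidean_space. cis (\<xi> \<bullet> x)) \<in> borel_measurable borel" by measurable
qed

lemma FT_integrable:
  assumes f: "integrable lborel f"
  shows "integrable lborel (\<lambda>x. cis (- (x \<bullet> \<xi>)) * f x)"
  by (rule Bochner_Integration.integrable_bound[OF f])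
     (use borel_measurable_integrable[OF f] in \<open>auto simp: norm_mult\<close>)

lemma FT_integrable':
  assumes f: "integrable lborel f"
  shows "integrable lborel (\<lambda>x. cis (x \<bullet> \<xi>) * f x)"
  using FT_integrable[OF f, of "- \<xi>"] by simp

lemma FT_measurable:
  assumes [measurable]: "f \<in> borel_measurable borel"
  shows "FT f \<in> borel_measurable borel"
proof -
  have "(\<lambda>\<xi>. LINT x|lborel. cis (- (x \<bullet> \<xi>)) * f x) \<in> borel_measurable lborel"
  proof (rule lborel.borel_measurable_lebesgue_integral)
    have "(\<lambda>p. cis (- (snd p \<bullet> fst p)) * f (snd p)) \<in> borel_measurable (lborel \<Otimes>\<^sub>M lborel)"
      using measurable_compose[OF measurable_pair_swap' cis_inner_measurable(1)]
      by (auto simp: case_prod_beta)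
    then show "(\<lambda>(\<xi>, x). cis (- (x \<bullet> \<xi>)) * f x) \<in> borel_measurable (lborel \<Otimes>\<^sub>M lborel)"
      by (simp add: case_prod_beta')
  qed
  then show ?thesis by (simp add: FT_def[abs_def])
qed

lemma FT_bound:
  assumes f: "integrable lborel f"
  shows "cmod (FT f \<xi>) \<le> (LINT x|lborel. cmod (f x))"
  unfolding FT_def
  by (rule order.trans[OF integral_norm_bound]) (simp add: norm_mult)

lemma FT_diff:
  assumes "integrable lborel f" "integrable lborel g"
  shows "FT (\<lambda>x. f x - g x) \<xi> = FT f \<xi> - FT g \<xi>"
  using FT_integrable[OF assms(1)] FT_integrable[OF assms(2)]
  by (simp add: FT_def right_diff_distrib)

lemma FT_add:
  assumes "integrable lborel f" "integrable lborel g"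
  shows "FT (\<lambda>x. f x + g x) \<xi> = FT f \<xi> + FT g \<xi>"
  using FT_integrable[OF assms(1)] FT_integrable[OF assms(2)]
  by (simp add: FT_def distrib_left)

lemma FT_scaleR: "FT (\<lambda>x. c *\<^sub>R f x) \<xi> = c *\<^sub>R FT f \<xi>"
  by (simp add: FT_def)

lemma FT_cong_AE:
  assumes [measurable]: "f \<in> borel_measurable borel" "g \<in> borel_measurable borel"
    and "AE x in lborel. f x = g x"
  shows "FT f \<xi> = FT g \<xi>"
  unfolding FT_def
  by (rule integral_cong_AE) (use assms(3) in auto)

text \<open>The only exchange of integrals behind the adjointness of the Fourier transform and its inverse.\<close>
lemma multiplication_formula:
  assumes f: "integrable lborel f" and g: "integrable lborel g"
  shows "(LINT \<xi>|lborel. FT f \<xi> * g \<xi>) = (LINT x|lborel. f x * FT g x)"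
proof -
  note [measurable] = borel_measurable_integrable[OF f] borel_measurable_integrable[OF g]
  have int: "integrable (lborel \<Otimes>\<^sub>M lborel) (\<lambda>(x, \<xi>). cis (- (x \<bullet> \<xi>)) * f x * g \<xi>)"
  proof (rule integrable_lborel_pair_bound[OF _ f g, where C=1])
    have "(\<lambda>p. (case p of (x, \<xi>) \<Rightarrow> cis (- (x \<bullet> \<xi>))) * (f (fst p) * g (snd p))) \<in> borel_measurable (lborel \<Otimes>\<^sub>M lborel)"
      by (intro borel_measurable_times cis_inner_measurable) measurable
    then show "(\<lambda>(x, \<xi>). cis (- (x \<bullet> \<xi>)) * f x * g \<xi>) \<in> borel_measurable (lborel \<Otimes>\<^sub>M lborel)"
      by (simp add: case_prod_beta' mult.assoc)
  qed (simp add: norm_mult)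
  have "(LINT \<xi>|lborel. FT f \<xi> * g \<xi>) = (LINT \<xi>|lborel. LINT x|lborel. cis (- (x \<bullet> \<xi>)) * f x * g \<xi>)"
    by (simp add: FT_def)
  also have "\<dots> = (LINT x|lborel. LINT \<xi>|lborel. cis (- (x \<bullet> \<xi>)) * f x * g \<xi>)"
    by (rule lborel_pair.Fubini_integral[OF int])
  also have "\<dots> = (LINT x|lborel. LINT \<xi>|lborel. f x * (cis (- (\<xi> \<bullet> x)) * g \<xi>))"
    by (simp add: inner_commute mult_ac)
  also have "\<dots> = (LINT x|lborel. f x * FT g x)"
    by (simp add: FT_def)
  finally show ?thesis .
qed

lemma FT_cis_shift: "FT (\<lambda>x. cis (x \<bullet> y) * f x) \<xi> = FT f (\<xi> - y)"
  unfolding FT_def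
  by (intro Bochner_Integration.integral_cong refl) (simp add: mult.assoc[symmetric] cis_mult inner_diff_right)

subsection \<open>Gaussian weights\<close>

lemma lborel_product_integral:
  fixes g :: "'a::euclidean_space \<Rightarrow> real \<Rightarrow> 'b::{real_normed_field, banach, second_countable_topology}"
  assumes g: "\<And>b. b \<in> Basis \<Longrightarrow> integrable lborel (g b)"
  shows "integrable lborel (\<lambda>x. \<Prod>b\<in>Basis. g b (x \<bullet> b))"
    "(LINT x|lborel. (\<Prod>b\<in>Basis. g b (x \<bullet> b))) = (\<Prod>b\<in>Basis. LINT x|lborel. g b x)"
proof -
  interpret product_sigma_finite "\<lambda>b::'a. lborel :: real measure" ..
  have [measurable]: "g b \<in> borel_measurable borel" if "b \<in> Basis" for b
    using borel_measurable_integrable[OF g[OF that]] by simp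
  have m: "(\<lambda>x. \<Prod>b\<in>Basis. g b (x \<bullet> b)) \<in> borel_measurable borel" by measurable
  have s: "(\<lambda>f. \<Sum>b\<in>Basis. f b *\<^sub>R b) \<in> (\<Pi>\<^sub>M b\<in>Basis. lborel) \<rightarrow>\<^sub>M (borel :: 'a measure)" by measurable
  have eq: "(\<Prod>b\<in>Basis. g b ((\<Sum>b\<in>Basis. f b *\<^sub>R b) \<bullet> b)) = (\<Prod>b\<in>Basis. g b (f b))" for f :: "'a \<Rightarrow> real"
    by (intro prod.cong refl) simp
  show "integrable lborel (\<lambda>x. \<Prod>b\<in>Basis. g b (x \<bullet> b))"
    by (subst lborel_eq, subst integrable_distr_eq[OF s m]) (simp only: eq, intro product_integrable_prod g, auto)
  show "(LINT x|lborel. (\<Prod>b\<in>Basis. g b (x \<bullet> b))) = (\<Prod>b\<in>Basis. LINT x|lborel. g b x)"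
    by (subst lborel_eq, subst integral_distr[OF s m]) (simp only: eq, intro product_integral_prod g, auto)
qed

text \<open>The standard normal density in dimension \<open>d\<close>, as a product so that its Fourier transform
  reduces to the characteristic function in dimension one.\<close>
definition gauss :: "'a::euclidean_space \<Rightarrow> real" where
  "gauss x = (\<Prod>b\<in>Basis. std_normal_density (x \<bullet> b))"

lemma gauss_nonneg: "0 \<le> gauss x"
  unfolding gauss_def by (intro prod_nonneg) (simp add: normal_density_nonneg)

lemma gauss_integral: "integrable lborel (gauss :: 'a::euclidean_space \<Rightarrow> real)" 
  "(LINT x|lborel. gauss (x::'a)) = 1"
proof -
  have i: "integrable lborel std_normal_density" by (rule integrable_normal_density) simp
  show "integrable lborel (gauss :: 'a \<Rightarrow> real)" 
    unfolding gauss_def[abs_def] by (rule lborel_product_integral(1)) (rule i)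
  show "(LINT x|lborel. gauss (x::'a)) = 1"
    unfolding gauss_def by (subst lborel_product_integral(2)) (auto simp: i)
qed

lemma std_normal_le: "std_normal_density x \<le> 1 / sqrt (2 * pi)"
  unfolding std_normal_density_def using exp_le_one_iff[of "-x\<^sup>2 / 2"] 
  by (auto simp: field_simps)

lemma gauss_bound: "gauss x \<le> (1 / sqrt (2 * pi)) ^ DIM('a)" for x :: "'a::euclidean_space"
proof -
  have "gauss x \<le> (\<Prod>b\<in>(Basis::'a set). 1 / sqrt (2 * pi))"
    unfolding gauss_def by (intro prod_mono) (auto simp: normal_density_nonneg std_normal_le)
  then show ?thesis by (simp add: power_one_over)
qed

lemma kernel_gauss: "kernel (gauss :: 'a::euclidean_space \<Rightarrow> real)"
proof -
  have "gauss \<in> borel_measurable borel"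
    using borel_measurable_integrable[OF gauss_integral(1)] by simp
  moreover have "\<bar>gauss x\<bar> \<le> (1 / sqrt (2 * pi)) ^ DIM('a)" for x :: 'a
    using gauss_nonneg[of x] gauss_bound[of x] by linarith
  ultimately show ?thesis unfolding kernel_def using gauss_integral(1) by blast
qed

lemma gauss_FT: "FT (\<lambda>x. complex_of_real (gauss x)) \<xi> = of_real (sqrt (2 * pi) ^ DIM('a) * gauss \<xi>)"
  for \<xi> :: "'a::euclidean_space"
proof -
  let ?g = "\<lambda>b x. std_normal_density x *\<^sub>R cis (- (x * (\<xi> \<bullet> b)))"
  have i: "integrable lborel (?g b)" for b
  proof (rule Bochner_Integration.integrable_bound)
    show "integrable lborel std_normal_density" by (rule integrable_normal_density) simp
    show "?g b \<in> borel_measurable lborel" by measurable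
  qed auto
  have v: "(LINT x|lborel. ?g b x) = of_real (sqrt (2 * pi) * std_normal_density (\<xi> \<bullet> b))" for b
  proof -
    have "char std_normal_distribution (- (\<xi> \<bullet> b)) = (LINT x|lborel. std_normal_density x *\<^sub>R iexp (- (\<xi> \<bullet> b) * x))"
      unfolding char_def by (subst integral_density) (auto simp: normal_density_nonneg)
    also have "(\<lambda>x. std_normal_density x *\<^sub>R iexp (- (\<xi> \<bullet> b) * x)) = ?g b"
      by (auto simp: cis_conv_exp mult_ac)
    finally show ?thesis
      unfolding char_std_normal_distribution by (simp add: std_normal_density_def)
  qed
  have c: "cis (- (x \<bullet> \<xi>)) = (\<Prod>b\<in>Basis. cis (- ((x \<bullet> b) * (\<xi> \<bullet> b))))" for x :: 'a
    by (subst euclidean_inner) (simp add: cis_conv_exp sum_negf sum_distrib_left exp_sum[symmetric])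
  have "FT (\<lambda>x. complex_of_real (gauss x)) \<xi> = (LINT x|lborel. (\<Prod>b\<in>Basis. ?g b (x \<bullet> b)))"
    unfolding FT_def c by (simp add: gauss_def scaleR_conv_of_real prod.distrib mult.commute)
  also have "\<dots> = (\<Prod>b\<in>Basis. LINT x|lborel. ?g b x)"
    by (rule lborel_product_integral(2)) (rule i)
  also have "\<dots> = of_real (\<Prod>b\<in>Basis. sqrt (2 * pi) * std_normal_density (\<xi> \<bullet> b))"
    unfolding v by simp
  also have "(\<Prod>b\<in>Basis. sqrt (2 * pi) * std_normal_density (\<xi> \<bullet> b)) = sqrt (2 * pi) ^ DIM('a) * gauss \<xi>"
    by (simp add: prod.distrib gauss_def)
  finally show ?thesis .
qed

text \<open>The weight \<open>exp (- \<epsilon>\<^sup>2|\<xi>|\<^sup>2/2)\<close>, written so that its Fourier transform can be read off from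
  that of the density.\<close>
definition gweight :: "real \<Rightarrow> 'a::euclidean_space \<Rightarrow> real" where
  "gweight \<epsilon> \<xi> = sqrt (2 * pi) ^ DIM('a) * gauss (\<epsilon> *\<^sub>R \<xi>)"

lemma gweight_props: 
  fixes \<xi> :: "'a::euclidean_space"
  shows "0 \<le> gweight \<epsilon> \<xi>" "gweight \<epsilon> \<xi> \<le> 1"
    "(\<lambda>n. gweight (1 / real (Suc n)) \<xi>) \<longlonglongrightarrow> 1"
    "\<epsilon> > 0 \<Longrightarrow> integrable lborel (gweight \<epsilon> :: 'a \<Rightarrow> real)"
proof -
  show "0 \<le> gweight \<epsilon> \<xi>" by (simp add: gweight_def gauss_nonneg)
  have "sqrt (2 * pi) ^ DIM('a) * gauss (\<epsilon> *\<^sub>R \<xi>) \<le> sqrt (2 * pi) ^ DIM('a) * (1 / sqrt (2 * pi)) ^ DIM('a)"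
    by (intro mult_left_mono gauss_bound) auto
  then show "gweight \<epsilon> \<xi> \<le> 1" unfolding gweight_def power_mult_distrib[symmetric] by simp
  show "(\<lambda>n. gweight (1 / real (Suc n)) \<xi>) \<longlonglongrightarrow> 1"
  proof -
    have "(\<lambda>n. \<Prod>b\<in>(Basis::'a set). exp (- (1 / real (Suc n) * (\<xi> \<bullet> b))\<^sup>2 / 2)) \<longlonglongrightarrow> (\<Prod>b\<in>(Basis::'a set). exp (- (0 * (\<xi> \<bullet> b))\<^sup>2 / 2))"
      by (intro tendsto_intros LIMSEQ_Suc[OF lim_1_over_n]) auto
    moreover have "gweight \<epsilon> \<xi> = (\<Prod>b\<in>(Basis::'a set). exp (- (\<epsilon> * (\<xi> \<bullet> b))\<^sup>2 / 2))" for \<epsilon>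
      by (simp add: gweight_def gauss_def std_normal_density_def prod.distrib prod_dividef)
    ultimately show ?thesis by simp
  qed
  assume "\<epsilon> > 0"
  then have "integrable lborel (\<lambda>\<xi>::'a. gauss (0 + \<epsilon> *\<^sub>R \<xi>))"
    by (intro integrable_lborel_affine gauss_integral) auto
  then show "integrable lborel (gweight \<epsilon> :: 'a \<Rightarrow> real)" by (simp add: gweight_def[abs_def])
qed

lemma gweight_FT:
  fixes \<xi> :: "'a::euclidean_space"
  assumes e: "\<epsilon> > 0"
  shows "FT (\<lambda>x. complex_of_real (gweight \<epsilon> x)) \<xi> = of_real ((2 * pi) ^ DIM('a) * mollifying_net gauss \<epsilon> \<xi>)"
proof -
  let ?c = "sqrt (2 * pi) ^ DIM('a)"
  have "FT (\<lambda>x. complex_of_real (gweight \<epsilon> x)) \<xi> = ?c *\<^sub>R (LINT x|lborel. cis (- (x \<bullet> \<xi>)) * complex_of_real (gauss (\<epsilon> *\<^sub>R x)))"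
    unfolding FT_def gweight_def by (simp add: scaleR_conv_of_real mult_ac flip: integral_mult_right_zero)
  also have "(LINT x|lborel. cis (- (x \<bullet> \<xi>)) * complex_of_real (gauss (\<epsilon> *\<^sub>R x)))
    = \<bar>inverse \<epsilon>\<bar> ^ DIM('a) *\<^sub>R (LINT x|lborel. cis (- ((inverse \<epsilon> *\<^sub>R x) \<bullet> \<xi>)) * complex_of_real (gauss (\<epsilon> *\<^sub>R (inverse \<epsilon> *\<^sub>R x))))"
    using integral_lborel_affine[of "inverse \<epsilon>" "\<lambda>x. cis (- (x \<bullet> \<xi>)) * complex_of_real (gauss (\<epsilon> *\<^sub>R x))" 0] e by simp
  also have "(LINT x|lborel. cis (- ((inverse \<epsilon> *\<^sub>R x) \<bullet> \<xi>)) * complex_of_real (gauss (\<epsilon> *\<^sub>R (inverse \<epsilon> *\<^sub>R x))))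
    = FT (\<lambda>x. complex_of_real (gauss x)) (\<xi> /\<^sub>R \<epsilon>)"
    unfolding FT_def using e by simp
  also have "\<dots> = of_real (?c * gauss (\<xi> /\<^sub>R \<epsilon>))" by (rule gauss_FT)
  also have "?c *\<^sub>R (\<bar>inverse \<epsilon>\<bar> ^ DIM('a) *\<^sub>R complex_of_real (?c * gauss (\<xi> /\<^sub>R \<epsilon>)))
     = of_real ((?c * ?c) * (gauss (\<xi> /\<^sub>R \<epsilon>) / \<epsilon> ^ DIM('a)))"
    using e by (simp add: scaleR_conv_of_real field_simps)
  also have "?c * ?c = (2 * pi) ^ DIM('a)" unfolding power_mult_distrib[symmetric] by simp
  finally show ?thesis by (simp add: mollifying_net_def)
qed

lemma gauss_even: "gauss (- x) = gauss x"
  by (simp add: gauss_def std_normal_density_def)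

lemma gauss_net: 
  fixes \<epsilon> :: real
  assumes "\<epsilon> > 0"
  shows "kernel (mollifying_net gauss \<epsilon> :: 'a::euclidean_space \<Rightarrow> real)" "mollifying_net gauss \<epsilon> (- x) = mollifying_net gauss \<epsilon> (x :: 'a)"
    "(LINT x|lborel. \<bar>mollifying_net gauss \<epsilon> (x :: 'a)\<bar>) = 1"
proof -
  show "kernel (mollifying_net gauss \<epsilon> :: 'a \<Rightarrow> real)" by (rule mollifying_net_kernel[OF kernel_gauss assms])
  show "mollifying_net gauss \<epsilon> (- x) = mollifying_net gauss \<epsilon> (x :: 'a)"
    by (simp add: mollifying_net_def gauss_even)
  have "0 \<le> mollifying_net gauss \<epsilon> (x :: 'a)" for x using assms by (simp add: mollifying_net_def gauss_nonneg)
  then show "(LINT x|lborel. \<bar>mollifying_net gauss \<epsilon> (x :: 'a)\<bar>) = 1"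
    using integral_mollifying_net[OF assms, of "gauss :: 'a \<Rightarrow> real"] gauss_integral(2) by simp
qed

text \<open>Fourier inversion smoothed by a Gaussian: the weight on the Fourier side becomes a convolution
  with a narrow Gaussian.\<close>
lemma gweight_inversion:
  assumes f: "integrable lborel f" and e: "\<epsilon> > 0"
  shows "(LINT \<xi>|lborel. FT f \<xi> * (cis (y \<bullet> \<xi>) * of_real (gweight \<epsilon> \<xi>))) 
    = of_real ((2 * pi) ^ DIM('a)) * convol f (mollifying_net gauss \<epsilon>) (y :: 'a::euclidean_space)"
proof -
  have "(LINT \<xi>|lborel. FT f \<xi> * (cis (y \<bullet> \<xi>) * of_real (gweight \<epsilon> \<xi>))) 
    = (LINT x|lborel. f x * FT (\<lambda>\<xi>. cis (y \<bullet> \<xi>) * of_real (gweight \<epsilon> \<xi>)) x)"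
    using FT_integrable'[of "\<lambda>\<xi>. complex_of_real (gweight \<epsilon> \<xi>)" y] gweight_props(4)[OF e, where 'a='a]
    by (intro multiplication_formula f) (simp add: inner_commute)
  also have "\<dots> = (LINT x|lborel. of_real ((2 * pi) ^ DIM('a)) * (mollifying_net gauss \<epsilon> (y - x) *\<^sub>R f x))"
  proof (intro Bochner_Integration.integral_cong refl)
    fix x
    have "FT (\<lambda>\<xi>. cis (y \<bullet> \<xi>) * of_real (gweight \<epsilon> \<xi>)) x = of_real ((2 * pi) ^ DIM('a) * mollifying_net gauss \<epsilon> (x - y))"
      using FT_cis_shift[of y "\<lambda>\<xi>. of_real (gweight \<epsilon> \<xi>)" x] gweight_FT[OF e] by (simp add: inner_commute)
    also have "mollifying_net gauss \<epsilon> (x - y) = mollifying_net gauss \<epsilon> (y - x)"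
      using gauss_net(2)[OF e, of "y - x"] by simp
    finally show "f x * FT (\<lambda>\<xi>. cis (y \<bullet> \<xi>) * of_real (gweight \<epsilon> \<xi>)) x = of_real ((2 * pi) ^ DIM('a)) * (mollifying_net gauss \<epsilon> (y - x) *\<^sub>R f x)"
      by (simp add: scaleR_conv_of_real)
  qed
  also have "\<dots> = of_real ((2 * pi) ^ DIM('a)) * convol f (mollifying_net gauss \<epsilon>) y"
    unfolding convol_def by (rule integral_mult_right_zero)
  finally show ?thesis .
qed

text \<open>With the weight inserted, \<open>|f^|\<^sup>2\<close> may be integrated and unfolded by Fubini to
  \<open>(2\<pi>)\<^sup>d \<langle>f * G\<^sub>\<epsilon>, f\<rangle>\<close> with a Gaussian \<open>G\<^sub>\<epsilon>\<close> of integral \<open>1\<close>, and convolution with \<open>G\<^sub>\<epsilon>\<close> is a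
  contraction.\<close>
lemma weighted_bessel:
  fixes f :: "'a::euclidean_space \<Rightarrow> complex"
  assumes f: "integrable lborel f" "f \<in> L2" and e: "\<epsilon> > 0"
  shows "integrable lborel (\<lambda>\<xi>. gweight \<epsilon> \<xi> * (cmod (FT f \<xi>))\<^sup>2)"
    "(LINT \<xi>|lborel. gweight \<epsilon> \<xi> * (cmod (FT f \<xi>))\<^sup>2) \<le> (2 * pi) ^ DIM('a) * (norm (cls f))\<^sup>2"
proof -
  let ?w = "\<lambda>\<xi>::'a. complex_of_real (gweight \<epsilon> \<xi>)"
  define C where "C = (LINT x|lborel. cmod (f x))"
  have C: "cmod (FT f \<xi>) \<le> C" for \<xi> unfolding C_def by (rule FT_bound[OF f(1)])
  note [measurable] = borel_measurable_integrable[OF f(1)] FT_measurable[OF L2_D(1)[OF f(2)]]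
  have wi: "integrable lborel ?w" by (rule integrable_of_real[OF gweight_props(4)[OF e]])
  note [measurable] = borel_measurable_integrable[OF gweight_props(4)[OF e, where 'a='a]]
  show int: "integrable lborel (\<lambda>\<xi>. gweight \<epsilon> \<xi> * (cmod (FT f \<xi>))\<^sup>2)"
  proof (rule Bochner_Integration.integrable_bound)
    show "integrable lborel (\<lambda>\<xi>::'a. C\<^sup>2 * gweight \<epsilon> \<xi>)" by (intro integrable_mult_right gweight_props(4)[OF e])
    show "AE \<xi> in lborel. norm (gweight \<epsilon> \<xi> * (cmod (FT f \<xi>))\<^sup>2) \<le> norm (C\<^sup>2 * gweight \<epsilon> \<xi>)"
    proof (intro AE_I2)
      fix \<xi> :: 'a
      have "(cmod (FT f \<xi>))\<^sup>2 \<le> C\<^sup>2" by (intro power_mono C) simp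
      from mult_right_mono[OF this gweight_props(1)[of \<epsilon> \<xi>]] gweight_props(1)[of \<epsilon> \<xi>]
      show "norm (gweight \<epsilon> \<xi> * (cmod (FT f \<xi>))\<^sup>2) \<le> norm (C\<^sup>2 * gweight \<epsilon> \<xi>)"
        by (simp only: real_norm_def abs_mult abs_of_nonneg abs_power2 zero_le_power2) (simp add: mult.commute)
    qed
  qed measurable
  let ?h = "\<lambda>y \<xi>. cnj (f y) * (FT f \<xi> * (cis (y \<bullet> \<xi>) * ?w \<xi>))"
  have pair: "integrable (lborel \<Otimes>\<^sub>M lborel) (case_prod ?h)"
  proof (rule integrable_lborel_pair_bound[OF _ f(1) wi, where C="C"])
    have "(\<lambda>p::'a\<times>'a. cnj (f (fst p)) * (FT f (snd p) * (cnj ((\<lambda>(x, \<xi>). cis (- (x \<bullet> \<xi>))) p) * ?w (snd p)))) \<in> borel_measurable (lborel \<Otimes>\<^sub>M lborel)"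
      by measurable
    then show "case_prod ?h \<in> borel_measurable (lborel \<Otimes>\<^sub>M lborel)"
      by (simp add: case_prod_beta' cis_cnj)
    show "cmod (?h y \<xi>) \<le> C * (cmod (f y) * cmod (?w \<xi>))" for y \<xi>
      using mult_right_mono[OF C[of \<xi>], of "cmod (f y) * cmod (?w \<xi>)"] by (simp add: norm_mult mult_ac)
  qed
  have cf: "cnj (FT f \<xi>) = (LINT y|lborel. cis (y \<bullet> \<xi>) * cnj (f y))" for \<xi>
    unfolding FT_def Bochner_Integration.integral_cnj[symmetric]
    by (intro Bochner_Integration.integral_cong refl) (simp add: cis_cnj)
  have "complex_of_real (LINT \<xi>|lborel. gweight \<epsilon> \<xi> * (cmod (FT f \<xi>))\<^sup>2) = (LINT \<xi>|lborel. ?w \<xi> * (FT f \<xi> * cnj (FT f \<xi>)))"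
    unfolding integral_complex_of_real[symmetric]
    by (intro Bochner_Integration.integral_cong refl) (simp only: of_real_mult complex_norm_square)
  also have "\<dots> = (LINT \<xi>|lborel. LINT y|lborel. ?h y \<xi>)"
  proof (intro Bochner_Integration.integral_cong refl)
    fix \<xi>
    have "?w \<xi> * (FT f \<xi> * cnj (FT f \<xi>)) = (LINT y|lborel. (?w \<xi> * FT f \<xi>) * (cis (y \<bullet> \<xi>) * cnj (f y)))"
      unfolding cf by (simp only: integral_mult_right_zero mult.assoc)
    also have "\<dots> = (LINT y|lborel. ?h y \<xi>)"
      by (intro Bochner_Integration.integral_cong refl) (simp only: mult_ac)
    finally show "?w \<xi> * (FT f \<xi> * cnj (FT f \<xi>)) = (LINT y|lborel. ?h y \<xi>)" .
  qed
  also have "\<dots> = (LINT y|lborel. LINT \<xi>|lborel. ?h y \<xi>)"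
    by (rule lborel_pair.Fubini_integral[OF pair])
  also have "\<dots> = (LINT y|lborel. cnj (f y) * (of_real ((2 * pi) ^ DIM('a)) * convol f (mollifying_net gauss \<epsilon>) y))"
    using gweight_inversion[OF f(1) e] by simp
  also have "\<dots> = of_real ((2 * pi) ^ DIM('a)) * (LINT y|lborel. convol f (mollifying_net gauss \<epsilon>) y * cnj (f y))"
    by (subst integral_mult_right_zero[symmetric]) (simp only: mult_ac)
  finally have eq: "complex_of_real (LINT \<xi>|lborel. gweight \<epsilon> \<xi> * (cmod (FT f \<xi>))\<^sup>2) 
    = of_real ((2 * pi) ^ DIM('a)) * (LINT y|lborel. convol f (mollifying_net gauss \<epsilon>) y * cnj (f y))" .
  have re: "X = c * Re Z" if "complex_of_real X = of_real c * Z" for X c Z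
    using arg_cong[OF that, of Re] by simp
  have "(LINT \<xi>|lborel. gweight \<epsilon> \<xi> * (cmod (FT f \<xi>))\<^sup>2) = (2 * pi) ^ DIM('a) * Re (LINT y|lborel. convol f (mollifying_net gauss \<epsilon>) y * cnj (f y))"
    by (rule re[OF eq])
  also have "Re (LINT y|lborel. convol f (mollifying_net gauss \<epsilon>) y * cnj (f y)) = Conv (mollifying_net gauss \<epsilon>) (cls f) \<bullet> cls f"
  proof -
    note k = gauss_net[OF e, where 'a='a]
    have c: "convol f (mollifying_net gauss \<epsilon>) \<in> L2" by (rule convol_L2[OF k(1) f(2)])
    have "Conv (mollifying_net gauss \<epsilon>) (cls f) \<bullet> cls f = (LINT y|lborel. Re (convol f (mollifying_net gauss \<epsilon>) y * cnj (f y)))"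
      unfolding Conv_cls[OF k(1) f(2)] inner_cls[OF c f(2)] by (simp add: inner_complex_def)
    also have "\<dots> = Re (LINT y|lborel. convol f (mollifying_net gauss \<epsilon>) y * cnj (f y))"
      by (rule integral_Re[OF L2_integrable_mult[OF c L2_cnj[OF f(2)]]])
    finally show ?thesis ..
  qed
  also have "\<dots> \<le> norm (Conv (mollifying_net gauss \<epsilon>) (cls f)) * norm (cls f)" by (rule norm_cauchy_schwarz)
  also have "\<dots> \<le> (norm (cls f))\<^sup>2"
    using norm_Conv_le[OF gauss_net(1)[OF e], of "cls f"] gauss_net(3)[OF e, where 'a='a] 
    by (simp add: power2_eq_square mult_right_mono)
  finally show "(LINT \<xi>|lborel. gweight \<epsilon> \<xi> * (cmod (FT f \<xi>))\<^sup>2) \<le> (2 * pi) ^ DIM('a) * (norm (cls f))\<^sup>2"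
    by simp
qed

text \<open>The weights increase to \<open>1\<close> as \<open>\<epsilon>\<close> tends to \<open>0\<close>; the bound is uniform, so Fatou's lemma applies.\<close>
lemma FT_L2:
  fixes f :: "'a::euclidean_space \<Rightarrow> complex"
  assumes f: "integrable lborel f" "f \<in> L2" 
  shows "FT f \<in> L2" "norm (cls (FT f)) \<le> sqrt ((2 * pi) ^ DIM('a)) * norm (cls f)"
proof -
  let ?K = "sqrt ((2 * pi) ^ DIM('a)) * norm (cls f)"
  note m [measurable] = FT_measurable[OF L2_D(1)[OF f(2)]]
  define e where "e n = 1 / real (Suc n)" for n
  have e: "e n > 0" for n by (simp add: e_def)
  note [measurable] = borel_measurable_integrable[OF gweight_props(4)[OF e, where 'a='a]]
  have "(\<integral>\<^sup>+\<xi>. ennreal ((cmod (FT f \<xi>))\<^sup>2) \<partial>lborel) = (\<integral>\<^sup>+\<xi>. liminf (\<lambda>n. ennreal (gweight (e n) \<xi> * (cmod (FT f \<xi>))\<^sup>2)) \<partial>lborel)"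
  proof (rule nn_integral_cong)
    fix \<xi> :: 'a
    have "(\<lambda>n. ennreal (gweight (e n) \<xi> * (cmod (FT f \<xi>))\<^sup>2)) \<longlonglongrightarrow> ennreal (1 * (cmod (FT f \<xi>))\<^sup>2)"
      unfolding e_def by (intro tendsto_ennrealI tendsto_intros gweight_props(3))
    then show "ennreal ((cmod (FT f \<xi>))\<^sup>2) = liminf (\<lambda>n. ennreal (gweight (e n) \<xi> * (cmod (FT f \<xi>))\<^sup>2))"
      using lim_imp_Liminf[OF sequentially_bot] by (metis mult_1)
  qed
  also have "\<dots> \<le> liminf (\<lambda>n. (\<integral>\<^sup>+\<xi>. ennreal (gweight (e n) \<xi> * (cmod (FT f \<xi>))\<^sup>2) \<partial>lborel))"
    by (intro nn_integral_liminf) measurable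
  also have "\<dots> \<le> liminf (\<lambda>n. ennreal (?K\<^sup>2))"
  proof (rule Liminf_mono, intro always_eventually allI)
    fix n
    have "(\<integral>\<^sup>+\<xi>. ennreal (gweight (e n) \<xi> * (cmod (FT f \<xi>))\<^sup>2) \<partial>lborel) = ennreal (LINT \<xi>|lborel. gweight (e n) \<xi> * (cmod (FT f \<xi>))\<^sup>2)"
      by (intro nn_integral_eq_integral weighted_bessel(1)[OF f e] AE_I2 mult_nonneg_nonneg gweight_props(1) zero_le_power2)
    also have "\<dots> \<le> ennreal (?K\<^sup>2)"
      using weighted_bessel(2)[OF f e] by (intro ennreal_leI) (simp add: power_mult_distrib)
    finally show "(\<integral>\<^sup>+\<xi>. ennreal (gweight (e n) \<xi> * (cmod (FT f \<xi>))\<^sup>2) \<partial>lborel) \<le> ennreal (?K\<^sup>2)" .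
  qed
  also have "\<dots> = ennreal (?K\<^sup>2)" by (simp add: Liminf_const)
  finally have "(\<integral>\<^sup>+\<xi>. ennreal ((cmod (FT f \<xi>))\<^sup>2) \<partial>lborel) \<le> ennreal (?K\<^sup>2)" .
  from L2_nn_bound[OF m this] show "FT f \<in> L2" "norm (cls (FT f)) \<le> ?K" by auto
qed

subsection \<open>Extension to \<open>L\<^sup>2\<close>\<close>

text \<open>The limit runs over integer truncation radii, which suffices for a definition; lemma
  \<open>Fourier_trunc_tendsto\<close> shows that all real radii give the same limit.\<close>
definition Fourier :: "'a::euclidean_space l2 \<Rightarrow> 'a l2" where
  "Fourier F = lim (\<lambda>n. cls (FT (trunc (real n) (rep_l2 F))))"

lemma trunc_int: "f \<in> L2 \<Longrightarrow> integrable lborel (trunc R f)"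
  by (intro bdd_supp_L2_integrable trunc_L2 trunc_bdd_supp)

lemma FT_cls_diff:
  fixes f g :: "'a::euclidean_space \<Rightarrow> complex"
  assumes f: "integrable lborel f" "f \<in> L2" and g: "integrable lborel g" "g \<in> L2"
  shows "norm (cls (FT f) - cls (FT g)) \<le> sqrt ((2 * pi) ^ DIM('a)) * norm (cls f - cls g)"
proof -
  have "FT (\<lambda>x. f x - g x) = (\<lambda>\<xi>. FT f \<xi> - FT g \<xi>)" by (intro ext FT_diff f g)
  then have "cls (FT f) - cls (FT g) = cls (FT (\<lambda>x. f x - g x))"
    by (simp only: cls_diff[OF FT_L2(1)[OF f] FT_L2(1)[OF g]])
  also have "norm \<dots> \<le> sqrt ((2 * pi) ^ DIM('a)) * norm (cls (\<lambda>x. f x - g x))"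
    by (intro FT_L2(2) Bochner_Integration.integrable_diff L2_diff f g)
  finally show ?thesis by (simp only: cls_diff[OF f(2) g(2)])
qed

lemma trunc_seq_tendsto: "f \<in> L2 \<Longrightarrow> (\<lambda>n. cls (trunc (real n) f)) \<longlonglongrightarrow> cls f"
  by (rule filterlim_compose[OF trunc_tendsto filterlim_real_sequentially])

lemma Fourier_LIMSEQ:
  fixes f :: "'a::euclidean_space \<Rightarrow> complex"
  assumes f: "f \<in> L2"
  shows "(\<lambda>n. cls (FT (trunc (real n) f))) \<longlonglongrightarrow> Fourier (cls f)"
proof -
  let ?r = "rep_l2 (cls f)"
  have eq: "FT (trunc R ?r) = FT (trunc R f)" for R
  proof
    fix \<xi> show "FT (trunc R ?r) \<xi> = FT (trunc R f) \<xi>"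
    proof (rule FT_cong_AE)
      show "AE x in lborel. trunc R ?r x = trunc R f x"
        using rep_cls[OF f] by eventually_elim (simp add: trunc_def)
    qed (intro L2_D(1) trunc_L2 f rep_l2)+
  qed
  have "Cauchy (\<lambda>n. cls (FT (trunc (real n) f)))"
  proof (rule metric_CauchyI)
    fix e :: real assume e: "e > 0"
    define K where "K = sqrt ((2 * pi) ^ DIM('a))"
    have K: "K > 0" by (simp add: K_def)
    have "Cauchy (\<lambda>n. cls (trunc (real n) f))"
      by (rule LIMSEQ_imp_Cauchy[OF trunc_seq_tendsto[OF f]])
    from metric_CauchyD[OF this divide_pos_pos[OF e K]]
    obtain M where M: "\<And>m n. m \<ge> M \<Longrightarrow> n \<ge> M \<Longrightarrow> dist (cls (trunc (real m) f)) (cls (trunc (real n) f)) < e / K"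
      by blast
    have "dist (cls (FT (trunc (real m) f))) (cls (FT (trunc (real n) f))) < e" if "m \<ge> M" "n \<ge> M" for m n
    proof -
      have "dist (cls (FT (trunc (real m) f))) (cls (FT (trunc (real n) f))) \<le> K * dist (cls (trunc (real m) f)) (cls (trunc (real n) f))"
        unfolding dist_norm K_def by (intro FT_cls_diff trunc_int trunc_L2 f)
      also have "\<dots> < K * (e / K)" by (rule mult_strict_left_mono[OF M[OF that] K])
      finally show ?thesis using K by simp
    qed
    then show "\<exists>M. \<forall>m\<ge>M. \<forall>n\<ge>M. dist (cls (FT (trunc (real m) f))) (cls (FT (trunc (real n) f))) < e" by blast
  qed
  then have "convergent (\<lambda>n. cls (FT (trunc (real n) f)))" by (simp add: Cauchy_convergent_iff)
  then show ?thesis by (simp add: Fourier_def eq convergent_LIMSEQ_iff)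
qed

text \<open>This single estimate gives the agreement with the integral formula, the convergence along real
  radii and the boundedness of the operator.\<close>
lemma Fourier_diff_le:
  fixes f g :: "'a::euclidean_space \<Rightarrow> complex"
  assumes f: "f \<in> L2" and g: "integrable lborel g" "g \<in> L2"
  shows "norm (Fourier (cls f) - cls (FT g)) \<le> sqrt ((2 * pi) ^ DIM('a)) * norm (cls f - cls g)"
proof (rule tendsto_le[OF sequentially_bot])
  show "(\<lambda>n. norm (cls (FT (trunc (real n) f)) - cls (FT g))) \<longlonglongrightarrow> norm (Fourier (cls f) - cls (FT g))"
    by (intro tendsto_intros Fourier_LIMSEQ f)
  show "(\<lambda>n. sqrt ((2 * pi) ^ DIM('a)) * norm (cls (trunc (real n) f) - cls g)) \<longlonglongrightarrow> sqrt ((2 * pi) ^ DIM('a)) * norm (cls f - cls g)"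
    by (intro tendsto_intros trunc_seq_tendsto f)
  show "\<forall>\<^sub>F n in sequentially. norm (cls (FT (trunc (real n) f)) - cls (FT g)) \<le> sqrt ((2 * pi) ^ DIM('a)) * norm (cls (trunc (real n) f) - cls g)"
    by (intro always_eventually allI FT_cls_diff trunc_int trunc_L2 f g)
qed

lemma Fourier_cls:
  assumes "integrable lborel f" "f \<in> L2"
  shows "Fourier (cls f) = cls (FT f)"
  using Fourier_diff_le[OF assms(2) assms] by simp

lemma Fourier_trunc_tendsto:
  fixes f :: "'a::euclidean_space \<Rightarrow> complex"
  assumes f: "f \<in> L2"
  shows "((\<lambda>R. cls (FT (trunc R f))) \<longlongrightarrow> Fourier (cls f)) at_top"
proof (rule LIM_zero_cancel, rule Lim_null_comparison)
  show "\<forall>\<^sub>F R in at_top. norm (cls (FT (trunc R f)) - Fourier (cls f)) \<le> sqrt ((2 * pi) ^ DIM('a)) * norm (cls f - cls (trunc R f))"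
    using Fourier_diff_le[OF f trunc_int trunc_L2, OF f f] by (intro always_eventually allI) (simp add: norm_minus_commute)
  have "((\<lambda>R. sqrt ((2 * pi) ^ DIM('a)) * norm (cls f - cls (trunc R f))) \<longlongrightarrow> sqrt ((2 * pi) ^ DIM('a)) * norm (cls f - cls f)) at_top"
    by (intro tendsto_intros trunc_tendsto f)
  then show "((\<lambda>R. sqrt ((2 * pi) ^ DIM('a)) * norm (cls f - cls (trunc R f))) \<longlongrightarrow> 0) at_top" by simp
qed

lemma bounded_linear_Fourier: "bounded_linear (Fourier :: 'a::euclidean_space l2 \<Rightarrow> 'a l2)"
proof (rule bounded_linear_intro)
  fix F G :: "'a l2" and c :: real
  obtain f g where f: "f \<in> L2" "F = cls f" and g: "g \<in> L2" "G = cls g"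
    using l2_cases by metis
  have t: "trunc R (\<lambda>x. f x + g x) = (\<lambda>x. trunc R f x + trunc R g x)" 
    "trunc R (\<lambda>x. c *\<^sub>R f x) = (\<lambda>x. c *\<^sub>R trunc R f x)" for R
    by (auto simp: trunc_def distrib_left)
  have F2: "FT (trunc R h) \<in> L2" if "h \<in> L2" for R and h :: "'a \<Rightarrow> complex"
    by (intro FT_L2 trunc_int trunc_L2 that)
  have "cls (FT (trunc R (\<lambda>x. f x + g x))) = cls (FT (trunc R f)) + cls (FT (trunc R g))" for R
  proof -
    have "FT (trunc R (\<lambda>x. f x + g x)) = (\<lambda>\<xi>. FT (trunc R f) \<xi> + FT (trunc R g) \<xi>)"
      unfolding t by (intro ext FT_add trunc_int f g)
    then show ?thesis using cls_add[OF F2[OF f(1)] F2[OF g(1)]] by simp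
  qed
  then have "(\<lambda>n. cls (FT (trunc (real n) f)) + cls (FT (trunc (real n) g))) \<longlonglongrightarrow> Fourier (cls (\<lambda>x. f x + g x))"
    using Fourier_LIMSEQ[OF L2_add[OF f(1) g(1)]] by simp
  from LIMSEQ_unique[OF this tendsto_add[OF Fourier_LIMSEQ[OF f(1)] Fourier_LIMSEQ[OF g(1)]]]
  show "Fourier (F + G) = Fourier F + Fourier G" by (simp add: f g cls_add)
  have "cls (FT (trunc R (\<lambda>x. c *\<^sub>R f x))) = c *\<^sub>R cls (FT (trunc R f))" for R
  proof -
    have "FT (trunc R (\<lambda>x. c *\<^sub>R f x)) = (\<lambda>\<xi>. c *\<^sub>R FT (trunc R f) \<xi>)"
      unfolding t by (intro ext FT_scaleR)
    then show ?thesis using cls_scaleR[OF F2[OF f(1)]] by simp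
  qed
  then have "(\<lambda>n. c *\<^sub>R cls (FT (trunc (real n) f))) \<longlonglongrightarrow> Fourier (cls (\<lambda>x. c *\<^sub>R f x))"
    using Fourier_LIMSEQ[OF L2_scaleR[OF f(1)], of c] by simp
  from LIMSEQ_unique[OF this tendsto_scaleR[OF tendsto_const Fourier_LIMSEQ[OF f(1)]]]
  show "Fourier (c *\<^sub>R F) = c *\<^sub>R Fourier F" by (simp add: f cls_scaleR)
  have "FT (\<lambda>x. 0) = (\<lambda>\<xi>::'a. 0)" by (simp add: FT_def fun_eq_iff)
  then show "norm (Fourier F) \<le> norm F * sqrt ((2 * pi) ^ DIM('a))"
    using Fourier_diff_le[OF f(1), of "\<lambda>x. 0"] by (simp add: f cls_zero mult.commute)
qed

text \<open>Translates the limits in the definitions of the transforms and of solutions into convergence in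
  the normed space of classes.\<close>
lemma L2_lim_iff:
  assumes "\<forall>\<^sub>F i in net. F i \<in> L2"
  shows "L2_lim F l net \<longleftrightarrow> l \<in> L2 \<and> ((\<lambda>i. cls (F i)) \<longlongrightarrow> cls l) net"
proof -
  have "((\<lambda>i. L2_norm (\<lambda>x. F i x - l x)) \<longlongrightarrow> 0) net \<longleftrightarrow> ((\<lambda>i. cls (F i)) \<longlongrightarrow> cls l) net" if l: "l \<in> L2"
  proof -
    have "((\<lambda>i. cls (F i)) \<longlongrightarrow> cls l) net \<longleftrightarrow> ((\<lambda>i. norm (cls (F i) - cls l)) \<longlongrightarrow> 0) net"
      by (simp add: LIM_zero_iff tendsto_norm_zero_iff)
    also have "\<dots> \<longleftrightarrow> ((\<lambda>i. L2_norm (\<lambda>x. F i x - l x)) \<longlongrightarrow> 0) net"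
      by (rule tendsto_cong, use assms in eventually_elim)
         (simp add: l L2_diff norm_cls flip: cls_diff)
    finally show ?thesis ..
  qed
  then show ?thesis using assms by (auto simp: L2_lim_def)
qed

lemma set_integral_FT_trunc:
  "(LINT x:cball 0 R|lborel. cis (- (x \<bullet> \<xi>)) * f x) = FT (trunc R f) \<xi>"
  unfolding set_lebesgue_integral_def FT_def trunc_def
  by (intro Bochner_Integration.integral_cong refl) (simp add: indicator_def)

lemma has_fourier_iff:
  "has_fourier f g \<longleftrightarrow> f \<in> L2 \<and> g \<in> L2 \<and> Fourier (cls f) = cls g"
proof (cases "f \<in> L2")
  case True
  have e: "\<forall>\<^sub>F R in at_top. FT (trunc R f) \<in> L2"
    by (intro always_eventually allI FT_L2 trunc_int trunc_L2 True)
  show ?thesis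
    unfolding has_fourier_def set_integral_FT_trunc L2_lim_iff[OF e]
    using Fourier_trunc_tendsto[OF True] tendsto_unique[OF trivial_limit_at_top_linorder] True by metis
qed (simp add: has_fourier_def)

subsection \<open>Reflection, conjugation and the inverse transform\<close>

definition Reflect :: "'a::euclidean_space l2 \<Rightarrow> 'a l2" where
  "Reflect F = cls (\<lambda>x. rep_l2 F (- x))"

lemma L2_reflect:
  assumes f: "f \<in> L2"
  shows "(\<lambda>x. f (- x)) \<in> L2"
proof (rule L2_I)
  note [measurable] = L2_D(1)[OF f]
  show "(\<lambda>x. f (- x)) \<in> borel_measurable borel" by measurable
  show "integrable lborel (\<lambda>x. (cmod (f (- x)))\<^sup>2)"
    using integrable_lborel_reflect[OF L2_D(2)[OF f], of 0] by simp
qed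

lemma AE_lborel_reflect:
  assumes "AE x in lborel. P (x::'a::euclidean_space)"
  shows "AE x in lborel. P (- x)"
proof -
  obtain N where N': "{x \<in> space lborel. \<not> P x} \<subseteq> N" "emeasure lborel N = 0" "N \<in> sets lborel"
    using AE_E[OF assms] by blast
  then have N: "N \<in> null_sets lborel" "{x. \<not> P x} \<subseteq> N" by auto
  have Ns [measurable]: "N \<in> sets borel" using N'(3) by simp
  have "emeasure lborel {x. - x \<in> N} = (\<integral>\<^sup>+x. indicator N (0 - x) \<partial>lborel)"
  proof -
    have m: "{x. - x \<in> N} \<in> sets lborel" by measurable
    have "emeasure lborel {x. - x \<in> N} = (\<integral>\<^sup>+x. indicator {x. - x \<in> N} x \<partial>lborel)"
      using m by simp
    also have "\<dots> = (\<integral>\<^sup>+x. indicator N (0 - x) \<partial>lborel)"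
      by (intro nn_integral_cong) (simp add: indicator_def)
    finally show ?thesis .
  qed
  also have "\<dots> = (\<integral>\<^sup>+x. indicator N x \<partial>lborel)" by (rule nn_integral_lborel_reflect) measurable
  also have "\<dots> = 0" using N(1) by auto
  finally have "{x. - x \<in> N} \<in> null_sets lborel" by (intro null_setsI) measurable
  then show ?thesis by (rule AE_I') (use N(2) in auto)
qed

lemma Reflect_cls: "f \<in> L2 \<Longrightarrow> Reflect (cls f) = cls (\<lambda>x. f (- x))"
  unfolding Reflect_def
  by (intro cls_eqI L2_reflect rep_l2 AE_lborel_reflect[of "\<lambda>x. rep_l2 (cls f) x = f x"] rep_cls)

lemma norm_Reflect: "norm (Reflect F) = norm F"
proof -
  obtain f where f: "f \<in> L2" "F = cls f" by (rule l2_cases)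
  have "(norm (Reflect F))\<^sup>2 = (norm F)\<^sup>2"
    using integral_lborel_reflect[of "\<lambda>x. (cmod (f x))\<^sup>2" 0]
    by (simp add: f Reflect_cls norm_cls_sq L2_reflect)
  then show ?thesis by simp
qed

lemma bounded_linear_Reflect: "bounded_linear Reflect"
proof (rule bounded_linear_intro)
  fix F G :: "'a l2" and c :: real
  obtain f g where f: "f \<in> L2" "F = cls f" and g: "g \<in> L2" "G = cls g"
    using l2_cases by metis
  show "Reflect (F + G) = Reflect F + Reflect G"
    using cls_add[OF L2_reflect[OF f(1)] L2_reflect[OF g(1)]]
    by (simp add: f g Reflect_cls L2_add flip: cls_add)
  show "Reflect (c *\<^sub>R F) = c *\<^sub>R Reflect F"
    using cls_scaleR[OF L2_reflect[OF f(1)], of c]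
    by (simp add: f Reflect_cls L2_scaleR flip: cls_scaleR)
  show "norm (Reflect F) \<le> norm F * 1" by (simp add: norm_Reflect)
qed

definition Cnj :: "'a::euclidean_space l2 \<Rightarrow> 'a l2" where
  "Cnj F = cls (\<lambda>x. cnj (rep_l2 F x))"

lemma Cnj_cls: "f \<in> L2 \<Longrightarrow> Cnj (cls f) = cls (\<lambda>x. cnj (f x))"
  unfolding Cnj_def
  by (intro cls_eqI L2_cnj rep_l2) (use rep_cls[of f] in auto)

lemma bounded_linear_Cnj: "bounded_linear Cnj"
proof (rule bounded_linear_intro)
  fix F G :: "'a l2" and c :: real
  obtain f g where f: "f \<in> L2" "F = cls f" and g: "g \<in> L2" "G = cls g"
    using l2_cases by metis
  show "Cnj (F + G) = Cnj F + Cnj G"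
    using cls_add[OF L2_cnj[OF f(1)] L2_cnj[OF g(1)]]
    by (simp add: f g Cnj_cls L2_add flip: cls_add)
  show "Cnj (c *\<^sub>R F) = c *\<^sub>R Cnj F"
    using cls_scaleR[OF L2_cnj[OF f(1)], of c]
    by (simp add: f Cnj_cls L2_scaleR flip: cls_scaleR)
  show "norm (Cnj F) \<le> norm F * 1"
    using norm_cls_le[OF L2_cnj[OF f(1)] f(1), of 1] by (simp add: f Cnj_cls)
qed

lemma Cnj_Mult:
  assumes m: "ess_bdd m" and r: "\<And>x. cnj (m x) = m x"
  shows "Cnj (Mult m F) = Mult m (Cnj F)"
proof -
  obtain f where f: "f \<in> L2" "F = cls f" by (rule l2_cases)
  show ?thesis using L2_mult[OF m f(1)] L2_cnj[OF f(1)] by (simp add: f Mult_cls[OF m] Cnj_cls r)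
qed

lemma Reflect_Mult:
  assumes m: "ess_bdd m" and r: "\<And>x. m (- x) = m x"
  shows "Reflect (Mult m F) = Mult m (Reflect F)"
proof -
  obtain f where f: "f \<in> L2" "F = cls f" by (rule l2_cases)
  show ?thesis using L2_mult[OF m f(1)] L2_reflect[OF f(1)] by (simp add: f Mult_cls[OF m] Reflect_cls r)
qed

lemma Cnj_Reflect: "Cnj (Reflect F) = Reflect (Cnj F)"
proof -
  obtain f where f: "f \<in> L2" "F = cls f" by (rule l2_cases)
  show ?thesis by (simp add: f Reflect_cls Cnj_cls L2_cnj L2_reflect)
qed

lemma Reflect_Reflect: "Reflect (Reflect F) = F"
proof -
  obtain f where f: "f \<in> L2" "F = cls f" by (rule l2_cases)
  show ?thesis by (simp add: f Reflect_cls L2_reflect)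
qed

lemma Mult_inner_commute:
  assumes m: "ess_bdd m" and r: "\<And>x. cnj (m x) = m x"
  shows "Mult m F \<bullet> G = F \<bullet> Mult m G"
proof -
  obtain f g where f: "f \<in> L2" "F = cls f" and g: "g \<in> L2" "G = cls g"
    using l2_cases by metis
  have "(m x * f x) \<bullet> g x = f x \<bullet> (m x * g x)" for x
    using r[of x] by (simp add: inner_complex_def complex_eq_iff algebra_simps)
  then show ?thesis by (simp add: f g Mult_cls[OF m] inner_cls L2_mult[OF m])
qed

lemma Fourier_Cnj: "Fourier (Cnj F) = Cnj (Reflect (Fourier F))"
proof (rule continuous_l2_eqI[where A="\<lambda>F. Fourier (Cnj F)" and B="\<lambda>F. Cnj (Reflect (Fourier F))"])
  show "continuous_on UNIV (\<lambda>F. Fourier (Cnj F))" 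
    by (rule linear_continuous_on[OF bounded_linear_compose[OF bounded_linear_Fourier bounded_linear_Cnj]])
  show "continuous_on UNIV (\<lambda>F. Cnj (Reflect (Fourier F)))"
    by (rule linear_continuous_on[OF bounded_linear_compose[OF bounded_linear_Cnj bounded_linear_compose[OF bounded_linear_Reflect bounded_linear_Fourier]]])
  fix f :: "'a \<Rightarrow> complex" assume f: "f \<in> L2" "integrable lborel f"
  have "FT (\<lambda>x. cnj (f x)) \<xi> = cnj (FT f (- \<xi>))" for \<xi>
    unfolding FT_def Bochner_Integration.integral_cnj[symmetric]
    by (intro Bochner_Integration.integral_cong refl) (simp add: cis_cnj)
  then have "FT (\<lambda>x. cnj (f x)) = (\<lambda>\<xi>. cnj (FT f (- \<xi>)))" by (rule ext)
  then show "Fourier (Cnj (cls f)) = Cnj (Reflect (Fourier (cls f)))"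
    using f by (simp add: Cnj_cls Fourier_cls L2_cnj Reflect_cls FT_L2 L2_reflect)
qed

text \<open>The inverse integral differs from the Fourier integral by a reflection and the factor
  \<open>(2\<pi>)\<^sup>-\<^sup>d\<close>, so its \<open>L\<^sup>2\<close> theory is inherited.\<close>
definition Inv_Fourier :: "'a::euclidean_space l2 \<Rightarrow> 'a l2" where
  "Inv_Fourier G = (1 / (2 * pi) ^ DIM('a)) *\<^sub>R Reflect (Fourier G)"

lemma bounded_linear_Inv_Fourier: "bounded_linear Inv_Fourier"
  unfolding Inv_Fourier_def[abs_def]
  by (intro bounded_linear_const_scaleR bounded_linear_compose[OF bounded_linear_Reflect bounded_linear_Fourier])

lemma Inv_Fourier_Cnj_Reflect: "Inv_Fourier (Cnj (Reflect F)) = Cnj (Inv_Fourier F)"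
proof -
  have "Fourier (Reflect F) = Reflect (Fourier F)" for F :: "'a l2"
  proof (rule continuous_l2_eqI[where A="\<lambda>F. Fourier (Reflect F)" and B="\<lambda>F. Reflect (Fourier F)"])
    show "continuous_on UNIV (\<lambda>F::'a l2. Fourier (Reflect F))" 
      by (rule linear_continuous_on[OF bounded_linear_compose[OF bounded_linear_Fourier bounded_linear_Reflect]])
    show "continuous_on UNIV (\<lambda>F::'a l2. Reflect (Fourier F))"
      by (rule linear_continuous_on[OF bounded_linear_compose[OF bounded_linear_Reflect bounded_linear_Fourier]])
    fix f :: "'a \<Rightarrow> complex" assume f: "f \<in> L2" "integrable lborel f"
    have "FT (\<lambda>x. f (- x)) \<xi> = FT f (- \<xi>)" for \<xi>
      unfolding FT_def using integral_lborel_reflect[of "\<lambda>x. cis (- (x \<bullet> - \<xi>)) * f x" 0] by simp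
    then have "FT (\<lambda>x. f (- x)) = (\<lambda>\<xi>. FT f (- \<xi>))" by (rule ext)
    then show "Fourier (Reflect (cls f)) = Reflect (Fourier (cls f))"
      using f integrable_lborel_reflect[OF f(2), of 0] by (simp add: Fourier_cls Reflect_cls FT_L2 L2_reflect)
  qed
  then show ?thesis
    by (simp add: Inv_Fourier_def Fourier_Cnj Cnj_Reflect Reflect_Reflect linear_simps(5)[OF bounded_linear_Cnj])
qed

text \<open>The device that moves the fractional Laplacian of a test function onto the solution: in an
  inner product, \<open>Inv_Fourier\<close> on one side becomes \<open>Fourier\<close> on the other.\<close>
lemma inner_Inv_Fourier: 
  fixes F G :: "'a::euclidean_space l2"
  shows "F \<bullet> Inv_Fourier G = (1 / (2 * pi) ^ DIM('a)) * (Fourier F \<bullet> G)"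
proof (rule continuous_l2_eqI[where A="\<lambda>F. F \<bullet> Inv_Fourier G" and B="\<lambda>F. (1 / (2 * pi) ^ DIM('a)) * (Fourier F \<bullet> G)"])
  show "continuous_on UNIV (\<lambda>F::'a l2. F \<bullet> Inv_Fourier G)" "continuous_on UNIV (\<lambda>F::'a l2. (1 / (2 * pi) ^ DIM('a)) * (Fourier F \<bullet> G))"
    by (intro continuous_intros linear_continuous_on[OF bounded_linear_Fourier])+
  fix f :: "'a \<Rightarrow> complex" assume f: "f \<in> L2" "integrable lborel f"
  show "cls f \<bullet> Inv_Fourier G = (1 / (2 * pi) ^ DIM('a)) * (Fourier (cls f) \<bullet> G)"
  proof (rule continuous_l2_eqI[where A="\<lambda>G. cls f \<bullet> Inv_Fourier G" and B="\<lambda>G. (1 / (2 * pi) ^ DIM('a)) * (Fourier (cls f) \<bullet> G)"])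
    show "continuous_on UNIV (\<lambda>G. cls f \<bullet> Inv_Fourier G)" "continuous_on UNIV (\<lambda>G. (1 / (2 * pi) ^ DIM('a)) * (Fourier (cls f) \<bullet> G))"
      by (intro continuous_intros linear_continuous_on[OF bounded_linear_Inv_Fourier])+
    fix g :: "'a \<Rightarrow> complex" assume g: "g \<in> L2" "integrable lborel g"
    have Fg: "FT g \<in> L2" and Ff: "FT f \<in> L2" using FT_L2 f g by auto
    have gc: "integrable lborel (\<lambda>x. cnj (g x))" using g(2) by simp
    have cg: "cnj (FT g (- x)) = FT (\<lambda>x. cnj (g x)) x" for x
      unfolding FT_def Bochner_Integration.integral_cnj[symmetric]
      by (intro Bochner_Integration.integral_cong refl) (simp add: cis_cnj)
    have "cls f \<bullet> Reflect (Fourier (cls g)) = (LINT x|lborel. Re (f x * cnj (FT g (- x))))"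
      using f g Fg by (simp add: Fourier_cls Reflect_cls inner_cls L2_reflect) (simp add: inner_complex_def)
    also have "\<dots> = Re (LINT x|lborel. f x * cnj (FT g (- x)))"
      by (rule integral_Re[OF L2_integrable_mult[OF f(1) L2_cnj[OF L2_reflect[OF Fg]]]])
    also have "(LINT x|lborel. f x * cnj (FT g (- x))) = (LINT \<xi>|lborel. FT f \<xi> * cnj (g \<xi>))"
      unfolding cg by (rule multiplication_formula[OF f(2) gc, symmetric])
    also have "Re \<dots> = (LINT \<xi>|lborel. Re (FT f \<xi> * cnj (g \<xi>)))"
      by (rule integral_Re[OF L2_integrable_mult[OF Ff L2_cnj[OF g(1)]], symmetric])
    also have "\<dots> = Fourier (cls f) \<bullet> cls g"
      using f g Ff by (simp add: Fourier_cls inner_cls) (simp add: inner_complex_def)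
    finally show "cls f \<bullet> Inv_Fourier (cls g) = (1 / (2 * pi) ^ DIM('a)) * (Fourier (cls f) \<bullet> cls g)"
      by (simp add: Inv_Fourier_def)
  qed
qed

lemma has_inv_fourier_iff:
  fixes f g :: "'a::euclidean_space \<Rightarrow> complex"
  shows "has_inv_fourier g f \<longleftrightarrow> g \<in> L2 \<and> f \<in> L2 \<and> Inv_Fourier (cls g) = cls f"
proof (cases "g \<in> L2")
  case True
  define c where "c = 1 / (2 * pi) ^ DIM('a)"
  have F2: "FT (trunc R g) \<in> L2" for R by (intro FT_L2 trunc_int trunc_L2 True)
  have eq: "(LINT \<xi>:cball 0 R|lborel. cis (x \<bullet> \<xi>) * g \<xi>) / of_real ((2 * pi) ^ DIM('a)) = c *\<^sub>R FT (trunc R g) (- x)" for R x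
    using set_integral_FT_trunc[of R "- x" g] by (simp add: inner_commute c_def scaleR_conv_of_real divide_inverse mult.commute)
  have L: "(\<lambda>x. c *\<^sub>R FT (trunc R g) (- x)) \<in> L2" for R
    by (intro L2_scaleR L2_reflect F2)
  have cl: "cls (\<lambda>x. c *\<^sub>R FT (trunc R g) (- x)) = c *\<^sub>R Reflect (cls (FT (trunc R g)))" for R
    by (simp add: Reflect_cls F2 cls_scaleR L2_reflect)
  have e: "\<forall>\<^sub>F R in at_top. (\<lambda>x. c *\<^sub>R FT (trunc R g) (- x)) \<in> L2" by (intro always_eventually allI L)
  have lim: "((\<lambda>R. c *\<^sub>R Reflect (cls (FT (trunc R g)))) \<longlongrightarrow> Inv_Fourier (cls g)) at_top"
    unfolding Inv_Fourier_def c_def 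
    by (intro tendsto_intros bounded_linear.tendsto[OF bounded_linear_Reflect] Fourier_trunc_tendsto True)
  show ?thesis
    unfolding has_inv_fourier_def eq L2_lim_iff[OF e] cl
    using lim tendsto_unique[OF trivial_limit_at_top_linorder] True by metis
qed (simp add: has_inv_fourier_def)

subsection \<open>Fourier transform of convolutions\<close>

lemma convol_pair_integrable:
  fixes f :: "'a::euclidean_space \<Rightarrow> complex"
  assumes k: "integrable lborel k" and f: "integrable lborel f"
  shows "integrable (lborel \<Otimes>\<^sub>M lborel) (\<lambda>(y, x). k (x - y) *\<^sub>R f y)"
proof (rule lborel_pair.Fubini_integrable)
  note [measurable] = borel_measurable_integrable[OF k] borel_measurable_integrable[OF f]
  show "(\<lambda>(y, x). k (x - y) *\<^sub>R f y) \<in> borel_measurable (lborel \<Otimes>\<^sub>M lborel)" by measurable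
  show "AE y in lborel. integrable lborel (\<lambda>x. case (y, x) of (y, x) \<Rightarrow> k (x - y) *\<^sub>R f y)"
    using integrable_lborel_shift[OF k] by simp
  have "(LINT x|lborel. norm (k (x - y) *\<^sub>R f y)) = (LINT x|lborel. \<bar>k x\<bar>) * cmod (f y)" for y
    using integral_lborel_shift[of "\<lambda>x. \<bar>k x\<bar>" y] by simp
  then show "integrable lborel (\<lambda>y. LINT x|lborel. norm (case (y, x) of (y, x) \<Rightarrow> k (x - y) *\<^sub>R f y))"
    using f by (simp only: case_prod_conv integrable_mult_right integrable_norm)
qed

lemma convol_integrable_L1:
  fixes f :: "'a::euclidean_space \<Rightarrow> complex"
  assumes k: "integrable lborel k" and f: "integrable lborel f"
  shows "integrable lborel (convol f k)"
proof -
  have "integrable lborel (\<lambda>x. LINT y|lborel. k (x - y) *\<^sub>R f y)"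
    using lborel_pair.integrable_snd[OF convol_pair_integrable[OF k f]] by simp
  then show ?thesis by (simp add: convol_def[abs_def])
qed

lemma FT_convol:
  fixes f :: "'a::euclidean_space \<Rightarrow> complex"
  assumes k: "integrable lborel k" and f: "integrable lborel f"
  shows "FT (convol f k) \<xi> = FT (\<lambda>x. of_real (k x)) \<xi> * FT f \<xi>"
proof -
  let ?h = "\<lambda>y x. cis (- (x \<bullet> \<xi>)) * (k (x - y) *\<^sub>R f y)"
  have int: "integrable (lborel \<Otimes>\<^sub>M lborel) (case_prod ?h)"
  proof (rule Bochner_Integration.integrable_bound[OF convol_pair_integrable[OF k f]])
    note [measurable] = borel_measurable_integrable[OF k] borel_measurable_integrable[OF f]
    show "case_prod ?h \<in> borel_measurable (lborel \<Otimes>\<^sub>M lborel)" by measurable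
  qed (auto simp: norm_mult)
  have "FT (convol f k) \<xi> = (LINT x|lborel. LINT y|lborel. ?h y x)"
    unfolding FT_def convol_def by (simp only: integral_mult_right_zero)
  also have "\<dots> = (LINT y|lborel. LINT x|lborel. ?h y x)"
    by (rule lborel_pair.Fubini_integral[OF int])
  also have "\<dots> = (LINT y|lborel. FT (\<lambda>x. of_real (k x)) \<xi> * (cis (- (y \<bullet> \<xi>)) * f y))"
  proof (intro Bochner_Integration.integral_cong refl)
    fix y
    have "(LINT x|lborel. ?h y x) = (LINT x|lborel. (cis (- ((x - y) \<bullet> \<xi>)) * of_real (k (x - y))) * (cis (- (y \<bullet> \<xi>)) * f y))"
    proof (intro Bochner_Integration.integral_cong refl)
      fix x
      have "cis (- (x \<bullet> \<xi>)) = cis (- ((x - y) \<bullet> \<xi>)) * cis (- (y \<bullet> \<xi>))"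
        by (simp add: cis_mult inner_diff_left)
      then show "?h y x = (cis (- ((x - y) \<bullet> \<xi>)) * of_real (k (x - y))) * (cis (- (y \<bullet> \<xi>)) * f y)"
        by (simp add: scaleR_conv_of_real mult_ac)
    qed
    also have "\<dots> = (LINT x|lborel. cis (- ((x - y) \<bullet> \<xi>)) * of_real (k (x - y))) * (cis (- (y \<bullet> \<xi>)) * f y)"
      by (rule integral_mult_left_zero)
    also have "(LINT x|lborel. cis (- ((x - y) \<bullet> \<xi>)) * of_real (k (x - y))) = FT (\<lambda>x. of_real (k x)) \<xi>"
      unfolding FT_def using integral_lborel_shift[of "\<lambda>x. cis (- (x \<bullet> \<xi>)) * of_real (k x)" y] by simp
    finally show "(LINT x|lborel. ?h y x) = FT (\<lambda>x. of_real (k x)) \<xi> * (cis (- (y \<bullet> \<xi>)) * f y)" .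
  qed
  also have "\<dots> = FT (\<lambda>x. of_real (k x)) \<xi> * FT f \<xi>"
    unfolding FT_def[of f] by (rule integral_mult_right_zero)
  finally show ?thesis .
qed

text \<open>The symbol of a kernel: convolution with \<open>k\<close> is the Fourier multiplier \<open>ksym k\<close>.\<close>
definition ksym :: "('a::euclidean_space \<Rightarrow> real) \<Rightarrow> 'a \<Rightarrow> complex" where
  "ksym k = FT (\<lambda>x. of_real (k x))"

lemma ksym_bound: "kernel k \<Longrightarrow> cmod (ksym k \<xi>) \<le> (LINT x|lborel. \<bar>k x\<bar>)"
  unfolding ksym_def using FT_bound[of "\<lambda>x. complex_of_real (k x)"] by (auto dest: kernelD)

lemma ksym_measurable: "kernel k \<Longrightarrow> ksym k \<in> borel_measurable borel"
  unfolding ksym_def by (intro FT_measurable) (auto dest: kernelD(1))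

lemma ess_bdd_ksym: "kernel k \<Longrightarrow> ess_bdd (ksym k)"
  by (rule ess_bdd_I[OF ksym_measurable ksym_bound])

lemma Fourier_Conv:
  assumes k: "kernel k"
  shows "Fourier (Conv k F) = Mult (ksym k) (Fourier F)"
proof (rule continuous_l2_eqI[where A="\<lambda>F. Fourier (Conv k F)" and B="\<lambda>F. Mult (ksym k) (Fourier F)"])
  show "continuous_on UNIV (\<lambda>F. Fourier (Conv k F))" 
    by (rule linear_continuous_on[OF bounded_linear_compose[OF bounded_linear_Fourier bounded_linear_Conv[OF k]]])
  show "continuous_on UNIV (\<lambda>F. Mult (ksym k) (Fourier F))"
    by (rule linear_continuous_on[OF bounded_linear_compose[OF bounded_linear_Mult[OF ess_bdd_ksym[OF k]] bounded_linear_Fourier]])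
  fix f :: "'a \<Rightarrow> complex" assume f: "f \<in> L2" "integrable lborel f"
  have "FT (convol f k) = (\<lambda>\<xi>. ksym k \<xi> * FT f \<xi>)"
    unfolding ksym_def by (intro ext FT_convol kernelD(2)[OF k] f)
  then show "Fourier (Conv k (cls f)) = Mult (ksym k) (Fourier (cls f))"
    using f k by (simp add: Conv_cls Fourier_cls convol_L2 convol_integrable_L1[OF kernelD(2)[OF k] f(2)] Mult_cls ess_bdd_ksym FT_L2)
qed

section \<open>Smooth kernels\<close>

subsection \<open>Closure properties of smoothness\<close>

lemma Ck_SucI:
  assumes "\<And>x. (f has_derivative D x) (at x)" "\<And>v. Ck k (\<lambda>x. D x v)"
  shows "Ck (Suc k) f"
proof -
  have "frechet_derivative f (at x) = D x" for x using frechet_derivative_at[OF assms(1)] by metis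
  then show ?thesis using assms by (auto simp: differentiable_def)
qed

lemma Ck_SucD:
  assumes "Ck (Suc k) f"
  shows "(f has_derivative frechet_derivative f (at x)) (at x)" "Ck k (\<lambda>x. frechet_derivative f (at x) v)"
  using assms by (auto simp: frechet_derivative_works[symmetric])

text \<open>Needed for products: the derivative of \<open>f g\<close> contains \<open>f\<close> and \<open>g\<close> themselves with one order of
  smoothness to spare.\<close>
lemma Ck_Suc_imp_Ck: "Ck (Suc k) f \<Longrightarrow> Ck k f"
proof (induction k arbitrary: f)
  case 0
  have "continuous (at x) f" for x using Ck_SucD(1)[OF 0] by (rule has_derivative_continuous)
  then show ?case by (simp add: continuous_at_imp_continuous_on)
next
  case (Suc k)
  show ?case
  proof (rule Ck_SucI)
    show "(f has_derivative frechet_derivative f (at x)) (at x)" for x by (rule Ck_SucD(1)[OF Suc.prems])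
    show "Ck k (\<lambda>x. frechet_derivative f (at x) v)" for v
      by (rule Suc.IH) (rule Ck_SucD(2)[OF Suc.prems])
  qed
qed

lemma Ck_bounded_linear:
  assumes L: "bounded_linear L" and f: "Ck k f"
  shows "Ck k (\<lambda>x. L (f x))"
  using f
proof (induction k arbitrary: f)
  case 0
  then show ?case using bounded_linear.continuous_on[OF L] by simp
next
  case (Suc k)
  show ?case
    by (rule Ck_SucI[OF bounded_linear.has_derivative[OF L Ck_SucD(1)[OF Suc.prems]]])
       (rule Suc.IH[OF Ck_SucD(2)[OF Suc.prems]])
qed

lemma Ck_affine:
  assumes L: "bounded_linear L" and f: "Ck k f"
  shows "Ck k (\<lambda>x. f (c + L x))"
  using f
proof (induction k arbitrary: f)
  case 0
  then have "continuous_on UNIV f" by simp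
  moreover have "continuous_on UNIV (\<lambda>x. c + L x)"
    by (intro continuous_intros linear_continuous_on[OF L])
  ultimately show ?case
    using continuous_on_compose2[of UNIV f UNIV "\<lambda>x. c + L x"] by simp
next
  case (Suc k)
  show ?case
  proof (rule Ck_SucI)
    show "((\<lambda>x. f (c + L x)) has_derivative (\<lambda>v. frechet_derivative f (at (c + L x)) (L v))) (at x)" for x
    proof -
      have "((\<lambda>x. c + L x) has_derivative L) (at x)"
        by (auto intro!: derivative_eq_intros bounded_linear_imp_has_derivative[OF L])
      from has_derivative_compose[OF this Ck_SucD(1)[OF Suc.prems]] show ?thesis .
    qed
    show "Ck k (\<lambda>x. frechet_derivative f (at (c + L x)) (L v))" for v
      by (rule Suc.IH[OF Ck_SucD(2)[OF Suc.prems]])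
  qed
qed

lemma Ck_add: "Ck k f \<Longrightarrow> Ck k g \<Longrightarrow> Ck k (\<lambda>x. f x + g x)"
proof (induction k arbitrary: f g)
  case 0
  then show ?case by (auto intro: continuous_intros)
next
  case (Suc k)
  show ?case
    by (rule Ck_SucI[OF has_derivative_add[OF Ck_SucD(1)[OF Suc.prems(1)] Ck_SucD(1)[OF Suc.prems(2)]]])
       (rule Suc.IH[OF Ck_SucD(2)[OF Suc.prems(1)] Ck_SucD(2)[OF Suc.prems(2)]])
qed

lemma Ck_bilinear:
  assumes B: "bounded_bilinear B" 
  shows "Ck k f \<Longrightarrow> Ck k g \<Longrightarrow> Ck k (\<lambda>x. B (f x) (g x))"
proof (induction k arbitrary: f g)
  case 0
  then show ?case using bounded_bilinear.continuous_on[OF B] by auto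
next
  case (Suc k)
  show ?case
    by (rule Ck_SucI[OF bounded_bilinear.FDERIV[OF B Ck_SucD(1)[OF Suc.prems(1)] Ck_SucD(1)[OF Suc.prems(2)]]])
       (intro Ck_add Suc.IH Ck_Suc_imp_Ck[OF Suc.prems(1)] Ck_Suc_imp_Ck[OF Suc.prems(2)]
          Ck_SucD(2)[OF Suc.prems(1)] Ck_SucD(2)[OF Suc.prems(2)])
qed

text \<open>A form of \<open>test_functions UNIV\<close> in which support conditions are inequalities between
  norms.\<close>
definition smooth_compact :: "('a::euclidean_space \<Rightarrow> 'b::real_normed_vector) \<Rightarrow> bool" where
  "smooth_compact f \<longleftrightarrow> (\<forall>k. Ck k f) \<and> bdd_supp f"

lemma test_functions_UNIV_iff: "f \<in> test_functions UNIV \<longleftrightarrow> smooth_compact f"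
proof
  assume "smooth_compact f"
  then obtain R where f: "\<And>k. Ck k f" "\<And>x. norm x > R \<Longrightarrow> f x = 0" by (auto simp: smooth_compact_def bdd_supp_def)
  have "{x. f x \<noteq> 0} \<subseteq> cball 0 R" using f(2) by (force simp: not_less)
  then have "compact (closure {x. f x \<noteq> 0})" using bounded_subset[OF bounded_cball] compact_closure by blast
  then show "f \<in> test_functions UNIV" using f(1) by (simp add: test_functions_def)
qed (auto simp: smooth_compact_def test_function_props)

lemma smooth_compactD:
  assumes "smooth_compact f"
  shows "continuous_on UNIV f" "bdd_supp f" "Ck k f" "(f has_derivative frechet_derivative f (at x)) (at x)"
proof -
  show k: "Ck k f" for k using assms by (simp add: smooth_compact_def)
  from k[of 0] show "continuous_on UNIV f" by simp
  from Ck_SucD(1)[OF k] show "(f has_derivative frechet_derivative f (at x)) (at x)" .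
  show "bdd_supp f" using assms by (simp add: smooth_compact_def)
qed

lemma smooth_compact_deriv:
  assumes f: "smooth_compact f"
  shows "smooth_compact (\<lambda>x. frechet_derivative f (at x) v)"
proof -
  obtain R where R: "\<And>x. norm x > R \<Longrightarrow> f x = 0" using smooth_compactD(2)[OF f] by (auto simp: bdd_supp_def)
  have "frechet_derivative f (at x) v = 0" if "norm x > R" for x
  proof -
    have "(f has_derivative (\<lambda>_. 0)) (at x)"
    proof (rule has_derivative_transform_within_open[where f="\<lambda>_. 0" and s="{x. norm x > R}"])
      show "open {x::'a. norm x > R}" by (intro open_Collect_less continuous_intros)
    qed (use that R in auto)
    from frechet_derivative_at[OF this] show ?thesis by metis
  qed
  then have "bdd_supp (\<lambda>x. frechet_derivative f (at x) v)" by (auto simp: bdd_supp_def)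
  then show ?thesis using Ck_SucD(2)[OF smooth_compactD(3)[OF f]] by (simp add: smooth_compact_def)
qed

lemma kernel_smooth_compact: "smooth_compact k \<Longrightarrow> kernel k"
  using kernelI[OF smooth_compactD(1) smooth_compactD(2)] by blast

subsection \<open>Convolution with a smooth kernel\<close>

lemma uniformly_continuous_bdd_supp:
  fixes f :: "'a::euclidean_space \<Rightarrow> 'b::real_normed_vector"
  assumes c: "continuous_on UNIV f" and b: "bdd_supp f"
  shows "uniformly_continuous_on UNIV f"
  unfolding uniformly_continuous_on_def
proof (intro allI impI)
  fix e :: real assume e: "e > 0"
  obtain R where R: "\<And>x. norm x > R \<Longrightarrow> f x = 0" using b by (auto simp: bdd_supp_def)
  have "uniformly_continuous_on (cball 0 (R + 1)) f"
    by (intro compact_uniformly_continuous continuous_on_subset[OF c]) auto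
  then obtain d where d: "d > 0" "\<And>x y. x \<in> cball 0 (R+1) \<Longrightarrow> y \<in> cball 0 (R+1) \<Longrightarrow> dist y x < d \<Longrightarrow> dist (f y) (f x) < e"
    using e unfolding uniformly_continuous_on_def by meson
  have "dist (f y) (f x) < e" if "dist y x < min d 1" for x y
  proof (cases "x \<in> cball 0 (R+1) \<and> y \<in> cball 0 (R+1)")
    case False
    have "norm x \<le> norm y + dist y x" "norm y \<le> norm x + dist y x"
      using norm_triangle_sub[of x y] norm_triangle_sub[of y x] by (auto simp: dist_norm norm_minus_commute)
    then have "norm x > R" "norm y > R" using False that by auto
    then show ?thesis using R e by simp
  qed (use d that in auto)
  then show "\<exists>d>0. \<forall>x\<in>UNIV. \<forall>y\<in>UNIV. dist y x < d \<longrightarrow> dist (f y) (f x) < e"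
    using d(1) by (intro exI[of _ "min d 1"]) auto
qed

text \<open>The directional derivatives along a basis are uniformly continuous by compactness of the
  support; the mean value inequality then makes the linear approximation uniform.\<close>
lemma smooth_compact_uniform_derivative:
  fixes k :: "'a::euclidean_space \<Rightarrow> real"
  assumes k: "smooth_compact k" and e: "e > 0"
  shows "\<exists>d>0. \<forall>y h. norm h < d \<longrightarrow> \<bar>k (y + h) - k y - frechet_derivative k (at y) h\<bar> \<le> e * norm h"
proof -
  let ?D = "\<lambda>x v. frechet_derivative k (at x) v"
  define e' where "e' = e / DIM('a)"
  have e': "e' > 0" using e by (simp add: e'_def)
  have "\<exists>d>0. \<forall>x y. dist y x < d \<longrightarrow> \<bar>?D y b - ?D x b\<bar> < e'" for b
  proof -
    note s = smooth_compact_deriv[OF k, of b]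
    from uniformly_continuous_bdd_supp[OF smooth_compactD(1)[OF s] smooth_compactD(2)[OF s]] e'
    show ?thesis unfolding uniformly_continuous_on_def by (simp add: dist_real_def)
  qed
  then obtain d where d: "\<And>b. d b > 0" "\<And>b x y. dist y x < d b \<Longrightarrow> \<bar>?D y b - ?D x b\<bar> < e'"
    by metis
  define d0 where "d0 = Min (d ` Basis)"
  have d0: "d0 > 0" unfolding d0_def using d(1) by (subst Min_gr_iff) auto
  have d0': "d0 \<le> d b" if "b \<in> Basis" for b unfolding d0_def using that by (intro Min_le) auto
  have lin: "linear (?D x)" for x using has_derivative_linear[OF smooth_compactD(4)[OF k]] .
  have "\<bar>k (y + h) - k y - ?D y h\<bar> \<le> e * norm h" if h: "norm h < d0" for y h
  proof -
    have "norm (k (y + h) - k y - ?D y ((y + h) - y)) \<le> norm ((y + h) - y) * e"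
    proof (rule differentiable_bound_linearization[where S="ball y d0" and f'="?D"])
      show "y + t *\<^sub>R (y + h - y) \<in> ball y d0" if "t \<in> {0..1}" for t
      proof -
        have "norm (t *\<^sub>R h) \<le> 1 * norm h" unfolding norm_scaleR by (rule mult_right_mono) (use that in auto)
        then show ?thesis using h by (simp add: dist_norm)
      qed
      show "(k has_derivative ?D x) (at x within ball y d0)" for x
        using smooth_compactD(4)[OF k] by (rule has_derivative_at_withinI)
      show "y \<in> ball y d0" using d0 by simp
      show "onorm (?D x - ?D y) \<le> e" if x: "x \<in> ball y d0" for x
        unfolding fun_diff_def
      proof (rule onorm_le)
        fix v :: 'a
        interpret l: linear "\<lambda>v. ?D x v - ?D y v" by (intro linear_compose_sub lin)
        have "?D x (\<Sum>b\<in>Basis. (v \<bullet> b) *\<^sub>R b) - ?D y (\<Sum>b\<in>Basis. (v \<bullet> b) *\<^sub>R b) = (\<Sum>b\<in>Basis. (v \<bullet> b) *\<^sub>R (?D x b - ?D y b))"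
          by (simp only: l.sum l.scale)
        then have "norm (?D x v - ?D y v) = norm (\<Sum>b\<in>Basis. (v \<bullet> b) *\<^sub>R (?D x b - ?D y b))"
          by (simp only: euclidean_representation)
        also have "\<dots> \<le> (\<Sum>b\<in>(Basis::'a set). norm v * e')"
        proof (rule sum_norm_le)
          fix b :: 'a assume b: "b \<in> Basis"
          have "\<bar>?D x b - ?D y b\<bar> < e'" using d(2) d0'[OF b] x by (simp add: dist_commute)
          then show "norm ((v \<bullet> b) *\<^sub>R (?D x b - ?D y b)) \<le> norm v * e'"
            using Basis_le_norm[OF b, of v] by (simp add: abs_mult mult_mono)
        qed
        also have "\<dots> = e * norm v" by (simp add: e'_def)
        finally show "norm (?D x v - ?D y v) \<le> e * norm v" .
      qed
    qed
    then show ?thesis by (simp add: mult.commute)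
  qed
  then show ?thesis using d0 by blast
qed

text \<open>The uniform linear approximation of \<open>k\<close> can be integrated against \<open>z\<close>, so that \<open>z\<close> need only be
  integrable.\<close>
lemma convol_has_derivative:
  fixes k :: "'a::euclidean_space \<Rightarrow> real" and z :: "'a \<Rightarrow> 'b::{banach, second_countable_topology}"
  assumes k: "smooth_compact k" and z: "integrable lborel z"
  shows "(convol z k has_derivative (\<lambda>v. convol z (\<lambda>x. frechet_derivative k (at x) v) x)) (at x)"
proof -
  let ?D = "\<lambda>x v. frechet_derivative k (at x) v"
  note [measurable] = borel_measurable_integrable[OF z]
  have int: "integrable lborel (\<lambda>y. f (x - y) *\<^sub>R z y)" if f: "smooth_compact f" for f x
  proof -
    from kernelD[OF kernel_smooth_compact[OF f]] obtain C where f [measurable]: "f \<in> borel_measurable borel" and C: "\<And>x. \<bar>f x\<bar> \<le> C" by auto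
    show ?thesis
    proof (rule Bochner_Integration.integrable_bound)
      show "integrable lborel (\<lambda>y. C *\<^sub>R z y)" using z by simp
      show "AE y in lborel. norm (f (x - y) *\<^sub>R z y) \<le> norm (C *\<^sub>R z y)"
        using C by (intro AE_I2) (auto intro!: mult_right_mono intro: order.trans[OF _ abs_ge_self])
    qed measurable
  qed
  have lin: "linear (?D x)" for x using has_derivative_linear[OF smooth_compactD(4)[OF k]] .
  show ?thesis
    unfolding has_derivative_at_alt
  proof (intro conjI allI impI)
    have "linear (\<lambda>v. convol z (\<lambda>x. ?D x v) x)"
    proof (rule linearI)
      show "convol z (\<lambda>x. ?D x (v + w)) x = convol z (\<lambda>x. ?D x v) x + convol z (\<lambda>x. ?D x w) x" for v w
        using int[OF smooth_compact_deriv[OF k]] 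
        by (simp add: convol_def linear_add[OF lin] scaleR_add_left)
      show "convol z (\<lambda>x. ?D x (c *\<^sub>R v)) x = c *\<^sub>R convol z (\<lambda>x. ?D x v) x" for c v
        by (simp add: convol_def linear_scale[OF lin] flip: scaleR_scaleR)
    qed
    then show "bounded_linear (\<lambda>v. convol z (\<lambda>x. ?D x v) x)" by (rule linear_conv_bounded_linear[THEN iffD1])
    fix e :: real assume e: "e > 0"
    \<comment> \<open>The summand \<open>1\<close> keeps the divisor positive when \<open>z\<close> vanishes.\<close>
    define K where "K = (LINT y|lborel. norm (z y)) + 1"
    have K: "K > 0" unfolding K_def by (intro add_nonneg_pos) auto
    obtain d where d: "d > 0" "\<And>y h. norm h < d \<Longrightarrow> \<bar>k (y + h) - k y - ?D y h\<bar> \<le> e / K * norm h"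
      using smooth_compact_uniform_derivative[OF k divide_pos_pos[OF e K]] by blast
    have "norm (convol z k y - convol z k x - convol z (\<lambda>w. ?D w (y - x)) x) \<le> e * norm (y - x)" if "norm (y - x) < d" for y
    proof -
      have "convol z k y - convol z k x - convol z (\<lambda>w. ?D w (y - x)) x
         = (LINT w|lborel. k (y - w) *\<^sub>R z w - k (x - w) *\<^sub>R z w - ?D (x - w) (y - x) *\<^sub>R z w)"
        unfolding convol_def using int[OF k] int[OF smooth_compact_deriv[OF k]] by simp
      also have "norm \<dots> \<le> (LINT w|lborel. e / K * norm (y - x) * norm (z w))"
      proof (rule order.trans[OF integral_norm_bound], rule integral_mono)
        show "integrable lborel (\<lambda>w. norm (k (y - w) *\<^sub>R z w - k (x - w) *\<^sub>R z w - ?D (x - w) (y - x) *\<^sub>R z w))"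
          by (intro integrable_norm Bochner_Integration.integrable_diff int k smooth_compact_deriv)
        show "integrable lborel (\<lambda>w. e / K * norm (y - x) * norm (z w))" using z by simp
        fix w
        have "\<bar>k ((x - w) + (y - x)) - k (x - w) - ?D (x - w) (y - x)\<bar> \<le> e / K * norm (y - x)"
          by (rule d(2)[OF that])
        then have "\<bar>k (y - w) - k (x - w) - ?D (x - w) (y - x)\<bar> * norm (z w) \<le> e / K * norm (y - x) * norm (z w)"
          by (intro mult_right_mono) (auto simp: algebra_simps)
        then show "norm (k (y - w) *\<^sub>R z w - k (x - w) *\<^sub>R z w - ?D (x - w) (y - x) *\<^sub>R z w) \<le> e / K * norm (y - x) * norm (z w)"
          by (simp flip: scaleR_diff_left)
      qed
      also have "\<dots> = e / K * norm (y - x) * (K - 1)" by (simp add: K_def)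
      also have "\<dots> \<le> e / K * norm (y - x) * K" using e K by (intro mult_left_mono) auto
      also have "\<dots> = e * norm (y - x)" using K by simp
      finally show ?thesis .
    qed
    then show "\<exists>d>0. \<forall>y. norm (y - x) < d \<longrightarrow> norm (convol z k y - convol z k x - convol z (\<lambda>w. ?D w (y - x)) x) \<le> e * norm (y - x)"
      using d(1) by blast
  qed
qed

lemma convol_Ck:
  fixes k :: "'a::euclidean_space \<Rightarrow> real" and z :: "'a \<Rightarrow> 'b::{banach, second_countable_topology}"
  assumes z: "integrable lborel z"
  shows "smooth_compact k \<Longrightarrow> Ck n (convol z k)"
proof (induction n arbitrary: k)
  case 0
  have "continuous (at x) (convol z k)" for x
    using convol_has_derivative[OF 0 z] by (rule has_derivative_continuous)
  then show ?case by (simp add: continuous_at_imp_continuous_on)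
next
  case (Suc n)
  show ?case
    by (rule Ck_SucI[OF convol_has_derivative[OF Suc.prems z]])
       (rule Suc.IH[OF smooth_compact_deriv[OF Suc.prems]])
qed

lemma convol_smooth_compact:
  fixes k :: "'a::euclidean_space \<Rightarrow> real" and z :: "'a \<Rightarrow> 'b::{banach, second_countable_topology}"
  assumes z: "integrable lborel z" "bdd_supp z" and k: "smooth_compact k"
  shows "smooth_compact (convol z k)"
proof -
  obtain R where R: "\<And>x. norm x > R \<Longrightarrow> k x = 0" using smooth_compactD(2)[OF k] by (auto simp: bdd_supp_def)
  obtain S where S: "\<And>x. norm x > S \<Longrightarrow> z x = 0" using z(2) by (auto simp: bdd_supp_def)
  have "convol z k x = 0" if "norm x > R + S" for x
  proof -
    have "k (x - y) *\<^sub>R z y = 0" for y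
      using R[of "x - y"] S[of y] that norm_triangle_ineq[of "x - y" y] by fastforce
    then show ?thesis by (simp only: convol_def integral_zero)
  qed
  then have "bdd_supp (convol z k)" by (auto simp: bdd_supp_def)
  then show ?thesis using convol_Ck[OF z(1) k] by (simp add: smooth_compact_def)
qed

subsection \<open>Decay of the symbol of a smooth kernel\<close>

text \<open>Convolving \<open>k\<close> with the plane wave \<open>cis (y \<bullet> \<xi>)\<close> gives \<open>cis (x \<bullet> \<xi>) * ksym k \<xi>\<close>. Differentiating
  this at \<open>0\<close> in two ways replaces an integration by parts. The plane wave is cut off far away to
  become integrable, which changes nothing for \<open>x\<close> near \<open>0\<close>.\<close>
lemma ksym_deriv:
  fixes k :: "'a::euclidean_space \<Rightarrow> real"
  assumes k: "smooth_compact k"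
  shows "ksym (\<lambda>x. frechet_derivative k (at x) v) \<xi> = \<i> * of_real (v \<bullet> \<xi>) * ksym k \<xi>"
proof -
  let ?D = "\<lambda>x v. frechet_derivative k (at x) v"
  obtain R where R: "\<And>x. norm x > R \<Longrightarrow> k x = 0" using smooth_compactD(2)[OF k] by (auto simp: bdd_supp_def)
  obtain S where S: "\<And>x. norm x > S \<Longrightarrow> ?D x v = 0" using smooth_compactD(2)[OF smooth_compact_deriv[OF k]] by (auto simp: bdd_supp_def)
  \<comment> \<open>For \<open>norm x < 1\<close> the convolution at \<open>x\<close> only sees the ball of radius \<open>Q\<close>, where the cut-off is \<open>1\<close>.\<close>
  define Q where "Q = max R S + 1"
  define z where "z y = indicator (cball 0 Q) y * cis (y \<bullet> \<xi>)" for y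
  have z: "integrable lborel z"
  proof (rule Bochner_Integration.integrable_bound)
    show "integrable lborel (indicator (cball 0 Q) :: 'a \<Rightarrow> real)" by (rule integrable_indicator_cball)
    have [measurable]: "(indicator (cball 0 Q) :: 'a \<Rightarrow> complex) \<in> borel_measurable borel"
      by (rule complex_indicator_measurable) simp
    show "z \<in> borel_measurable lborel" unfolding z_def[abs_def] by measurable
  qed (auto simp: z_def norm_mult indicator_def)
  have conv: "convol z f x = cis (x \<bullet> \<xi>) * ksym f \<xi>" 
    if f: "\<And>x. norm x > Q - 1 \<Longrightarrow> f x = 0" and x: "norm x < 1" for f :: "'a \<Rightarrow> real" and x
  proof -
    have "convol z f x = (LINT y|lborel. f (x - y) *\<^sub>R cis (y \<bullet> \<xi>))"
      unfolding convol_def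
    proof (intro Bochner_Integration.integral_cong refl)
      fix y
      have "f (x - y) = 0" if "norm y > Q"
        using that x norm_triangle_ineq2[of y x] by (intro f) (simp add: norm_minus_commute)
      then show "f (x - y) *\<^sub>R z y = f (x - y) *\<^sub>R cis (y \<bullet> \<xi>)"
        by (cases "norm y > Q") (auto simp: z_def)
    qed
    also have "\<dots> = (LINT y|lborel. f (x - (x - y)) *\<^sub>R cis ((x - y) \<bullet> \<xi>))"
      by (rule integral_lborel_reflect[symmetric])
    also have "\<dots> = (LINT y|lborel. cis (x \<bullet> \<xi>) * (cis (- (y \<bullet> \<xi>)) * of_real (f y)))"
      by (intro Bochner_Integration.integral_cong refl)
         (simp add: scaleR_conv_of_real inner_diff_left cis_mult mult.assoc[symmetric] mult.commute[of "of_real _"])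
    also have "\<dots> = cis (x \<bullet> \<xi>) * ksym f \<xi>"
      by (simp add: ksym_def FT_def)
    finally show ?thesis .
  qed
  have "((\<lambda>x. convol z k x) has_derivative (\<lambda>v. convol z (\<lambda>x. ?D x v) 0)) (at 0)"
    using convol_has_derivative[OF k z] .
  then have "((\<lambda>x. cis (x \<bullet> \<xi>) * ksym k \<xi>) has_derivative (\<lambda>v. convol z (\<lambda>x. ?D x v) 0)) (at 0)"
    by (rule has_derivative_transform_within_open[where s="ball 0 1"]) (auto intro!: conv R simp: Q_def)
  moreover have "((\<lambda>x. cis (x \<bullet> \<xi>) * ksym k \<xi>) has_derivative (\<lambda>v. \<i> * of_real (v \<bullet> \<xi>) * ksym k \<xi>)) (at 0)"
  proof -
    have g: "((\<lambda>x. \<i> * complex_of_real (x \<bullet> \<xi>)) has_derivative (\<lambda>v. \<i> * complex_of_real (v \<bullet> \<xi>))) (at 0)"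
      by (intro has_derivative_mult_right has_derivative_of_real has_derivative_inner_left has_derivative_ident)
    have e: "(exp has_derivative (\<lambda>h. exp (\<i> * complex_of_real (0 \<bullet> \<xi>)) * h)) (at (\<i> * complex_of_real (0 \<bullet> \<xi>)))"
      by (rule has_field_derivative_imp_has_derivative[OF DERIV_exp])
    from has_derivative_mult_left[OF has_derivative_compose[OF g e], of "ksym k \<xi>"]
    show ?thesis by (simp add: cis_conv_exp)
  qed
  ultimately have "(\<lambda>v. convol z (\<lambda>x. ?D x v) 0) = (\<lambda>v. \<i> * of_real (v \<bullet> \<xi>) * ksym k \<xi>)"
    by (rule has_derivative_unique)
  then have "convol z (\<lambda>x. ?D x v) 0 = \<i> * of_real (v \<bullet> \<xi>) * ksym k \<xi>" by (rule fun_cong)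
  moreover have "convol z (\<lambda>x. ?D x v) 0 = ksym (\<lambda>x. ?D x v) \<xi>"
    using conv[of "\<lambda>x. ?D x v" 0] S by (simp add: Q_def)
  ultimately show ?thesis by simp
qed

lemma ksym_decay_direction:
  fixes k :: "'a::euclidean_space \<Rightarrow> real"
  shows "smooth_compact k \<Longrightarrow> \<exists>C. \<forall>\<xi>. \<bar>v \<bullet> \<xi>\<bar> ^ n * cmod (ksym k \<xi>) \<le> C"
proof (induction n arbitrary: k)
  case 0
  then show ?case using ksym_bound[OF kernel_smooth_compact[OF 0]] by auto
next
  case (Suc n)
  obtain C where "\<And>\<xi>. \<bar>v \<bullet> \<xi>\<bar> ^ n * cmod (ksym (\<lambda>x. frechet_derivative k (at x) v) \<xi>) \<le> C"
    using Suc.IH[OF smooth_compact_deriv[OF Suc.prems]] by blast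
  then show ?case
    unfolding ksym_deriv[OF Suc.prems] by (auto simp: norm_mult mult_ac)
qed

lemma ksym_decay_power:
  fixes k :: "'a::euclidean_space \<Rightarrow> real"
  assumes k: "smooth_compact k"
  shows "\<exists>C. \<forall>\<xi>. norm \<xi> ^ n * cmod (ksym k \<xi>) \<le> C"
proof -
  obtain C where C: "\<And>b \<xi>. \<bar>b \<bullet> \<xi>\<bar> ^ n * cmod (ksym k \<xi>) \<le> C b"
    using ksym_decay_direction[OF k, of _ n] by metis
  have C0: "0 \<le> C b" for b using order.trans[OF _ C[of b 0]] by simp
  have "norm \<xi> ^ n * cmod (ksym k \<xi>) \<le> real DIM('a) ^ n * (\<Sum>b\<in>Basis. C b)" for \<xi> :: 'a
  proof -
    have "\<exists>b\<in>Basis. norm \<xi> \<le> real DIM('a) * \<bar>\<xi> \<bullet> b\<bar>"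
    proof (rule ccontr)
      assume "\<not> ?thesis"
      then have "\<bar>\<xi> \<bullet> b\<bar> < norm \<xi> / real DIM('a)" if "b \<in> Basis" for b
        using that by (auto simp: field_simps not_le)
      then have "(\<Sum>b\<in>(Basis::'a set). \<bar>\<xi> \<bullet> b\<bar>) < (\<Sum>b\<in>(Basis::'a set). norm \<xi> / real DIM('a))"
        by (intro sum_strict_mono) auto
      also have "\<dots> = norm \<xi>" by simp
      finally show False using norm_le_l1[of \<xi>] by simp
    qed
    then obtain b where b: "b \<in> Basis" "norm \<xi> \<le> real DIM('a) * \<bar>\<xi> \<bullet> b\<bar>" by blast
    have "norm \<xi> ^ n \<le> (real DIM('a) * \<bar>\<xi> \<bullet> b\<bar>) ^ n" by (rule power_mono[OF b(2)]) simp
    then have "norm \<xi> ^ n * cmod (ksym k \<xi>) \<le> (real DIM('a) * \<bar>\<xi> \<bullet> b\<bar>) ^ n * cmod (ksym k \<xi>)"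
      by (rule mult_right_mono) simp
    also have "\<dots> = real DIM('a) ^ n * (\<bar>b \<bullet> \<xi>\<bar> ^ n * cmod (ksym k \<xi>))"
      by (simp add: power_mult_distrib inner_commute)
    also have "\<dots> \<le> real DIM('a) ^ n * C b" by (intro mult_left_mono C) simp
    also have "C b \<le> (\<Sum>b\<in>Basis. C b)" using b(1) C0 by (intro member_le_sum) auto
    finally show ?thesis by (simp add: mult_left_mono)
  qed
  then show ?thesis by blast
qed

text \<open>This makes \<open>|\<xi>|\<^bsup>2s\<^esup> ksym k \<xi>\<close> a bounded multiplier, so that the fractional Laplacian of a mollified
  function is defined on all of \<open>L\<^sup>2\<close>.\<close>
lemma ksym_decay:
  fixes k :: "'a::euclidean_space \<Rightarrow> real"
  assumes k: "smooth_compact k" and r: "r \<ge> 0"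
  shows "\<exists>C. \<forall>\<xi>. norm \<xi> powr r * cmod (ksym k \<xi>) \<le> C"
proof -
  obtain n :: nat where n: "r \<le> real n" using real_arch_simple by blast
  obtain C where C: "\<And>\<xi>. norm \<xi> ^ n * cmod (ksym k \<xi>) \<le> C" using ksym_decay_power[OF k] by blast
  obtain B where B: "\<And>\<xi>. norm \<xi> ^ 0 * cmod (ksym k \<xi>) \<le> B" using ksym_decay_power[OF k] by blast
  have "norm \<xi> powr r * cmod (ksym k \<xi>) \<le> C + B" for \<xi>
  proof -
    have "norm \<xi> powr r \<le> norm \<xi> ^ n + 1"
    proof (cases "norm \<xi> \<ge> 1")
      case True
      then have "norm \<xi> powr r \<le> norm \<xi> powr real n" using n by (intro powr_mono) auto
      also have "\<dots> = norm \<xi> ^ n" using True by (intro powr_realpow) auto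
      finally show ?thesis by simp
    next
      case False
      then have "norm \<xi> powr r \<le> 1 powr r" using r by (intro powr_mono2) auto
      then show ?thesis by (simp add: add_increasing)
    qed
    then have "norm \<xi> powr r * cmod (ksym k \<xi>) \<le> (norm \<xi> ^ n + 1) * cmod (ksym k \<xi>)"
      by (rule mult_right_mono) simp
    also have "\<dots> \<le> C + B" using C[of \<xi>] B[of \<xi>] by (simp add: distrib_right)
    finally show ?thesis .
  qed
  then show ?thesis by blast
qed

section \<open>The equation in weak form\<close>

subsection \<open>Solutions and coefficients in \<open>L\<^sup>2\<close>\<close>

lemma has_vector_derivative_iff_quotient:
  fixes U :: "real \<Rightarrow> 'b::real_normed_vector"
  shows "(U has_vector_derivative V) (at t within S) \<longleftrightarrow> ((\<lambda>r. (U r - U t) /\<^sub>R (r - t)) \<longlongrightarrow> V) (at t within S)"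
proof -
  have ev: "\<forall>\<^sub>F r in at t within S. norm ((1 / norm (r - t)) *\<^sub>R (U r - (U t + (r - t) *\<^sub>R V))) = norm ((U r - U t) /\<^sub>R (r - t) - V)"
    unfolding eventually_at_filter
  proof (intro always_eventually allI impI)
    fix r assume "r \<noteq> t"
    then have "(U r - U t) /\<^sub>R (r - t) - V = inverse (r - t) *\<^sub>R (U r - (U t + (r - t) *\<^sub>R V))"
      by (simp add: scaleR_diff_right scaleR_add_right)
    then show "norm ((1 / norm (r - t)) *\<^sub>R (U r - (U t + (r - t) *\<^sub>R V))) = norm ((U r - U t) /\<^sub>R (r - t) - V)"
      by (simp add: divide_inverse)
  qed
  have "(U has_vector_derivative V) (at t within S) \<longleftrightarrow>
      ((\<lambda>r. norm ((1 / norm (r - t)) *\<^sub>R (U r - (U t + (r - t) *\<^sub>R V)))) \<longlongrightarrow> 0) (at t within S)"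
    unfolding has_vector_derivative_def has_derivative_within tendsto_norm_zero_iff by (simp add: bounded_linear_scaleR_left)
  also have "\<dots> \<longleftrightarrow> ((\<lambda>r. norm ((U r - U t) /\<^sub>R (r - t) - V)) \<longlongrightarrow> 0) (at t within S)"
    by (rule tendsto_cong[OF ev])
  finally show ?thesis by (simp add: LIM_zero_iff tendsto_norm_zero_iff)
qed

lemma C1_L2_cls:
  assumes C: "C1_L2 T u v" and T: "T > 0"
  shows "\<And>t. t \<in> {0..T} \<Longrightarrow> u t \<in> L2" "\<And>t. t \<in> {0..T} \<Longrightarrow> v t \<in> L2"
    "\<And>t. t \<in> {0..T} \<Longrightarrow> ((\<lambda>t. cls (u t)) has_vector_derivative cls (v t)) (at t within {0..T})"
    "continuous_on {0..T} (\<lambda>t. cls (v t))"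
proof -
  show u: "u t \<in> L2" if "t \<in> {0..T}" for t using C that by (auto simp: C1_L2_def)
  show v: "v t \<in> L2" if "t \<in> {0..T}" for t using C that by (auto simp: C1_L2_def L2_lim_def)
  have ev: "\<forall>\<^sub>F \<tau> in at t within {0..T}. \<tau> \<in> {0..T}" for t
    by (auto simp: eventually_at_filter)
  show "((\<lambda>t. cls (u t)) has_vector_derivative cls (v t)) (at t within {0..T})" if t: "t \<in> {0..T}" for t
  proof (rule has_vector_derivative_iff_quotient[THEN iffD2])
    have L: "\<forall>\<^sub>F \<tau> in at t within {0..T}. (\<lambda>x. (u \<tau> x - u t x) /\<^sub>R (\<tau> - t)) \<in> L2"
      using ev by eventually_elim (intro L2_scaleR L2_diff u t)
    have "L2_lim (\<lambda>\<tau> x. (u \<tau> x - u t x) /\<^sub>R (\<tau> - t)) (v t) (at t within {0..T})"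
      using C t unfolding C1_L2_def by blast
    then have "((\<lambda>\<tau>. cls (\<lambda>x. (u \<tau> x - u t x) /\<^sub>R (\<tau> - t))) \<longlongrightarrow> cls (v t)) (at t within {0..T})"
      unfolding L2_lim_iff[OF L] by blast
    moreover have "\<forall>\<^sub>F \<tau> in at t within {0..T}. cls (\<lambda>x. (u \<tau> x - u t x) /\<^sub>R (\<tau> - t)) = (cls (u \<tau>) - cls (u t)) /\<^sub>R (\<tau> - t)"
      using ev
    proof eventually_elim
      case (elim \<tau>)
      show ?case using cls_scaleR[OF L2_diff[OF u[OF elim] u[OF t]]] cls_diff[OF u[OF elim] u[OF t]] by simp
    qed
    ultimately show "((\<lambda>\<tau>. (cls (u \<tau>) - cls (u t)) /\<^sub>R (\<tau> - t)) \<longlongrightarrow> cls (v t)) (at t within {0..T})"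
      by (rule Lim_transform_eventually)
  qed
  show "continuous_on {0..T} (\<lambda>t. cls (v t))"
    unfolding continuous_on_def
  proof
    fix t assume t: "t \<in> {0..T}"
    have "\<forall>\<^sub>F \<tau> in at t within {0..T}. v \<tau> \<in> L2" using ev by eventually_elim (rule v)
    note iff = L2_lim_iff[OF this]
    have "L2_lim v (v t) (at t within {0..T})" using C t unfolding C1_L2_def by blast
    then show "((\<lambda>t. cls (v t)) \<longlongrightarrow> cls (v t)) (at t within {0..T})" unfolding iff by blast
  qed
qed

lemma Linf_norm_AE:
  assumes "Linf_norm f < \<infinity>"
  shows "AE x in lborel. \<bar>f x\<bar> \<le> real_of_ereal (Linf_norm f)"
proof -
  have "AE x in lborel. ereal \<bar>f x\<bar> \<le> Linf_norm f" unfolding Linf_norm_def by (rule esssup_AE)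
  then show ?thesis
    by eventually_elim (use assms in \<open>cases "Linf_norm f"; auto\<close>)
qed

lemma Linf_ess_bdd:
  assumes a: "a \<in> Linf"
  shows "ess_bdd (\<lambda>x. complex_of_real (a x))"
  using a Linf_norm_AE[of a] unfolding Linf_def ess_bdd_def by auto

subsection \<open>The fractional Laplacian as a Fourier multiplier\<close>

text \<open>The choice operator in \<open>frac_laplacian\<close> is harmless because all candidates agree almost
  everywhere; what has to be shown is that a candidate exists, and this is where the boundedness of
  the multiplier enters.\<close>
lemma frac_laplacian_multiplier:
  assumes f: "f \<in> L2" and F: "Fourier (cls f) = Mult \<kappa> G" and \<kappa>: "ess_bdd \<kappa>"
    and m: "ess_bdd (\<lambda>\<xi>. of_real (norm \<xi> powr (2 * s)) * \<kappa> \<xi>)"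
  shows "frac_laplacian s f \<in> L2"
    "cls (frac_laplacian s f) = Inv_Fourier (Mult (\<lambda>\<xi>. of_real (norm \<xi> powr (2 * s)) * \<kappa> \<xi>) G)"
proof -
  let ?w = "\<lambda>\<xi>::'a. complex_of_real (norm \<xi> powr (2 * s))"
  let ?H = "Inv_Fourier (Mult (\<lambda>\<xi>. ?w \<xi> * \<kappa> \<xi>) G)"
  obtain g where g: "g \<in> L2" "G = cls g" by (rule l2_cases)
  have kg: "(\<lambda>\<xi>. \<kappa> \<xi> * g \<xi>) \<in> L2" by (rule L2_mult[OF \<kappa> g(1)])
  have wm: "?w \<in> borel_measurable borel" by measurable
  have mg: "(\<lambda>\<xi>. ?w \<xi> * (\<kappa> \<xi> * g \<xi>)) \<in> L2" using L2_mult[OF m g(1)] by (simp add: mult.assoc)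
  have H: "?H = Inv_Fourier (cls (\<lambda>\<xi>. ?w \<xi> * (\<kappa> \<xi> * g \<xi>)))" by (simp add: g Mult_cls[OF m g(1)] mult.assoc)
  have ex: "has_frac_laplacian s f (rep_l2 ?H)"
    unfolding has_frac_laplacian_def has_fourier_iff has_inv_fourier_iff
    by (rule exI[of _ "\<lambda>\<xi>. \<kappa> \<xi> * g \<xi>"]) (use f F kg mg H in \<open>simp add: g(2) Mult_cls[OF \<kappa> g(1)]\<close>)
  have "h \<in> L2 \<and> cls h = ?H" if h: "has_frac_laplacian s f h" for h
  proof -
    obtain g' where g': "g' \<in> L2" "Fourier (cls f) = cls g'" "(\<lambda>\<xi>. ?w \<xi> * g' \<xi>) \<in> L2" "h \<in> L2" "Inv_Fourier (cls (\<lambda>\<xi>. ?w \<xi> * g' \<xi>)) = cls h"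
      using h unfolding has_frac_laplacian_def has_fourier_iff has_inv_fourier_iff by blast
    have "AE \<xi> in lborel. g' \<xi> = \<kappa> \<xi> * g \<xi>"
      using g'(2) F cls_eq_iff[OF g'(1) kg] by (simp add: g(2) Mult_cls[OF \<kappa> g(1)])
    then have "cls (\<lambda>\<xi>. ?w \<xi> * g' \<xi>) = cls (\<lambda>\<xi>. ?w \<xi> * (\<kappa> \<xi> * g \<xi>))"
      by (intro cls_eqI g' mg) auto
    then show ?thesis using g' H by simp
  qed
  from this[OF someI[of "has_frac_laplacian s f", OF ex]]
  show "frac_laplacian s f \<in> L2" "cls (frac_laplacian s f) = ?H" by (auto simp: frac_laplacian_def)
qed

definition lap_sym :: "real \<Rightarrow> ('a::euclidean_space \<Rightarrow> real) \<Rightarrow> 'a \<Rightarrow> complex" where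
  "lap_sym s k \<xi> = of_real (norm \<xi> powr (2 * s)) * ksym k \<xi>"

text \<open>The operator \<open>A\<^sub>k\<close>: the fractional Laplacian composed with convolution by \<open>k\<close>.\<close>
definition moll_lap :: "real \<Rightarrow> ('a::euclidean_space \<Rightarrow> real) \<Rightarrow> 'a l2 \<Rightarrow> 'a l2" where
  "moll_lap s k F = Inv_Fourier (Mult (lap_sym s k) (Fourier F))"

definition even_kernel :: "('a::euclidean_space \<Rightarrow> real) \<Rightarrow> bool" where
  "even_kernel k \<longleftrightarrow> smooth_compact k \<and> (\<forall>x. k (- x) = k x)"

text \<open>An even real kernel has a real and even symbol. Realness makes the operators symmetric;
  evenness lets them commute with complex conjugation.\<close>
lemma even_kernelD:
  assumes "even_kernel k"
  shows "smooth_compact k" "kernel k" "k (- x) = k x" "ess_bdd (ksym k)" "ksym k (- \<xi>) = ksym k \<xi>" "cnj (ksym k \<xi>) = ksym k \<xi>"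
proof -
  show s: "smooth_compact k" and e: "k (- x) = k x" for x using assms by (auto simp: even_kernel_def)
  show k: "kernel k" by (rule kernel_smooth_compact[OF s])
  show "ess_bdd (ksym k)" by (rule ess_bdd_ksym[OF k])
  show ev: "ksym k (- \<xi>) = ksym k \<xi>" for \<xi>
    unfolding ksym_def FT_def 
    using integral_lborel_reflect[of "\<lambda>x. cis (- (x \<bullet> \<xi>)) * complex_of_real (k x)" 0] by (simp add: e)
  have "cnj (ksym k \<xi>) = ksym k (- \<xi>)"
    unfolding ksym_def FT_def Bochner_Integration.integral_cnj[symmetric]
    by (intro Bochner_Integration.integral_cong refl) (simp add: cis_cnj)
  then show "cnj (ksym k \<xi>) = ksym k \<xi>" by (simp add: ev)
qed

lemma lap_sym_props:
  assumes k: "even_kernel k" and s: "s > 0"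
  shows "ess_bdd (lap_sym s k)" "cnj (lap_sym s k \<xi>) = lap_sym s k \<xi>" "lap_sym s k (- \<xi>) = lap_sym s k \<xi>"
proof -
  obtain C where C: "\<And>\<xi>. norm \<xi> powr (2 * s) * cmod (ksym k \<xi>) \<le> C"
    using ksym_decay[OF even_kernelD(1)[OF k], of "2 * s"] s by auto
  have [measurable]: "ksym k \<in> borel_measurable borel" using even_kernelD(4)[OF k] by (simp add: ess_bdd_def)
  show "ess_bdd (lap_sym s k)"
    by (rule ess_bdd_I[where C=C]) (use C in \<open>auto simp: lap_sym_def[abs_def] norm_mult\<close>)
  show "cnj (lap_sym s k \<xi>) = lap_sym s k \<xi>" "lap_sym s k (- \<xi>) = lap_sym s k \<xi>"
    using even_kernelD(5,6)[OF k] by (auto simp: lap_sym_def)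
qed

lemma bounded_linear_moll_lap:
  assumes k: "even_kernel k" and s: "s > 0"
  shows "bounded_linear (moll_lap s k)"
  unfolding moll_lap_def[abs_def]
  by (rule bounded_linear_compose[OF bounded_linear_Inv_Fourier bounded_linear_compose[OF bounded_linear_Mult[OF lap_sym_props(1)[OF k s]] bounded_linear_Fourier]])

lemma moll_lap_inner:
  fixes F G :: "'a::euclidean_space l2"
  shows "F \<bullet> moll_lap s k G = (1 / (2 * pi) ^ DIM('a)) * (Fourier F \<bullet> Mult (lap_sym s k) (Fourier G))"
  by (simp only: moll_lap_def inner_Inv_Fourier)

lemma moll_lap_inner_commute:
  assumes k: "even_kernel k" and s: "s > 0"
  shows "moll_lap s k F \<bullet> G = F \<bullet> moll_lap s k G"
proof -
  have "Fourier G \<bullet> Mult (lap_sym s k) (Fourier F) = Fourier F \<bullet> Mult (lap_sym s k) (Fourier G)"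
    using Mult_inner_commute[OF lap_sym_props(1,2)[OF k s], of "Fourier G" "Fourier F"] by (simp add: inner_commute)
  then have "G \<bullet> moll_lap s k F = F \<bullet> moll_lap s k G" by (simp only: moll_lap_inner)
  then show ?thesis by (simp only: inner_commute)
qed

text \<open>The equation is tested bilinearly, whereas the Hilbert space argument needs an inner product;
  the test functions are therefore complex conjugates, and this evaluates the fractional Laplacian on
  them.\<close>
lemma frac_laplacian_cnj_convol:
  assumes k: "even_kernel k" and s: "s > 0" and z: "z \<in> L2"
  shows "frac_laplacian s (\<lambda>y. c *\<^sub>R cnj (convol z k y)) \<in> L2" 
    "cls (frac_laplacian s (\<lambda>y. c *\<^sub>R cnj (convol z k y))) = c *\<^sub>R Cnj (moll_lap s k (cls z))"
proof -
  let ?f = "\<lambda>y. c *\<^sub>R cnj (convol z k y)"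
  note kk = even_kernelD[OF k]
  have g: "convol z k \<in> L2" by (rule convol_L2(1)[OF kk(2) z])
  have f: "?f \<in> L2" by (intro L2_scaleR L2_cnj g)
  interpret M: bounded_linear "Mult (ksym k)" by (rule bounded_linear_Mult[OF kk(4)])
  interpret Fo: bounded_linear "Fourier :: 'a l2 \<Rightarrow> 'a l2" by (rule bounded_linear_Fourier)
  interpret I: bounded_linear "Inv_Fourier :: 'a l2 \<Rightarrow> 'a l2" by (rule bounded_linear_Inv_Fourier)
  interpret L: bounded_linear "Mult (lap_sym s k)" by (rule bounded_linear_Mult[OF lap_sym_props(1)[OF k s]])
  have cf: "cls ?f = c *\<^sub>R Cnj (Conv k (cls z))"
    by (simp add: cls_scaleR L2_cnj g Cnj_cls Conv_cls[OF kk(2) z])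
  have F: "Fourier (cls ?f) = Mult (ksym k) (c *\<^sub>R Cnj (Reflect (Fourier (cls z))))"
    unfolding cf Fo.scaleR Fourier_Cnj Fourier_Conv[OF kk(2)] Reflect_Mult[OF kk(4,5)] Cnj_Mult[OF kk(4,6)] M.scaleR ..
  have l: "(\<lambda>\<xi>. of_real (norm \<xi> powr (2 * s)) * ksym k \<xi>) = lap_sym s k" by (simp add: lap_sym_def fun_eq_iff)
  note * = frac_laplacian_multiplier[OF f F kk(4), of s, unfolded l, OF lap_sym_props(1)[OF k s]]
  show "frac_laplacian s ?f \<in> L2" by (rule *)
  show "cls (frac_laplacian s ?f) = c *\<^sub>R Cnj (moll_lap s k (cls z))"
    unfolding *(2) L.scaleR I.scaleR Cnj_Mult[OF lap_sym_props(1,2)[OF k s], symmetric] 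
      Reflect_Mult[OF lap_sym_props(1,3)[OF k s], symmetric] Inv_Fourier_Cnj_Reflect moll_lap_def ..
qed

subsection \<open>Testing the equation\<close>

text \<open>The type of classes carries the real inner product \<open>Re \<integral> f cnj g\<close>; the complex one is
  recovered by pairing also with \<open>\<i> g\<close>.\<close>
definition cprod :: "'a::euclidean_space l2 \<Rightarrow> 'a l2 \<Rightarrow> complex" where
  "cprod F G = Complex (F \<bullet> G) (F \<bullet> Mult (\<lambda>x. \<i>) G)"

lemma cprod_scaleR: "cprod F (c *\<^sub>R G) = c *\<^sub>R cprod F G"
  by (simp add: cprod_def complex_eq_iff linear_simps(5)[OF bounded_linear_Mult[OF ess_bdd_const]])

lemma integral_cprod:
  assumes f: "f \<in> L2" and g: "g \<in> L2"
  shows "integrable lborel (\<lambda>x. f x * cnj (g x))" "(LINT x|lborel. f x * cnj (g x)) = cprod (cls f) (cls g)"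
proof -
  show i: "integrable lborel (\<lambda>x. f x * cnj (g x))" by (rule L2_integrable_mult[OF f L2_cnj[OF g]])
  have "Re (LINT x|lborel. f x * cnj (g x)) = cls f \<bullet> cls g"
    by (subst integral_Re[OF i, symmetric]) (simp add: inner_cls f g, simp add: inner_complex_def)
  moreover have "Im (LINT x|lborel. f x * cnj (g x)) = cls f \<bullet> Mult (\<lambda>x. \<i>) (cls g)"
    by (subst integral_Im[OF i, symmetric]) 
       (simp add: inner_cls f g Mult_cls L2_cmult, simp add: inner_complex_def)
  ultimately show "(LINT x|lborel. f x * cnj (g x)) = cprod (cls f) (cls g)"
    by (simp add: cprod_def complex_eq_iff)
qed

lemma tensor_test_function:
  fixes \<theta> :: "real \<Rightarrow> real" and g :: "'a::euclidean_space \<Rightarrow> complex"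
  assumes \<theta>: "\<theta> \<in> test_functions {0<..<T}" and g: "smooth_compact g"
  shows "(\<lambda>(t, x). \<theta> t *\<^sub>R cnj (g x)) \<in> test_functions ({0<..<T} \<times> UNIV)"
proof -
  let ?\<phi> = "\<lambda>p::real \<times> 'a. \<theta> (fst p) *\<^sub>R cnj (g (snd p))"
  have c: "Ck k ?\<phi>" for k
  proof -
    have 1: "Ck k (\<lambda>p::real \<times> 'a. \<theta> (fst p))"
      using Ck_affine[OF bounded_linear_fst test_function_props(4)[OF \<theta>], of k 0] by simp
    have 2: "Ck k (\<lambda>p::real \<times> 'a. g (snd p))"
      using Ck_affine[OF bounded_linear_snd smooth_compactD(3)[OF g], of k 0] by simp
    show ?thesis
      by (rule Ck_bilinear[OF bounded_bilinear_scaleR 1 Ck_bounded_linear[OF bounded_linear_cnj 2]])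
  qed
  have s: "{p. ?\<phi> p \<noteq> 0} = {t. \<theta> t \<noteq> 0} \<times> {x. g x \<noteq> 0}" by auto
  have "g \<in> test_functions UNIV" using g by (simp add: test_functions_UNIV_iff)
  then have "compact (closure {p. ?\<phi> p \<noteq> 0})" "closure {p. ?\<phi> p \<noteq> 0} \<subseteq> {0<..<T} \<times> UNIV"
    unfolding s closure_Times using \<theta> by (auto simp: test_functions_def intro!: compact_Times)
  then show ?thesis using c by (simp add: test_functions_def case_prod_beta')
qed

text \<open>The test function is \<open>\<theta>(t) cnj (g x)\<close> with \<open>g = z * k\<close>. For it all four terms of the equation
  are inner products in \<open>L\<^sup>2\<close>, and the fractional Laplacian has moved to \<open>moll_lap\<close>.\<close>
lemma wave_eq_tested:
  fixes u v :: "real \<Rightarrow> 'a::euclidean_space \<Rightarrow> complex"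
  assumes eq: "wave_eq T s a b u v" and T: "T > 0" and s: "s > 0"
    and uL: "\<And>t. t \<in> {0..T} \<Longrightarrow> u t \<in> L2" and vL: "\<And>t. t \<in> {0..T} \<Longrightarrow> v t \<in> L2"
    and Uc: "continuous_on {0..T} (\<lambda>t. cls (u t))" and Vc: "continuous_on {0..T} (\<lambda>t. cls (v t))"
    and a: "ess_bdd (\<lambda>x. complex_of_real (a x))" and b: "ess_bdd (\<lambda>x. complex_of_real (b x))"
    and k: "even_kernel k" and z: "z \<in> L2" "integrable lborel z" "bdd_supp z"
    and \<theta>: "\<theta> \<in> test_functions {0<..<T}" 
      "\<And>t. (\<theta> has_real_derivative \<theta>1 t) (at t)" "\<And>t. (\<theta>1 has_real_derivative \<theta>2 t) (at t)"
      "continuous_on UNIV \<theta>2"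
  shows "integral {0..T} (\<lambda>t. \<theta>2 t * (cls (u t) \<bullet> Conv k (cls z)) + \<theta> t * (cls (u t) \<bullet> moll_lap s k (cls z)
    + (Mult (\<lambda>x. of_real (a x)) (cls (u t)) + Mult (\<lambda>x. of_real (b x)) (cls (v t))) \<bullet> Conv k (cls z))) = 0"
proof -
  note kk = even_kernelD[OF k]
  define g where "g = convol z k"
  define G where "G = Conv k (cls z)"
  define W where "W = moll_lap s k (cls z)"
  have g: "g \<in> L2" "cls g = G" "smooth_compact g"
    unfolding g_def G_def using convol_L2(1)[OF kk(2) z(1)] Conv_cls[OF kk(2) z(1)] convol_smooth_compact[OF z(2,3) kk(1)] by auto
  define \<phi> where "\<phi> = (\<lambda>(t, x). \<theta> t *\<^sub>R cnj (g x))"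
  have \<phi>: "\<phi> \<in> test_functions ({0<..<T} \<times> UNIV)"
    unfolding \<phi>_def by (rule tensor_test_function[OF \<theta>(1) g(3)])
  have d1: "dt \<phi> (t, x) = \<theta>1 t *\<^sub>R cnj (g x)" for t x
    unfolding dt_def \<phi>_def using \<theta>(2)[of t]
    by (auto intro!: vector_derivative_at derivative_eq_intros simp: has_real_derivative_iff_has_vector_derivative)
  have d2: "dt (dt \<phi>) (t, x) = \<theta>2 t *\<^sub>R cnj (g x)" for t x
    unfolding dt_def[of "dt \<phi>"] using \<theta>(3)[of t]
    by (auto intro!: vector_derivative_at derivative_eq_intros simp: d1 has_real_derivative_iff_has_vector_derivative)
  let ?Ma = "Mult (\<lambda>x. complex_of_real (a x))" and ?Mb = "Mult (\<lambda>x. complex_of_real (b x))"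
  define R where "R H K t = \<theta>2 t * (cls (u t) \<bullet> H) + \<theta> t * (cls (u t) \<bullet> K) + \<theta> t * (?Ma (cls (u t)) \<bullet> H) + \<theta> t * (?Mb (cls (v t)) \<bullet> H)" for H K t
  have I: "(LINT x|lborel. u t x * dt (dt \<phi>) (t, x) + u t x * frac_laplacian s (\<lambda>y. \<phi> (t, y)) x
        + of_real (a x) * u t x * \<phi> (t, x) + of_real (b x) * v t x * \<phi> (t, x)) 
     = Complex (R G W t) (R (Mult (\<lambda>x. \<i>) G) (Mult (\<lambda>x. \<i>) W) t)" if t: "t \<in> {0<..<T}" for t
  proof -
    have t': "t \<in> {0..T}" using t by auto
    define h where "h = frac_laplacian s (\<lambda>y. \<phi> (t, y))"
    have h: "h \<in> L2" "cls h = \<theta> t *\<^sub>R Cnj W"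
      using frac_laplacian_cnj_convol[OF k s z(1), of "\<theta> t"] by (simp_all add: h_def \<phi>_def W_def g_def)
    have ch: "cls (\<lambda>x. cnj (h x)) = \<theta> t *\<^sub>R W"
    proof -
      obtain w where w: "w \<in> L2" "W = cls w" by (rule l2_cases)
      have "Cnj (Cnj W) = W" by (simp add: w Cnj_cls L2_cnj)
      then show ?thesis using h linear_simps(5)[OF bounded_linear_Cnj, of "\<theta> t" "Cnj W"] by (simp add: Cnj_cls[symmetric])
    qed
    have au: "(\<lambda>x. of_real (a x) * u t x) \<in> L2" "(\<lambda>x. of_real (b x) * v t x) \<in> L2"
      by (intro L2_mult a b uL vL t')+
    note i1 = integral_cprod[OF uL[OF t'] g(1)] and i2 = integral_cprod[OF uL[OF t'] L2_cnj[OF h(1)]]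
      and i3 = integral_cprod[OF au(1) g(1)] and i4 = integral_cprod[OF au(2) g(1)]
    have "(LINT x|lborel. u t x * dt (dt \<phi>) (t, x) + u t x * h x
        + of_real (a x) * u t x * \<phi> (t, x) + of_real (b x) * v t x * \<phi> (t, x))
       = (LINT x|lborel. \<theta>2 t *\<^sub>R (u t x * cnj (g x)) + u t x * cnj (cnj (h x)) 
        + \<theta> t *\<^sub>R ((of_real (a x) * u t x) * cnj (g x)) + \<theta> t *\<^sub>R ((of_real (b x) * v t x) * cnj (g x)))"
      by (simp only: d2) (simp add: \<phi>_def)
    also have "\<dots> = \<theta>2 t *\<^sub>R cprod (cls (u t)) G + cprod (cls (u t)) (\<theta> t *\<^sub>R W) 
        + \<theta> t *\<^sub>R cprod (cls (\<lambda>x. of_real (a x) * u t x)) G + \<theta> t *\<^sub>R cprod (cls (\<lambda>x. of_real (b x) * v t x)) G"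
      using i1 i2 i3 i4 
      by (simp only: Bochner_Integration.integral_add Bochner_Integration.integrable_add integrable_scaleR_right integral_scaleR_right g(2) ch)
    also have "\<dots> = Complex (R G W t) (R (Mult (\<lambda>x. \<i>) G) (Mult (\<lambda>x. \<i>) W) t)"
      unfolding cprod_scaleR R_def Mult_cls[OF a uL[OF t']] Mult_cls[OF b vL[OF t']]
      by (simp add: cprod_def complex_eq_iff)
    finally show ?thesis by (simp add: h_def)
  qed
  have cont: "continuous_on {0..T} (R H K)" for H K
  proof -
    have c0: "continuous_on {0..T} \<theta>" "continuous_on {0..T} \<theta>2"
      using continuous_on_subset[OF test_function_props(1)[OF \<theta>(1)]] continuous_on_subset[OF \<theta>(4)] by auto
    show ?thesis unfolding R_def[abs_def]
      by (intro continuous_intros c0 Uc Vc bounded_linear.continuous_on[OF bounded_linear_Mult[OF a]]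
        bounded_linear.continuous_on[OF bounded_linear_Mult[OF b]])
  qed
  define C where "C t = Complex (R G W t) (R (Mult (\<lambda>x. \<i>) G) (Mult (\<lambda>x. \<i>) W) t)" for t
  have "(LINT t:{0<..<T}|lborel. C t) = (LINT t:{0<..<T}|lborel. (LINT x|lborel. u t x * dt (dt \<phi>) (t, x) + u t x * frac_laplacian s (\<lambda>y. \<phi> (t, y)) x
        + of_real (a x) * u t x * \<phi> (t, x) + of_real (b x) * v t x * \<phi> (t, x)))"
    by (rule set_lebesgue_integral_cong) (use I in \<open>auto simp: C_def\<close>)
  also have "\<dots> = 0" using eq \<phi> by (simp add: wave_eq_def)
  finally have z0: "(LINT t:{0<..<T}|lborel. C t) = 0" .
  have "continuous_on {0..T} C"
    unfolding C_def[abs_def] Complex_eq by (intro continuous_intros cont)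
  then have "set_integrable lborel {0..T} C" by (rule borel_integrable_atLeastAtMost')
  then have si: "set_integrable lborel {0<..<T} C" by (rule set_integrable_subset) auto
  have "integral {0<..<T} C = 0" using set_borel_integral_eq_integral(2)[OF si] z0 by simp
  then have "integral {0..T} C = 0" by (simp add: integral_open_interval_real)
  moreover have "C integrable_on {0..T}" by (rule integrable_continuous_real[OF \<open>continuous_on {0..T} C\<close>])
  ultimately have "integral {0..T} (\<lambda>t. Re (C t)) = 0"
    using integral_linear[of C "{0..T}" Re] by (simp add: o_def bounded_linear_Re)
  moreover have "(\<lambda>t. Re (C t)) = (\<lambda>t. \<theta>2 t * (cls (u t) \<bullet> G) + \<theta> t * (cls (u t) \<bullet> W + (?Ma (cls (u t)) + ?Mb (cls (v t))) \<bullet> G))"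
    by (simp add: C_def R_def fun_eq_iff inner_add_left algebra_simps)
  ultimately show ?thesis by (simp add: G_def W_def)
qed

subsection \<open>From distributions to functions of time\<close>

text \<open>A bump in one variable is obtained by restricting the given mollifier to a line.\<close>
lemma exists_bump:
  fixes \<psi> :: "'a::euclidean_space \<Rightarrow> real"
  assumes m: "friedrichs_mollifier \<psi>"
  obtains \<kappa> :: "real \<Rightarrow> real" where "smooth_compact \<kappa>" "\<And>r. 0 \<le> \<kappa> r" "\<kappa> 0 > 0"
proof -
  note p = friedrichsD[OF m]
  have s: "smooth_compact \<psi>" using p(1) by (simp add: test_functions_UNIV_iff)
  have "\<exists>x. \<psi> x \<noteq> 0"
  proof (rule ccontr)
    assume "\<not> ?thesis" then have "\<psi> = (\<lambda>x. 0)" by auto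
    then show False using p(3) by simp
  qed
  then obtain x0 where x0: "\<psi> x0 \<noteq> 0" by blast
  obtain e :: 'a where e: "e \<in> Basis" using nonempty_Basis by blast
  define \<kappa> where "\<kappa> r = \<psi> (x0 + r *\<^sub>R e)" for r :: real
  obtain R where R: "\<And>x. norm x > R \<Longrightarrow> \<psi> x = 0" using smooth_compactD(2)[OF s] by (auto simp: bdd_supp_def)
  have "Ck k \<kappa>" for k unfolding \<kappa>_def[abs_def]
    by (rule Ck_affine[OF bounded_linear_scaleR_left smooth_compactD(3)[OF s]])
  moreover have "\<kappa> r = 0" if "norm r > R + norm x0" for r
  proof -
    have "norm (r *\<^sub>R e) = \<bar>r\<bar>" using e by simp
    moreover have "norm (r *\<^sub>R e) \<le> norm (x0 + r *\<^sub>R e) + norm x0"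
      using norm_triangle_ineq4[of "x0 + r *\<^sub>R e" x0] by simp
    ultimately have "R < norm (x0 + r *\<^sub>R e)" using that unfolding real_norm_def by linarith
    then show ?thesis unfolding \<kappa>_def by (rule R)
  qed
  ultimately have "smooth_compact \<kappa>" by (auto simp: smooth_compact_def bdd_supp_def)
  moreover have "0 \<le> \<kappa> r" for r by (simp add: \<kappa>_def p(2))
  moreover have "\<kappa> 0 > 0" using x0 p(2)[of x0] by (simp add: \<kappa>_def)
  ultimately show thesis by (rule that)
qed

text \<open>The primitive of a difference of two translates of \<open>k\<close> has compact support. Writing it as the
  convolution of \<open>k\<close> with the indicator of \<open>[t\<^sub>0, t\<^sub>1]\<close> makes its smoothness a case of
  \<open>convol_smooth_compact\<close>.\<close>
lemma bump_difference_test: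
  assumes k: "smooth_compact (k::real \<Rightarrow> real)" and supp: "\<And>r. \<bar>r\<bar> > R \<Longrightarrow> k r = 0" 
    and t: "R < t0" "t0 < t1" "t1 < T - R"
  shows "\<exists>\<theta> \<theta>2. \<theta> \<in> test_functions {0<..<T} \<and> (\<forall>t. (\<theta> has_real_derivative k (t - t0) - k (t - t1)) (at t)) \<and>
    (\<forall>t. ((\<lambda>t. k (t - t0) - k (t - t1)) has_real_derivative \<theta>2 t) (at t)) \<and> continuous_on UNIV \<theta>2"
proof -
  define z where "z = (indicator {t0..t1} :: real \<Rightarrow> real)"
  define k' where "k' r = frechet_derivative k (at r) 1" for r
  have k': "(k has_real_derivative k' r) (at r)" for r
  proof -
    have lin: "linear (frechet_derivative k (at r))" by (rule has_derivative_linear[OF smooth_compactD(4)[OF k]])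
    have "frechet_derivative k (at r) h = k' r * h" for h
      using linear_scale[OF lin, of h 1] unfolding k'_def by (simp only: real_scaleR_def mult_1_right mult.commute[of h])
    then have "frechet_derivative k (at r) = (*) (k' r)" by (rule ext)
    then show ?thesis using smooth_compactD(4)[OF k, of r] unfolding has_field_derivative_def by metis
  qed
  have k'c: "continuous_on UNIV k'" unfolding k'_def[abs_def] by (rule smooth_compactD(1)[OF smooth_compact_deriv[OF k]])
  have zi: "integrable lborel z" unfolding z_def by (rule integrable_real_indicator) (use t in auto)
  have zb: "bdd_supp z" unfolding bdd_supp_def z_def
    by (rule exI[of _ "\<bar>t0\<bar> + \<bar>t1\<bar>"]) (auto simp: indicator_def)
  have s: "smooth_compact (convol z k)" by (rule convol_smooth_compact[OF zi zb k])
  have zero: "convol z k t = 0" if "t \<notin> {t0 - R..t1 + R}" for t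
  proof -
    have "k (t - y) *\<^sub>R z y = 0" for y
    proof (cases "y \<in> {t0..t1}")
      case True
      moreover have "t < t0 - R \<or> t > t1 + R" using that by auto
      ultimately have "\<bar>t - y\<bar> > R" by auto
      from supp[OF this] show ?thesis by simp
    qed (simp add: z_def)
    then show ?thesis by (simp only: convol_def integral_zero)
  qed
  have sub: "closure {t. convol z k t \<noteq> 0} \<subseteq> {t0 - R..t1 + R}"
  proof (rule closure_minimal)
    show "{t. convol z k t \<noteq> 0} \<subseteq> {t0 - R..t1 + R}" using zero by blast
  qed auto
  have "convol z k \<in> test_functions UNIV" using s by (simp add: test_functions_UNIV_iff)
  then have test: "convol z k \<in> test_functions {0<..<T}"
    using sub t by (force simp: test_functions_def)
  have d: "(convol z k has_real_derivative k (t - t0) - k (t - t1)) (at t)" for t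
  proof -
    have lin: "frechet_derivative k (at r) v = k' r * v" for r v
    proof -
      have "frechet_derivative k (at r) = (*) (k' r)"
        using frechet_derivative_at[OF k'[of r, unfolded has_field_derivative_def]] by simp
      then show ?thesis by simp
    qed
    have "convol z (\<lambda>x. frechet_derivative k (at x) v) t = (k (t - t0) - k (t - t1)) * v" for v
    proof -
      have "convol z (\<lambda>x. frechet_derivative k (at x) v) t = (LINT y|lborel. indicator {t0..t1} y *\<^sub>R (k' (t - y) * v))"
        unfolding convol_def by (simp add: lin z_def mult_ac)
      also have "\<dots> = - k (t - t1) * v - (- k (t - t0) * v)"
      proof (rule integral_FTC_atLeastAtMost)
        show "t0 \<le> t1" using t by simp
        show "((\<lambda>y. - k (t - y) * v) has_vector_derivative k' (t - y) * v) (at y within {t0..t1})" for y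
        proof -
          have "((\<lambda>y. k (t - y)) has_real_derivative k' (t - y) * (0 - 1)) (at y within {t0..t1})"
            by (rule DERIV_chain'[OF _ k']) (auto intro!: derivative_eq_intros)
          then have "((\<lambda>y. - k (t - y) * v) has_real_derivative k' (t - y) * v) (at y within {t0..t1})"
            by (auto intro!: derivative_eq_intros)
          then show ?thesis by (simp add: has_real_derivative_iff_has_vector_derivative)
        qed
        show "continuous_on {t0..t1} (\<lambda>y. k' (t - y) * v)"
          by (intro continuous_intros continuous_on_compose2[OF k'c]) auto
      qed
      finally show ?thesis by (simp add: algebra_simps)
    qed
    then show ?thesis using convol_has_derivative[OF k zi, of t] 
      by (simp add: has_field_derivative_def)
  qed
  show ?thesis
  proof (intro exI conjI allI)
    show "convol z k \<in> test_functions {0<..<T}" by (rule test)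
    show "(convol z k has_real_derivative k (t - t0) - k (t - t1)) (at t)" for t by (rule d)
    show "((\<lambda>t. k (t - t0) - k (t - t1)) has_real_derivative k' (t - t0) - k' (t - t1)) (at t)" for t
    proof -
      have "((\<lambda>t. k (t - c)) has_real_derivative k' (t - c) * (1 - 0)) (at t)" for c
        by (rule DERIV_chain'[OF _ k']) (auto intro!: derivative_eq_intros)
      then show ?thesis by (auto intro!: derivative_eq_intros)
    qed
    show "continuous_on UNIV (\<lambda>t. k' (t - t0) - k' (t - t1))"
      by (intro continuous_intros continuous_on_compose2[OF k'c]) auto
  qed
qed

text \<open>Concentrating the bump at \<open>t\<^sub>0\<close> and at \<open>t\<^sub>1\<close> turns equality of the two averages of \<open>m\<close> into
  \<open>m t\<^sub>0 = m t\<^sub>1\<close>. The bump keeps its shape, so both averages have the same positive total weight.\<close>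
lemma du_bois_reymond:
  fixes m :: "real \<Rightarrow> real"
  assumes \<kappa>: "smooth_compact (\<kappa>::real \<Rightarrow> real)" "\<And>r. 0 \<le> \<kappa> r" "\<kappa> 0 > 0"
    and m: "continuous_on {0..T} m"
    and test: "\<And>k R t0 t1. smooth_compact k \<Longrightarrow> (\<And>r. \<bar>r\<bar> > R \<Longrightarrow> k r = 0) \<Longrightarrow> 0 < R \<Longrightarrow> R < t0 \<Longrightarrow> t0 < t1 \<Longrightarrow> t1 < T - R \<Longrightarrow>
      integral {0..T} (\<lambda>t. (k (t - t0) - k (t - t1)) * m t) = 0"
    and t: "0 < t0" "t0 < t1" "t1 < T"
  shows "m t0 = m t1"
proof -
  obtain R0 where R0: "\<And>r. \<bar>r\<bar> > R0 \<Longrightarrow> \<kappa> r = 0" using smooth_compactD(2)[OF \<kappa>(1)] by (auto simp: bdd_supp_def)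
  define R1 where "R1 = max R0 1"
  have R1: "\<And>r. \<bar>r\<bar> > R1 \<Longrightarrow> \<kappa> r = 0" "R1 > 0" using R0 by (auto simp: R1_def)
  have T: "t0 \<in> {0..T}" "t1 \<in> {0..T}" using t by auto
  have bound: "\<bar>m t0 - m t1\<bar> \<le> 2 * e" if e: "e > 0" for e
  proof -
    have mc: "\<exists>d>0. \<forall>r\<in>{0..T}. \<bar>r - c\<bar> < d \<longrightarrow> \<bar>m r - m c\<bar> < e" if "c \<in> {0..T}" for c
      using m[unfolded continuous_on_iff dist_real_def, rule_format, OF that e] by blast
    obtain d0 where d0: "d0 > 0" "\<And>r. r \<in> {0..T} \<Longrightarrow> \<bar>r - t0\<bar> < d0 \<Longrightarrow> \<bar>m r - m t0\<bar> < e"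
      using mc[OF T(1)] by blast
    obtain d1 where d1: "d1 > 0" "\<And>r. r \<in> {0..T} \<Longrightarrow> \<bar>r - t1\<bar> < d1 \<Longrightarrow> \<bar>m r - m t1\<bar> < e"
      using mc[OF T(2)] by blast
    note d = d0 d1
    \<comment> \<open>The radius keeps both bumps inside the interval and within the \<open>e\<close>-continuity neighbourhoods of \<open>m\<close>.\<close>
    define R where "R = min (min (d0 / 2) (d1 / 2)) (min (t0 / 2) ((T - t1) / 2))"
    have "R \<le> d0 / 2" "R \<le> d1 / 2" "R \<le> t0 / 2" "R \<le> (T - t1) / 2" unfolding R_def by linarith+
    moreover have "R > 0" using d t by (simp add: R_def)
    moreover have "R + t1 < T" using t(3) \<open>R \<le> (T - t1) / 2\<close> by (simp add: field_simps)
    ultimately have R: "R > 0" "R < d0" "R < d1" "R < t0" "t1 < T - R" using d(1,3) t(1) by auto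
    define h where "h = R / R1"
    have h: "h > 0" using R R1 by (simp add: h_def)
    define k where "k r = \<kappa> (r / h)" for r
    have k0: "k r = 0" if "\<bar>r\<bar> > R" for r
    proof -
      have "R / h = R1" using R R1 by (simp add: h_def)
      moreover have "\<bar>r / h\<bar> = \<bar>r\<bar> / h" using h by (simp add: abs_divide)
      ultimately have "\<bar>r / h\<bar> > R1" using divide_strict_right_mono[OF that h] by linarith
      then show ?thesis unfolding k_def by (rule R1(1))
    qed
    have ks: "smooth_compact k"
    proof -
      have "Ck n k" for n
        using Ck_affine[OF bounded_linear_mult_right smooth_compactD(3)[OF \<kappa>(1)], of n 0 "inverse h"]
        by (simp add: k_def[abs_def] divide_inverse mult.commute)
      moreover have "bdd_supp k" unfolding bdd_supp_def using k0 by (intro exI[of _ R]) simp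
      ultimately show ?thesis by (simp add: smooth_compact_def)
    qed
    have kn: "0 \<le> k r" for r by (simp add: k_def \<kappa>(2))
    have kc: "continuous_on S (\<lambda>r. k (r - c))" for S c
      by (intro continuous_on_compose2[OF smooth_compactD(1)[OF ks]] continuous_intros) auto
    define I where "I c = integral {0..T} (\<lambda>r. k (r - c))" for c
    have Ieq: "I c = (LINT r|lborel. k r)" if "R < c" "c < T - R" for c
    proof -
      have "I c = (LINT r:{0..T}|lborel. k (r - c))"
        unfolding I_def using borel_integrable_atLeastAtMost'[OF kc] 
        by (intro set_borel_integral_eq_integral(2)[symmetric])
      also have "\<dots> = (LINT r|lborel. k (r - c))"
        unfolding set_lebesgue_integral_def
      proof (intro Bochner_Integration.integral_cong refl)
        fix r show "indicator {0..T} r *\<^sub>R k (r - c) = k (r - c)"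
        proof (cases "r \<in> {0..T}")
          case False
          then have "r < 0 \<or> r > T" by auto
          then have "\<bar>r - c\<bar> > R" using that by auto
          then show ?thesis using k0 by simp
        qed simp
      qed
      also have "\<dots> = (LINT r|lborel. k r)" by (rule integral_lborel_shift)
      finally show ?thesis .
    qed
    have I01: "I t0 = I t1" using Ieq[of t0] Ieq[of t1] R t by simp
    have Ipos: "I t0 > 0"
    proof -
      have "I t0 \<noteq> 0"
        unfolding I_def using integral_eq_0_iff[OF kc, of 0 T t0] t kn T \<kappa>(3) by (auto simp: k_def intro!: bexI[of _ t0])
      moreover have "I t0 \<ge> 0" unfolding I_def by (intro integral_nonneg integrable_continuous_real kc kn)
      ultimately show ?thesis by simp
    qed
    have est: "\<bar>integral {0..T} (\<lambda>r. k (r - c) * m r) - I c * m c\<bar> \<le> e * I c" 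
      if c: "c \<in> {0..T}" "\<And>r. r \<in> {0..T} \<Longrightarrow> \<bar>r - c\<bar> \<le> R \<Longrightarrow> \<bar>m r - m c\<bar> \<le> e" for c
    proof -
      have i1: "(\<lambda>r. k (r - c) * m r) integrable_on {0..T}" "(\<lambda>r. k (r - c) * m c) integrable_on {0..T}"
        "(\<lambda>r. k (r - c) * (m r - m c)) integrable_on {0..T}" "(\<lambda>r. e * k (r - c)) integrable_on {0..T}"
        by (intro integrable_continuous_real continuous_intros kc m)+
      have "integral {0..T} (\<lambda>r. k (r - c) * m r) - I c * m c = integral {0..T} (\<lambda>r. k (r - c) * m r) - integral {0..T} (\<lambda>r. k (r - c) * m c)"
        by (simp add: I_def)
      also have "\<dots> = integral {0..T} (\<lambda>r. k (r - c) * m r - k (r - c) * m c)"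
        by (rule Henstock_Kurzweil_Integration.integral_diff[OF i1(1,2), symmetric])
      also have "\<dots> = integral {0..T} (\<lambda>r. k (r - c) * (m r - m c))" by (simp add: right_diff_distrib)
      finally have eq: "integral {0..T} (\<lambda>r. k (r - c) * m r) - I c * m c = integral {0..T} (\<lambda>r. k (r - c) * (m r - m c))" .
      have "norm (integral {0..T} (\<lambda>r. k (r - c) * (m r - m c))) \<le> integral {0..T} (\<lambda>r. e * k (r - c))"
      proof (rule integral_norm_bound_integral[OF i1(3,4)])
        fix r assume r: "r \<in> {0..T}"
        show "norm (k (r - c) * (m r - m c)) \<le> e * k (r - c)"
        proof (cases "\<bar>r - c\<bar> \<le> R")
          case True
          have "k (r - c) * \<bar>m r - m c\<bar> \<le> k (r - c) * e" by (rule mult_left_mono[OF c(2)[OF r True] kn])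
          then show ?thesis using kn by (simp add: abs_mult mult.commute)
        qed (simp add: k0)
      qed
      then show ?thesis unfolding eq by (simp add: I_def)
    qed
    have e0: "\<bar>integral {0..T} (\<lambda>r. k (r - t0) * m r) - I t0 * m t0\<bar> \<le> e * I t0"
      using d(2) R by (intro est T) force
    have e1: "\<bar>integral {0..T} (\<lambda>r. k (r - t1) * m r) - I t1 * m t1\<bar> \<le> e * I t1"
      using d(4) R by (intro est T) force
    have "integral {0..T} (\<lambda>r. k (r - t0) * m r) - integral {0..T} (\<lambda>r. k (r - t1) * m r) = integral {0..T} (\<lambda>r. k (r - t0) * m r - k (r - t1) * m r)"
      by (intro Henstock_Kurzweil_Integration.integral_diff[symmetric] integrable_continuous_real continuous_intros kc m)
    also have "\<dots> = integral {0..T} (\<lambda>t. (k (t - t0) - k (t - t1)) * m t)" by (simp add: left_diff_distrib)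
    also have "\<dots> = 0" by (rule test[OF ks k0 R(1,4) t(2) R(5)])
    finally have "\<bar>I t0 * m t0 - I t0 * m t1\<bar> \<le> I t0 * (2 * e)" using e0 e1 unfolding I01 by (simp add: abs_le_iff algebra_simps)
    then have "I t0 * \<bar>m t0 - m t1\<bar> \<le> I t0 * (2 * e)" using Ipos by (simp add: abs_mult flip: right_diff_distrib)
    then show ?thesis using Ipos by simp
  qed
  show ?thesis
  proof (rule ccontr)
    assume "m t0 \<noteq> m t1"
    then show False using bound[of "\<bar>m t0 - m t1\<bar> / 4"] by simp
  qed
qed

lemma constant_on_closed_interval:
  fixes m :: "real \<Rightarrow> real"
  assumes m: "continuous_on {0..T} m" and eq: "\<And>t0 t1. 0 < t0 \<Longrightarrow> t0 < t1 \<Longrightarrow> t1 < T \<Longrightarrow> m t0 = m t1" 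
    and T: "T > 0" and t: "t \<in> {0..T}"
  shows "m t = m 0"
proof -
  have mid: "m r = m (T/2)" if "r \<in> {0<..<T}" for r
  proof -
    consider "r < T/2" | "r = T/2" | "r > T/2" by linarith
    then show ?thesis
    proof cases
      case 1 show ?thesis by (rule eq) (use 1 that T in auto)
    next
      case 3 show ?thesis by (rule eq[symmetric]) (use 3 that T in auto)
    next
      case 2 show ?thesis by (simp only: 2)
    qed
  qed
  have cl: "closure {0<..<T} = {0..T}" using T by simp
  have *: "m r = m (T/2)" if "r \<in> {0..T}" for r
    by (rule continuous_constant_on_closure[of "{0<..<T}" m, unfolded cl, OF m mid that])
  have "0 \<in> {0..T}" using T by simp
  from *[OF this] *[OF t] show ?thesis by (simp only:)
qed

text \<open>With \<open>Q\<close> a primitive of \<open>q\<close>, the derivative of \<open>\<theta>' p + \<theta> Q\<close> is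
  \<open>\<theta>'' p + \<theta> q + \<theta>' (p' + Q)\<close>. Integrating it shows that \<open>p' + Q\<close> annihilates all \<open>\<theta>'\<close>, hence
  is constant.\<close>
lemma weak_second_derivative:
  fixes p p1 q :: "real \<Rightarrow> real"
  assumes \<kappa>: "smooth_compact (\<kappa>::real \<Rightarrow> real)" "\<And>r. 0 \<le> \<kappa> r" "\<kappa> 0 > 0" and T: "T > 0"
    and p: "\<And>t. t \<in> {0..T} \<Longrightarrow> (p has_real_derivative p1 t) (at t within {0..T})"
    and p1: "continuous_on {0..T} p1" and q: "continuous_on {0..T} q"
    and weak: "\<And>\<theta> \<theta>1 \<theta>2. \<theta> \<in> test_functions {0<..<T} \<Longrightarrow> (\<And>t. (\<theta> has_real_derivative \<theta>1 t) (at t)) \<Longrightarrow>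
      (\<And>t. (\<theta>1 has_real_derivative \<theta>2 t) (at t)) \<Longrightarrow> continuous_on UNIV \<theta>2 \<Longrightarrow>
      integral {0..T} (\<lambda>t. \<theta>2 t * p t + \<theta> t * q t) = 0"
    and t: "t \<in> {0..T}"
  shows "p1 t + integral {0..t} q = p1 0"
proof -
  define Q where "Q t = integral {0..t} q" for t
  have Q: "(Q has_real_derivative q t) (at t within {0..T})" if "t \<in> {0..T}" for t
    unfolding Q_def[abs_def] has_real_derivative_iff_has_vector_derivative
    by (rule integral_has_vector_derivative[OF q that])
  have Qc: "continuous_on {0..T} Q" by (rule DERIV_continuous_on[OF Q])
  have pc: "continuous_on {0..T} p" by (rule DERIV_continuous_on[OF p])
  define m where "m t = p1 t + Q t" for t
  have m: "continuous_on {0..T} m" unfolding m_def[abs_def] by (intro continuous_intros p1 Qc)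
  have "m t0 = m t1" if t01: "0 < t0" "t0 < t1" "t1 < T" for t0 t1
  proof (rule du_bois_reymond[OF \<kappa> m _ t01])
    fix k :: "real \<Rightarrow> real" and R t0 t1
    assume k: "smooth_compact k" "\<And>r. \<bar>r\<bar> > R \<Longrightarrow> k r = 0" and R: "0 < R" "R < t0" "t0 < t1" "t1 < T - R"
    let ?th1 = "\<lambda>t. k (t - t0) - k (t - t1)"
    have "\<exists>\<theta> \<theta>2. \<theta> \<in> test_functions {0<..<T} \<and> (\<forall>t. (\<theta> has_real_derivative ?th1 t) (at t)) \<and>
      (\<forall>t. (?th1 has_real_derivative \<theta>2 t) (at t)) \<and> continuous_on UNIV \<theta>2"
      by (rule bump_difference_test[OF k R(2-4)])
    then obtain \<theta> \<theta>2 where ex: "\<theta> \<in> test_functions {0<..<T} \<and> (\<forall>t. (\<theta> has_real_derivative ?th1 t) (at t)) \<and>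
      (\<forall>t. (?th1 has_real_derivative \<theta>2 t) (at t)) \<and> continuous_on UNIV \<theta>2" by (elim exE) 
    then have \<theta>: "\<theta> \<in> test_functions {0<..<T}" "\<And>t. (\<theta> has_real_derivative ?th1 t) (at t)"
      "\<And>t. (?th1 has_real_derivative \<theta>2 t) (at t)" "continuous_on UNIV \<theta>2" by blast+
    have z: "\<theta> t = 0" "?th1 t = 0" if "t = 0 \<or> t = T" for t
    proof -
      have "t \<notin> closure {t. \<theta> t \<noteq> 0}" using \<theta>(1) that by (auto simp: test_functions_def)
      then show "\<theta> t = 0" using closure_subset[of "{t. \<theta> t \<noteq> 0}"] by blast
      show "?th1 t = 0" using that k(2)[of "t - t0"] k(2)[of "t - t1"] R by auto
    qed
    define Y where "Y t = ?th1 t * p t + \<theta> t * Q t" for t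
    have Y: "(Y has_vector_derivative (\<theta>2 t * p t + \<theta> t * q t) + ?th1 t * m t) (at t within {0..T})" if "t \<in> {0..T}" for t
    proof -
      note dd = DERIV_subset[OF \<theta>(2) subset_UNIV, of t "{0..T}"] DERIV_subset[OF \<theta>(3) subset_UNIV, of t "{0..T}"] 
      have "(Y has_real_derivative ((?th1 t * p1 t + \<theta>2 t * p t) + (\<theta> t * q t + ?th1 t * Q t))) (at t within {0..T})"
        unfolding Y_def[abs_def] by (intro DERIV_add DERIV_mult' dd p[OF that] Q[OF that])
      then show ?thesis by (simp add: m_def algebra_simps has_real_derivative_iff_has_vector_derivative)
    qed
    have FTC: "((\<lambda>t. (\<theta>2 t * p t + \<theta> t * q t) + ?th1 t * m t) has_integral Y T - Y 0) {0..T}"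
      by (rule fundamental_theorem_of_calculus) (use T Y in auto)
    then have "integral {0..T} (\<lambda>t. (\<theta>2 t * p t + \<theta> t * q t) + ?th1 t * m t) = 0"
    proof -
      have "Y t = 0" if "t = 0 \<or> t = T" for t using z[OF that] unfolding Y_def by simp
      then have "Y T - Y 0 = 0" by simp
      with FTC show ?thesis by (simp only: integral_unique)
    qed
    moreover have "integral {0..T} (\<lambda>t. (\<theta>2 t * p t + \<theta> t * q t) + ?th1 t * m t) = integral {0..T} (\<lambda>t. \<theta>2 t * p t + \<theta> t * q t) + integral {0..T} (\<lambda>t. ?th1 t * m t)"
    proof (intro Henstock_Kurzweil_Integration.integral_add integrable_continuous_real)
      have c: "continuous_on {0..T} \<theta>" "continuous_on {0..T} \<theta>2" "continuous_on {0..T} ?th1"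
        using continuous_on_subset[OF test_function_props(1)[OF \<theta>(1)]] continuous_on_subset[OF \<theta>(4)] 
          continuous_on_subset[OF DERIV_continuous_on[of UNIV, OF \<theta>(3)]] by auto
      show "continuous_on {0..T} (\<lambda>t. \<theta>2 t * p t + \<theta> t * q t)" "continuous_on {0..T} (\<lambda>t. ?th1 t * m t)"
        by (intro continuous_on_add continuous_on_mult c pc q m)+
    qed
    moreover have "integral {0..T} (\<lambda>t. \<theta>2 t * p t + \<theta> t * q t) = 0" by (rule weak[OF \<theta>])
    ultimately show "integral {0..T} (\<lambda>t. ?th1 t * m t) = 0" by simp
  qed
  from constant_on_closed_interval[OF m this T t] show ?thesis by (simp add: m_def Q_def)
qed

subsection \<open>The mollified equation\<close>

text \<open>The tested equation says that \<open>k * v\<close> plus the integral of \<open>A\<^sub>k u + k * (a u + b v)\<close> has constant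
  inner product with a dense set of vectors. As the integrand is continuous in \<open>L\<^sup>2\<close>, the integral
  exists there and the identity holds in \<open>L\<^sup>2\<close> itself.\<close>
lemma mollified_equation:
  fixes u v :: "real \<Rightarrow> 'a::euclidean_space \<Rightarrow> complex" and \<psi> :: "'a \<Rightarrow> real"
  assumes m: "friedrichs_mollifier \<psi>"
    and eq: "wave_eq T s a b u v" and C1: "C1_L2 T u v" and T: "T > 0" and s: "s > 0"
    and a: "ess_bdd (\<lambda>x. complex_of_real (a x))" and b: "ess_bdd (\<lambda>x. complex_of_real (b x))"
    and k: "even_kernel k" and t: "t \<in> {0..T}"
  shows "((\<lambda>t. Conv k (cls (v t))) has_vector_derivative 
    - (moll_lap s k (cls (u t)) + Conv k (Mult (\<lambda>x. of_real (a x)) (cls (u t)) + Mult (\<lambda>x. of_real (b x)) (cls (v t))))) (at t within {0..T})"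
proof -
  let ?U = "\<lambda>t. cls (u t)" and ?V = "\<lambda>t. cls (v t)"
  note C = C1_L2_cls[OF C1 T]
  note kk = even_kernelD[OF k]
  have Uc: "continuous_on {0..T} ?U" 
    unfolding continuous_on_eq_continuous_within using has_vector_derivative_continuous[OF C(3)] by blast
  define F where "F t = Mult (\<lambda>x. of_real (a x)) (?U t) + Mult (\<lambda>x. of_real (b x)) (?V t)" for t
  have Fc: "continuous_on {0..T} F" unfolding F_def[abs_def]
    by (intro continuous_intros bounded_linear.continuous_on[OF bounded_linear_Mult[OF a]] bounded_linear.continuous_on[OF bounded_linear_Mult[OF b]] Uc C(4))
  define X where "X t = moll_lap s k (?U t) + Conv k (F t)" for t
  have Xc: "continuous_on {0..T} X" unfolding X_def[abs_def]
    by (intro continuous_intros bounded_linear.continuous_on[OF bounded_linear_moll_lap[OF k s]] bounded_linear.continuous_on[OF bounded_linear_Conv[OF kk(2)]] Uc Fc)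
  obtain \<kappa> :: "real \<Rightarrow> real" where \<kappa>: "smooth_compact \<kappa>" "\<And>r. 0 \<le> \<kappa> r" "\<kappa> 0 > 0" using exists_bump[OF m] by metis
  have tested: "(Conv k (?V t) + integral {0..t} X) \<bullet> cls z = Conv k (?V 0) \<bullet> cls z"
    if t: "t \<in> {0..T}" and z: "z \<in> L2" "integrable lborel z" "bdd_supp z" for z t
  proof -
    define G where "G = Conv k (cls z)"
    define W where "W = moll_lap s k (cls z)"
    have "?V t \<bullet> G + integral {0..t} (\<lambda>t. ?U t \<bullet> W + F t \<bullet> G) = ?V 0 \<bullet> G"
    proof (rule weak_second_derivative[OF \<kappa> T _ _ _ _ t])
      show "((\<lambda>t. ?U t \<bullet> G) has_real_derivative ?V t \<bullet> G) (at t within {0..T})" if "t \<in> {0..T}" for t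
        using bounded_linear.has_vector_derivative[OF bounded_linear_inner_left C(3)[OF that], of G]
        by (simp add: has_real_derivative_iff_has_vector_derivative)
      show "continuous_on {0..T} (\<lambda>t. ?V t \<bullet> G)" "continuous_on {0..T} (\<lambda>t. ?U t \<bullet> W + F t \<bullet> G)"
        by (intro continuous_intros C(4) Uc Fc)+
      show "integral {0..T} (\<lambda>t. \<theta>2 t * (?U t \<bullet> G) + \<theta> t * (?U t \<bullet> W + F t \<bullet> G)) = 0"
        if "\<theta> \<in> test_functions {0<..<T}" "\<And>t. (\<theta> has_real_derivative \<theta>1 t) (at t)" "\<And>t. (\<theta>1 has_real_derivative \<theta>2 t) (at t)" "continuous_on UNIV \<theta>2" for \<theta> \<theta>1 \<theta>2
        unfolding G_def W_def F_def
        by (rule wave_eq_tested[OF eq T s C(1,2) Uc C(4) a b k z that])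
    qed
    moreover have "?U t \<bullet> W + F t \<bullet> G = X t \<bullet> cls z" for t
      by (simp add: X_def W_def G_def inner_add_left moll_lap_inner_commute[OF k s] Conv_inner_commute[OF kk(2,3)])
    moreover have "?V t \<bullet> G = Conv k (?V t) \<bullet> cls z" for t
      by (simp add: G_def Conv_inner_commute[OF kk(2,3)])
    moreover have "integral {0..t} (\<lambda>t. X t \<bullet> cls z) = integral {0..t} X \<bullet> cls z"
    proof -
      have "X integrable_on {0..t}" using t by (intro integrable_continuous_real continuous_on_subset[OF Xc]) auto
      from integral_linear[OF this bounded_linear_inner_left[of "cls z"]] show ?thesis by (simp add: o_def)
    qed
    ultimately show ?thesis by (simp add: inner_add_left)
  qed
  have strong: "Conv k (?V t) = Conv k (?V 0) - integral {0..t} X" if t: "t \<in> {0..T}" for t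
  proof -
    have "(Conv k (?V t) + integral {0..t} X) \<bullet> Z = Conv k (?V 0) \<bullet> Z" for Z
      by (rule continuous_l2_eqI[where A="\<lambda>Z. (Conv k (?V t) + integral {0..t} X) \<bullet> Z" and B="\<lambda>Z. Conv k (?V 0) \<bullet> Z"])
         (intro continuous_intros tested[OF t]; assumption)+
    then have "\<forall>Z. (Conv k (?V t) + integral {0..t} X) \<bullet> Z = Conv k (?V 0) \<bullet> Z" by blast
    then have "Conv k (?V t) + integral {0..t} X = Conv k (?V 0)" by (simp only: vector_eq_rdot)
    then show ?thesis by (simp add: eq_diff_eq)
  qed
  have "((\<lambda>t. Conv k (?V 0) - integral {0..t} X) has_vector_derivative 0 - X t) (at t within {0..T})"
    by (intro has_vector_derivative_diff has_vector_derivative_const integral_has_vector_derivative[OF Xc t])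
  from has_vector_derivative_transform[where g="\<lambda>t. Conv k (?V t)", OF t strong this]
  have "((\<lambda>t. Conv k (?V t)) has_vector_derivative 0 - X t) (at t within {0..T})"
    by blast
  then show ?thesis by (simp add: X_def F_def)
qed

section \<open>Energy estimates\<close>

subsection \<open>Symmetrised mollifiers\<close>

lemma ksym_mollifying_net:
  fixes k :: "'a::euclidean_space \<Rightarrow> real"
  assumes e: "\<epsilon> > 0"
  shows "ksym (mollifying_net k \<epsilon>) \<xi> = ksym k (\<epsilon> *\<^sub>R \<xi>)"
proof -
  have "ksym (mollifying_net k \<epsilon>) \<xi> = \<bar>\<epsilon>\<bar> ^ DIM('a) *\<^sub>R (LINT x|lborel. cis (- ((\<epsilon> *\<^sub>R x) \<bullet> \<xi>)) * complex_of_real (mollifying_net k \<epsilon> (\<epsilon> *\<^sub>R x)))"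
    unfolding ksym_def FT_def
    using integral_lborel_affine[of \<epsilon> "\<lambda>x. cis (- (x \<bullet> \<xi>)) * complex_of_real (mollifying_net k \<epsilon> x)" 0] e by simp
  also have "\<dots> = (LINT x|lborel. \<bar>\<epsilon>\<bar> ^ DIM('a) *\<^sub>R (cis (- ((\<epsilon> *\<^sub>R x) \<bullet> \<xi>)) * complex_of_real (mollifying_net k \<epsilon> (\<epsilon> *\<^sub>R x))))"
    by (rule integral_scaleR_right[symmetric])
  also have "\<dots> = ksym k (\<epsilon> *\<^sub>R \<xi>)"
    unfolding ksym_def FT_def
    by (intro Bochner_Integration.integral_cong refl) (use e in \<open>simp add: mollifying_net_def scaleR_conv_of_real\<close>)
  finally show ?thesis .
qed

lemma ksym_zero: "ksym k 0 = of_real (LINT x|lborel. k x)"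
  by (simp add: ksym_def FT_def)

lemma smooth_compact_scale:
  fixes k :: "'a::euclidean_space \<Rightarrow> real"
  assumes k: "smooth_compact k" and c: "c \<noteq> 0"
  shows "smooth_compact (\<lambda>x. k (c *\<^sub>R x))"
proof -
  obtain R where R: "\<And>x. norm x > R \<Longrightarrow> k x = 0" using smooth_compactD(2)[OF k] by (auto simp: bdd_supp_def)
  have "k (c *\<^sub>R x) = 0" if "norm x > R / \<bar>c\<bar>" for x
    using that c by (intro R) (simp add: field_simps)
  then have "bdd_supp (\<lambda>x. k (c *\<^sub>R x))" by (auto simp: bdd_supp_def)
  moreover have "Ck n (\<lambda>x. k (c *\<^sub>R x))" for n
    using Ck_affine[OF bounded_linear_scaleR_right smooth_compactD(3)[OF k], of n 0 c] by simp
  ultimately show ?thesis by (simp add: smooth_compact_def)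
qed

lemma smooth_compact_mollifying_net:
  fixes k :: "'a::euclidean_space \<Rightarrow> real"
  assumes k: "smooth_compact k" and e: "\<epsilon> > 0"
  shows "smooth_compact (mollifying_net k \<epsilon>)"
proof -
  have s: "smooth_compact (\<lambda>x. k (inverse \<epsilon> *\<^sub>R x))" using e by (intro smooth_compact_scale k) simp
  have eq: "mollifying_net k \<epsilon> = (\<lambda>x. (1 / \<epsilon> ^ DIM('a)) *\<^sub>R k (inverse \<epsilon> *\<^sub>R x))"
    by (auto simp: mollifying_net_def)
  have "Ck n (mollifying_net k \<epsilon>)" for n unfolding eq
    by (rule Ck_bounded_linear[OF bounded_linear_scaleR_right smooth_compactD(3)[OF s]])
  moreover have "bdd_supp (mollifying_net k \<epsilon>)"
    using smooth_compactD(2)[OF s] unfolding eq bdd_supp_def by auto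
  ultimately show ?thesis by (simp add: smooth_compact_def)
qed

text \<open>The convolution of \<open>\<psi>\<close> with its reflection. Its symbol is the square of the modulus of the symbol
  of \<open>\<psi>\<close>, which supplies the positivity on which the energy method rests.\<close>
definition autocorr :: "('a::euclidean_space \<Rightarrow> real) \<Rightarrow> 'a \<Rightarrow> real" where
  "autocorr \<psi> = convol (\<lambda>y. \<psi> (- y)) \<psi>"

lemma autocorr_props:
  fixes \<psi> :: "'a::euclidean_space \<Rightarrow> real"
  assumes m: "friedrichs_mollifier \<psi>"
  shows "friedrichs_mollifier (autocorr \<psi>)" "autocorr \<psi> (- x) = autocorr \<psi> x" 
    "ksym (autocorr \<psi>) \<xi> = of_real ((cmod (ksym \<psi> \<xi>))\<^sup>2)"
proof -
  note p = friedrichsD[OF m]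
  have s: "smooth_compact \<psi>" using p(1) by (simp add: test_functions_UNIV_iff)
  have s': "smooth_compact (\<lambda>y. \<psi> (- y))" using smooth_compact_scale[OF s, of "-1"] by simp
  have i': "integrable lborel (\<lambda>y. \<psi> (- y))" using integrable_lborel_reflect[OF kernelD(2)[OF p(4)], of 0] by simp
  have sm: "smooth_compact (autocorr \<psi>)"
    unfolding autocorr_def by (rule convol_smooth_compact[OF i' smooth_compactD(2)[OF s'] s])
  have nn: "0 \<le> autocorr \<psi> x" for x
    unfolding autocorr_def convol_def by (intro Bochner_Integration.integral_nonneg) (simp add: p(2))
  show "autocorr \<psi> (- x) = autocorr \<psi> x"
  proof -
    have "autocorr \<psi> (- x) = (LINT y|lborel. \<psi> (- x - (- x - y)) * \<psi> (- (- x - y)))"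
      unfolding autocorr_def convol_def using integral_lborel_reflect[of "\<lambda>y. \<psi> (- x - y) * \<psi> (- y)" "- x"] by simp
    also have "\<dots> = (LINT y|lborel. \<psi> (x - (0 - y)) * \<psi> (- (0 - y)))" by (simp add: mult.commute add.commute)
    also have "\<dots> = autocorr \<psi> x"
      unfolding autocorr_def convol_def using integral_lborel_reflect[of "\<lambda>y. \<psi> (x - y) * \<psi> (- y)" 0] by simp
    finally show ?thesis .
  qed
  show ks: "ksym (autocorr \<psi>) \<xi> = of_real ((cmod (ksym \<psi> \<xi>))\<^sup>2)" for \<xi>
  proof -
    have "(\<lambda>x. complex_of_real (autocorr \<psi> x)) = convol (\<lambda>y. of_real (\<psi> (- y))) \<psi>"
      by (simp add: autocorr_def convol_def fun_eq_iff scaleR_conv_of_real flip: integral_complex_of_real of_real_mult)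
    then have "ksym (autocorr \<psi>) \<xi> = ksym \<psi> \<xi> * FT (\<lambda>y. of_real (\<psi> (- y))) \<xi>"
      unfolding ksym_def using FT_convol[OF kernelD(2)[OF p(4)], of "\<lambda>y. complex_of_real (\<psi> (- y))" \<xi>] integrable_of_real[OF i'] by simp
    also have "FT (\<lambda>y. of_real (\<psi> (- y))) \<xi> = cnj (ksym \<psi> \<xi>)"
    proof -
      have "cnj (ksym \<psi> \<xi>) = (LINT x|lborel. cis (x \<bullet> \<xi>) * of_real (\<psi> x))"
        unfolding ksym_def FT_def Bochner_Integration.integral_cnj[symmetric]
        by (intro Bochner_Integration.integral_cong refl) (simp add: cis_cnj)
      then show ?thesis
        unfolding FT_def using integral_lborel_reflect[of "\<lambda>x. cis (x \<bullet> \<xi>) * complex_of_real (\<psi> x)" 0] by simp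
    qed
    finally show ?thesis by (simp only: complex_norm_square)
  qed
  have "complex_of_real (LINT x|lborel. autocorr \<psi> x) = 1"
    using ks[of 0] p(3) by (simp add: ksym_zero)
  then have "(LINT x|lborel. autocorr \<psi> x) = 1" by (simp only: of_real_eq_1_iff)
  then show "friedrichs_mollifier (autocorr \<psi>)"
    using sm nn by (simp add: friedrichs_mollifier_def test_functions_UNIV_iff)
qed

lemma ksym_mollifier_le_1:
  assumes "friedrichs_mollifier \<psi>"
  shows "cmod (ksym \<psi> \<xi>) \<le> 1"
  using ksym_bound[OF friedrichsD(4)[OF assms], of \<xi>] friedrichsD(2,3)[OF assms] by simp

lemma symmetric_net:
  fixes \<psi> :: "'a::euclidean_space \<Rightarrow> real"
  assumes m: "friedrichs_mollifier \<psi>" and d: "\<delta> > 0"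
  shows "even_kernel (mollifying_net (autocorr \<psi>) \<delta>)"
    "\<exists>r. ksym (mollifying_net (autocorr \<psi>) \<delta>) \<xi> = of_real r \<and> 0 \<le> r \<and> r \<le> 1"
proof -
  note a = autocorr_props[OF m]
  have "smooth_compact (autocorr \<psi>)" using friedrichsD(1)[OF a(1)] by (simp add: test_functions_UNIV_iff)
  from smooth_compact_mollifying_net[OF this d]
  show "even_kernel (mollifying_net (autocorr \<psi>) \<delta>)"
    by (simp add: even_kernel_def mollifying_net_def a(2))
  have "(cmod (ksym \<psi> (\<delta> *\<^sub>R \<xi>)))\<^sup>2 \<le> 1"
    using ksym_mollifier_le_1[OF m] by (simp add: power_le_one)
  then show "\<exists>r. ksym (mollifying_net (autocorr \<psi>) \<delta>) \<xi> = of_real r \<and> 0 \<le> r \<and> r \<le> 1"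
    unfolding ksym_mollifying_net[OF d] a(3) by (intro exI[of _ "(cmod (ksym \<psi> (\<delta> *\<^sub>R \<xi>)))\<^sup>2"]) simp
qed

lemma ksym_tendsto_1:
  assumes m: "friedrichs_mollifier \<psi>"
  shows "((\<lambda>i. ksym \<psi> (inverse i *\<^sub>R \<xi>)) \<longlongrightarrow> 1) at_top"
proof -
  note p = friedrichsD[OF m]
  have [measurable]: "\<psi> \<in> borel_measurable borel" by (rule kernelD(1)[OF p(4)])
  have "((\<lambda>i. LINT x|lborel. cis (- (x \<bullet> (inverse i *\<^sub>R \<xi>))) * complex_of_real (\<psi> x)) \<longlongrightarrow> (LINT x|lborel. complex_of_real (\<psi> x))) at_top"
  proof (rule integral_dominated_convergence_at_top[where w=\<psi>])
    show "integrable lborel \<psi>" by (rule kernelD(2)[OF p(4)])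
    show "\<forall>\<^sub>F i in at_top. AE x in lborel. cmod (cis (- (x \<bullet> (inverse i *\<^sub>R \<xi>))) * complex_of_real (\<psi> x)) \<le> \<psi> x"
      using p(2) by (simp add: norm_mult)
    show "AE x in lborel. ((\<lambda>i. cis (- (x \<bullet> (inverse i *\<^sub>R \<xi>))) * complex_of_real (\<psi> x)) \<longlongrightarrow> complex_of_real (\<psi> x)) at_top"
    proof (rule AE_I2)
      fix x
      have i0: "((\<lambda>i::real. inverse i) \<longlongrightarrow> 0) at_top" by (rule tendsto_inverse_0_at_top[OF filterlim_ident])
      have "((\<lambda>i. cis (- (inverse i * (x \<bullet> \<xi>))) * complex_of_real (\<psi> x)) \<longlongrightarrow> cis (- (0 * (x \<bullet> \<xi>))) * complex_of_real (\<psi> x)) at_top"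
        by (intro tendsto_intros i0)
      then show "((\<lambda>i. cis (- (x \<bullet> (inverse i *\<^sub>R \<xi>))) * complex_of_real (\<psi> x)) \<longlongrightarrow> complex_of_real (\<psi> x)) at_top"
        by simp
    qed
    show "(\<lambda>x. cis (- (x \<bullet> (inverse t *\<^sub>R \<xi>))) * complex_of_real (\<psi> x)) \<in> borel_measurable lborel" for t
      by measurable
  qed measurable
  then show ?thesis using p(3) by (simp add: ksym_def FT_def)
qed

subsection \<open>The quadratic form of the mollified fractional Laplacian\<close>

lemma moll_lap_form:
  fixes k :: "'a::euclidean_space \<Rightarrow> real"
  assumes k: "even_kernel k" and s: "s > 0" and g: "g \<in> L2" "Fourier F = cls g"
    and r: "\<And>\<xi>. ksym k \<xi> = of_real (r \<xi>)"
  shows "integrable lborel (\<lambda>\<xi>. r \<xi> * (cmod (of_real (norm \<xi> powr s) * g \<xi>))\<^sup>2)"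
    "F \<bullet> moll_lap s k F = (1 / (2 * pi) ^ DIM('a)) * (LINT \<xi>|lborel. r \<xi> * (cmod (of_real (norm \<xi> powr s) * g \<xi>))\<^sup>2)"
proof -
  have m: "(\<lambda>\<xi>. lap_sym s k \<xi> * g \<xi>) \<in> L2" by (rule L2_mult[OF lap_sym_props(1)[OF k s] g(1)])
  have pt: "g \<xi> \<bullet> (lap_sym s k \<xi> * g \<xi>) = r \<xi> * (cmod (of_real (norm \<xi> powr s) * g \<xi>))\<^sup>2" for \<xi>
  proof -
    have "(norm \<xi> powr s)\<^sup>2 = norm \<xi> powr (2 * s)"
      by (simp add: power2_eq_square powr_add[symmetric])
    then have "lap_sym s k \<xi> * g \<xi> = (r \<xi> * (norm \<xi> powr s)\<^sup>2) *\<^sub>R g \<xi>"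
      by (simp add: lap_sym_def r scaleR_conv_of_real)
    then have "g \<xi> \<bullet> (lap_sym s k \<xi> * g \<xi>) = (r \<xi> * (norm \<xi> powr s)\<^sup>2) * (cmod (g \<xi>))\<^sup>2"
      by (simp only: inner_scaleR_right power2_norm_eq_inner)
    then show ?thesis by (simp add: norm_mult power_mult_distrib)
  qed
  show "integrable lborel (\<lambda>\<xi>. r \<xi> * (cmod (of_real (norm \<xi> powr s) * g \<xi>))\<^sup>2)"
    using L2_integrable_inner[OF g(1) m] by (simp only: pt)
  show "F \<bullet> moll_lap s k F = (1 / (2 * pi) ^ DIM('a)) * (LINT \<xi>|lborel. r \<xi> * (cmod (of_real (norm \<xi> powr s) * g \<xi>))\<^sup>2)"
    by (simp only: moll_lap_inner g(2) Mult_cls[OF lap_sym_props(1)[OF k s] g(1)] inner_cls[OF g(1) m] pt)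
qed

lemma moll_lap_nonneg:
  fixes \<psi> :: "'a::euclidean_space \<Rightarrow> real"
  assumes m: "friedrichs_mollifier \<psi>" and d: "\<delta> > 0" and s: "s > 0"
  shows "0 \<le> F \<bullet> moll_lap s (mollifying_net (autocorr \<psi>) \<delta>) F"
proof -
  obtain g where g: "g \<in> L2" "Fourier F = cls g" by (rule l2_cases)
  obtain r where r: "\<And>\<xi>. ksym (mollifying_net (autocorr \<psi>) \<delta>) \<xi> = of_real (r \<xi>)" "\<And>\<xi>. 0 \<le> r \<xi>"
    using symmetric_net(2)[OF m d] by metis
  show ?thesis
    unfolding moll_lap_form(2)[OF symmetric_net(1)[OF m d] s g r(1)]
    by (intro mult_nonneg_nonneg Bochner_Integration.integral_nonneg) (use r(2) in auto)
qed

text \<open>Since the symbol is at most \<open>1\<close>, the form is bounded by that of the fractional Laplacian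
  itself, uniformly in \<open>\<delta>\<close>.\<close>
lemma moll_lap_form_le:
  fixes \<psi> :: "'a::euclidean_space \<Rightarrow> real"
  assumes m: "friedrichs_mollifier \<psi>" and d: "\<delta> > 0" and s: "s > 0" and g: "g \<in> L2" "Fourier F = cls g"
    and h: "(\<lambda>\<xi>. of_real (norm \<xi> powr s) * g \<xi>) \<in> L2"
  shows "F \<bullet> moll_lap s (mollifying_net (autocorr \<psi>) \<delta>) F \<le> (1 / (2 * pi) ^ DIM('a)) * (norm (cls (\<lambda>\<xi>. of_real (norm \<xi> powr s) * g \<xi>)))\<^sup>2"
proof -
  obtain r where r: "\<And>\<xi>. ksym (mollifying_net (autocorr \<psi>) \<delta>) \<xi> = of_real (r \<xi>)" "\<And>\<xi>. 0 \<le> r \<xi>" "\<And>\<xi>. r \<xi> \<le> 1"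
    using symmetric_net(2)[OF m d] by metis
  note f = moll_lap_form[OF symmetric_net(1)[OF m d] s g r(1)]
  show ?thesis
    unfolding f(2) norm_cls_sq[OF h]
  proof (intro mult_left_mono integral_mono f(1) L2_D(2)[OF h])
    fix \<xi> show "r \<xi> * (cmod (of_real (norm \<xi> powr s) * g \<xi>))\<^sup>2 \<le> (cmod (of_real (norm \<xi> powr s) * g \<xi>))\<^sup>2"
      using mult_right_mono[OF r(3), of "(cmod (of_real (norm \<xi> powr s) * g \<xi>))\<^sup>2"] by simp
  qed simp
qed

subsection \<open>The mollified energy\<close>

text \<open>Only \<open>J V\<close> is differentiable here, but by symmetry the increment of
  \<open>\<langle>V, J V\<rangle>\<close> is \<open>\<langle>J V(r) - J V(t), V(r) + V(t)\<rangle>\<close>.\<close>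
lemma has_derivative_symmetric_form:
  fixes V :: "real \<Rightarrow> 'b::real_inner"
  assumes J: "bounded_linear J" "\<And>x y. J x \<bullet> y = x \<bullet> J y"
    and V: "continuous_on S V" and t: "t \<in> S"
    and D: "((\<lambda>t. J (V t)) has_vector_derivative D) (at t within S)"
  shows "((\<lambda>t. V t \<bullet> J (V t)) has_real_derivative 2 * (D \<bullet> V t)) (at t within S)"
  unfolding has_field_derivative_iff
proof -
  note q = has_vector_derivative_iff_quotient[THEN iffD1, OF D]
  have Vt: "(V \<longlongrightarrow> V t) (at t within S)" using V t by (simp add: continuous_on_def)
  have "((\<lambda>r. ((J (V r) - J (V t)) /\<^sub>R (r - t)) \<bullet> (V r + V t)) \<longlongrightarrow> D \<bullet> (V t + V t)) (at t within S)"
    by (intro tendsto_intros q Vt)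
  moreover have "((J (V r) - J (V t)) /\<^sub>R (r - t)) \<bullet> (V r + V t) = (V r \<bullet> J (V r) - V t \<bullet> J (V t)) / (r - t)" for r
  proof -
    have "V t \<bullet> J (V r) = V r \<bullet> J (V t)" using J(2)[of "V t" "V r"] by (simp only: inner_commute)
    then have "(J (V r) - J (V t)) \<bullet> (V r + V t) = V r \<bullet> J (V r) - V t \<bullet> J (V t)"
      by (simp add: inner_diff_left inner_add_right J(2))
    then show ?thesis by (simp add: divide_inverse mult.commute)
  qed
  ultimately show "((\<lambda>r. (V r \<bullet> J (V r) - V t \<bullet> J (V t)) / (r - t)) \<longlongrightarrow> 2 * (D \<bullet> V t)) (at t within S)"
    by (simp add: inner_add_right)
qed

lemma real_FTC_within:
  fixes f :: "real \<Rightarrow> real"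
  assumes "\<And>t. t \<in> {0..T} \<Longrightarrow> (f has_real_derivative f' t) (at t within {0..T})" "t \<in> {0..T}"
  shows "(f' has_integral f t - f 0) {0..t}"
proof (rule fundamental_theorem_of_calculus)
  show "(f has_vector_derivative f' x) (at x within {0..t})" if "x \<in> {0..t}" for x
  proof -
    have "x \<in> {0..T}" "{0..t} \<subseteq> {0..T}" using that assms(2) by auto
    then show ?thesis
      using has_vector_derivative_within_subset[OF assms(1)[unfolded has_real_derivative_iff_has_vector_derivative]] by blast
  qed
qed (use assms in auto)

text \<open>The terms with \<open>A\<close> cancel because the derivative of \<open>\<langle>W, A W\<rangle>\<close> is \<open>2 \<langle>A W, V\<rangle>\<close>.\<close>
lemma energy_identity:
  fixes W V F :: "real \<Rightarrow> 'b::real_inner"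
  assumes J: "bounded_linear J" "\<And>x y. J x \<bullet> y = x \<bullet> J y"
    and A: "bounded_linear A" "\<And>x y. A x \<bullet> y = x \<bullet> A y"
    and W: "\<And>t. t \<in> {0..T} \<Longrightarrow> (W has_vector_derivative V t) (at t within {0..T})"
    and V: "continuous_on {0..T} V"
    and eq: "\<And>t. t \<in> {0..T} \<Longrightarrow> ((\<lambda>t. J (V t)) has_vector_derivative - (A (W t) + J (F t))) (at t within {0..T})"
    and t: "t \<in> {0..T}"
  shows "((\<lambda>t. - 2 * (J (F t) \<bullet> V t)) has_integral (V t \<bullet> J (V t) + W t \<bullet> A (W t)) - (V 0 \<bullet> J (V 0) + W 0 \<bullet> A (W 0))) {0..t}"
proof (rule real_FTC_within[where T=T and f="\<lambda>t. V t \<bullet> J (V t) + W t \<bullet> A (W t)", OF _ t])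
  fix t assume t: "t \<in> {0..T}"
  have Wc: "continuous_on {0..T} W"
    unfolding continuous_on_eq_continuous_within using has_vector_derivative_continuous[OF W] by blast
  have AW: "((\<lambda>t. A (W t)) has_vector_derivative A (V t)) (at t within {0..T})"
    by (rule bounded_linear.has_vector_derivative[OF A(1) W[OF t]])
  have "((\<lambda>t. V t \<bullet> J (V t) + W t \<bullet> A (W t)) has_real_derivative 2 * (- (A (W t) + J (F t)) \<bullet> V t) + 2 * (A (V t) \<bullet> W t)) (at t within {0..T})"
    by (rule DERIV_add[OF has_derivative_symmetric_form[OF J V t eq[OF t]] has_derivative_symmetric_form[OF A Wc t AW]])
  moreover have "A (V t) \<bullet> W t = A (W t) \<bullet> V t" using A(2)[of "V t" "W t"] by (simp only: inner_commute)
  ultimately show "((\<lambda>t. V t \<bullet> J (V t) + W t \<bullet> A (W t)) has_real_derivative - 2 * (J (F t) \<bullet> V t)) (at t within {0..T})"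
    by (simp add: inner_add_left algebra_simps)
qed

text \<open>The mollified energies satisfy the inequality with constants independent of \<open>\<delta>\<close>; the form
  \<open>\<langle>W(t), A\<^sub>k W(t)\<rangle> \<ge> 0\<close> is dropped and \<open>\<delta>\<close> tends to \<open>0\<close>.\<close>
lemma energy_estimate:
  fixes W V F :: "real \<Rightarrow> 'a::euclidean_space l2" and \<psi> :: "'a \<Rightarrow> real"
  assumes m: "friedrichs_mollifier \<psi>" and s: "s > 0"
    and W: "\<And>t. t \<in> {0..T} \<Longrightarrow> (W has_vector_derivative V t) (at t within {0..T})"
    and V: "continuous_on {0..T} V" and F: "continuous_on {0..T} F"
    and eq: "\<And>k t. even_kernel k \<Longrightarrow> t \<in> {0..T} \<Longrightarrow> 
      ((\<lambda>t. Conv k (V t)) has_vector_derivative - (moll_lap s k (W t) + Conv k (F t))) (at t within {0..T})"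
    and e: "\<And>\<delta>. \<delta> > 0 \<Longrightarrow> W 0 \<bullet> moll_lap s (mollifying_net (autocorr \<psi>) \<delta>) (W 0) \<le> e"
    and t: "t \<in> {0..T}"
  shows "(norm (V t))\<^sup>2 \<le> (norm (V 0))\<^sup>2 + e + integral {0..t} (\<lambda>t. 2 * (norm (F t) * norm (V t)))"
proof -
  note a = autocorr_props(1)[OF m]
  let ?k = "mollifying_net (autocorr \<psi>)"
  have sub: "{0..t} \<subseteq> {0..T}" using t by auto
  have bound: "V t \<bullet> Conv (?k \<delta>) (V t) \<le> (norm (V 0))\<^sup>2 + e + integral {0..t} (\<lambda>t. 2 * (norm (F t) * norm (V t)))"
    if d: "\<delta> > 0" for \<delta>
  proof -
    note sk = symmetric_net(1)[OF m d]
    note kk = even_kernelD[OF sk]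
    have hi: "((\<lambda>t. - 2 * (Conv (?k \<delta>) (F t) \<bullet> V t)) has_integral (V t \<bullet> Conv (?k \<delta>) (V t) + W t \<bullet> moll_lap s (?k \<delta>) (W t)) 
        - (V 0 \<bullet> Conv (?k \<delta>) (V 0) + W 0 \<bullet> moll_lap s (?k \<delta>) (W 0))) {0..t}"
      by (rule energy_identity[OF bounded_linear_Conv[OF kk(2)] Conv_inner_commute[OF kk(2,3)] bounded_linear_moll_lap[OF sk s] 
            moll_lap_inner_commute[OF sk s] W V eq[OF sk] t])
    have ii: "(\<lambda>t. 2 * (norm (F t) * norm (V t))) integrable_on {0..t}"
      by (intro integrable_continuous_real continuous_intros continuous_on_subset[OF F sub] continuous_on_subset[OF V sub])
    have "(V t \<bullet> Conv (?k \<delta>) (V t) + W t \<bullet> moll_lap s (?k \<delta>) (W t)) 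
        - (V 0 \<bullet> Conv (?k \<delta>) (V 0) + W 0 \<bullet> moll_lap s (?k \<delta>) (W 0)) \<le> integral {0..t} (\<lambda>t. 2 * (norm (F t) * norm (V t)))"
    proof (rule has_integral_le[OF hi integrable_integral[OF ii]])
      fix r
      have "- (Conv (?k \<delta>) (F r) \<bullet> V r) \<le> norm (Conv (?k \<delta>) (F r)) * norm (V r)"
        using norm_cauchy_schwarz[of "- Conv (?k \<delta>) (F r)" "V r"] by simp
      also have "\<dots> \<le> norm (F r) * norm (V r)"
        by (rule mult_right_mono[OF Conv_mollifier_contraction[OF a d]]) simp
      finally show "- 2 * (Conv (?k \<delta>) (F r) \<bullet> V r) \<le> 2 * (norm (F r) * norm (V r))" by simp
    qed
    moreover have "0 \<le> W t \<bullet> moll_lap s (?k \<delta>) (W t)" by (rule moll_lap_nonneg[OF m d s])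
    moreover have "V 0 \<bullet> Conv (?k \<delta>) (V 0) \<le> (norm (V 0))\<^sup>2"
    proof -
      have "V 0 \<bullet> Conv (?k \<delta>) (V 0) \<le> norm (V 0) * norm (Conv (?k \<delta>) (V 0))" by (rule norm_cauchy_schwarz)
      also have "\<dots> \<le> norm (V 0) * norm (V 0)" by (rule mult_left_mono[OF Conv_mollifier_contraction[OF a d]]) simp
      finally show ?thesis by (simp add: power2_eq_square)
    qed
    ultimately show ?thesis using e[OF d] by linarith
  qed
  have "((\<lambda>\<delta>. V t \<bullet> Conv (?k \<delta>) (V t)) \<longlongrightarrow> V t \<bullet> V t) (at_right 0)"
    by (intro tendsto_intros Conv_mollifier_tendsto a)
  then have "V t \<bullet> V t \<le> (norm (V 0))\<^sup>2 + e + integral {0..t} (\<lambda>t. 2 * (norm (F t) * norm (V t)))"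
  proof (rule tendsto_upperbound)
    show "\<forall>\<^sub>F \<delta> in at_right 0. V t \<bullet> Conv (?k \<delta>) (V t) \<le> (norm (V 0))\<^sup>2 + e + integral {0..t} (\<lambda>t. 2 * (norm (F t) * norm (V t)))"
      using eventually_at_right_less[of "0::real"] by eventually_elim (rule bound)
  qed simp
  then show ?thesis by (simp add: power2_norm_eq_inner)
qed

lemma gronwall:
  fixes f :: "real \<Rightarrow> real"
  assumes f: "continuous_on {0..T} f" and C: "C \<ge> 0" and t: "t \<in> {0..T}"
    and le: "\<And>t. t \<in> {0..T} \<Longrightarrow> f t \<le> A + C * integral {0..t} f"
  shows "f t \<le> A * exp (C * t)"
proof -
  define G where "G t = A + C * integral {0..t} f" for t
  define g where "g t = exp (- C * t) * G t" for t
  have g: "(g has_real_derivative exp (- C * t) * (C * f t - C * G t)) (at t within {0..T})" if "t \<in> {0..T}" for t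
  proof -
    have i: "((\<lambda>t. integral {0..t} f) has_real_derivative f t) (at t within {0..T})"
      unfolding has_real_derivative_iff_has_vector_derivative by (rule integral_has_vector_derivative[OF f that])
    show ?thesis unfolding g_def[abs_def] G_def[abs_def]
      by (rule derivative_eq_intros i refl | simp)+ (simp add: algebra_simps)
  qed
  have hi: "((\<lambda>t. exp (- C * t) * (C * f t - C * G t)) has_integral g t - g 0) {0..t}"
    by (rule real_FTC_within[OF g t])
  have "g t - g 0 \<le> 0"
  proof (rule has_integral_le[OF hi has_integral_0])
    fix r assume "r \<in> {0..t}"
    then have "f r \<le> G r" using le[of r] t by (simp add: G_def)
    then have "C * f r - C * G r \<le> 0" using C by (simp add: mult_left_mono)
    then show "exp (- C * r) * (C * f r - C * G r) \<le> 0" by (simp add: mult_nonneg_nonpos)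
  qed
  then have "exp (- C * t) * G t \<le> A" by (simp add: g_def G_def)
  then have "exp (C * t) * (exp (- C * t) * G t) \<le> exp (C * t) * A" by (intro mult_left_mono) auto
  moreover have "exp (C * t) * exp (- C * t) = 1" by (simp add: mult_exp_exp)
  ultimately have "G t \<le> A * exp (C * t)" by (simp only: mult.assoc[symmetric] mult_1) (simp only: mult.commute)
  moreover have "f t \<le> G t" using le[OF t] by (simp add: G_def)
  ultimately show ?thesis by linarith
qed

section \<open>Stability and convergence\<close>

text \<open>What remains of the notion of solution after convolution: \<open>U\<close> and \<open>V\<close> are the classes of \<open>u\<close>
  and \<open>u\<^sub>t\<close>, and the equation holds in \<open>L\<^sup>2\<close> after convolution with any even kernel.\<close>
definition mollified_solution ::
  "real \<Rightarrow> real \<Rightarrow> ('a::euclidean_space \<Rightarrow> real) \<Rightarrow> ('a \<Rightarrow> real) \<Rightarrow> (real \<Rightarrow> 'a l2) \<Rightarrow> (real \<Rightarrow> 'a l2) \<Rightarrow> bool" where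
  "mollified_solution T s a b U V \<longleftrightarrow>
     (\<forall>t\<in>{0..T}. (U has_vector_derivative V t) (at t within {0..T})) \<and> continuous_on {0..T} V \<and>
     (\<forall>k. even_kernel k \<longrightarrow> (\<forall>t\<in>{0..T}. ((\<lambda>t. Conv k (V t)) has_vector_derivative 
        - (moll_lap s k (U t) + Conv k (Mult (\<lambda>x. of_real (a x)) (U t) + Mult (\<lambda>x. of_real (b x)) (V t)))) (at t within {0..T})))"

lemma mollified_solutionD:
  assumes "mollified_solution T s a b U V"
  shows "\<And>t. t \<in> {0..T} \<Longrightarrow> (U has_vector_derivative V t) (at t within {0..T})" "continuous_on {0..T} V" "continuous_on {0..T} U"
    "\<And>k t. even_kernel k \<Longrightarrow> t \<in> {0..T} \<Longrightarrow> ((\<lambda>t. Conv k (V t)) has_vector_derivative 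
        - (moll_lap s k (U t) + Conv k (Mult (\<lambda>x. of_real (a x)) (U t) + Mult (\<lambda>x. of_real (b x)) (V t)))) (at t within {0..T})"
proof -
  show d: "(U has_vector_derivative V t) (at t within {0..T})" if "t \<in> {0..T}" for t
    using assms that unfolding mollified_solution_def by blast
  show "continuous_on {0..T} U"
    unfolding continuous_on_eq_continuous_within using has_vector_derivative_continuous[OF d] by blast
  show "continuous_on {0..T} V" using assms unfolding mollified_solution_def by blast
  show "((\<lambda>t. Conv k (V t)) has_vector_derivative 
        - (moll_lap s k (U t) + Conv k (Mult (\<lambda>x. of_real (a x)) (U t) + Mult (\<lambda>x. of_real (b x)) (V t)))) (at t within {0..T})"
    if "even_kernel k" "t \<in> {0..T}" for k t
    using assms that unfolding mollified_solution_def by blast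
qed

lemma is_solution_mollified:
  fixes u :: "real \<Rightarrow> 'a::euclidean_space \<Rightarrow> complex" and \<psi> :: "'a \<Rightarrow> real"
  assumes sol: "is_solution T s a b u0 u1 u" and m: "friedrichs_mollifier \<psi>" and T: "T > 0" and s: "s > 0"
    and a: "ess_bdd (\<lambda>x. complex_of_real (a x))" and b: "ess_bdd (\<lambda>x. complex_of_real (b x))"
    and u01: "u0 \<in> L2" "u1 \<in> L2"
  shows "\<exists>V. mollified_solution T s a b (\<lambda>t. cls (u t)) V \<and> cls (u 0) = cls u0 \<and> V 0 = cls u1"
proof -
  obtain v where v: "C1_L2 T u v" "wave_eq T s a b u v" "AE x in lborel. u 0 x = u0 x" "AE x in lborel. v 0 x = u1 x"
    using sol unfolding is_solution_def by blast
  note C = C1_L2_cls[OF v(1) T]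
  have 0: "0 \<in> {0..T}" using T by simp
  have "mollified_solution T s a b (\<lambda>t. cls (u t)) (\<lambda>t. cls (v t))"
    unfolding mollified_solution_def
    by (intro conjI ballI allI impI C(3,4) mollified_equation[OF m v(2,1) T s a b])
  moreover have "cls (u 0) = cls u0" by (rule cls_eqI[OF C(1)[OF 0] u01(1) v(3)])
  moreover have "cls (v 0) = cls u1" by (rule cls_eqI[OF C(2)[OF 0] u01(2) v(4)])
  ultimately show ?thesis by blast
qed

lemma Mult_diff_symbol:
  assumes m: "ess_bdd m1" "ess_bdd m2"
  shows "Mult m1 F - Mult m2 F = Mult (\<lambda>x. m1 x - m2 x) F" "ess_bdd (\<lambda>x. m1 x - m2 x)"
proof -
  obtain C1 C2 where C: "AE x in lborel. cmod (m1 x) \<le> C1" "AE x in lborel. cmod (m2 x) \<le> C2"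
    using m unfolding ess_bdd_def by blast
  have "AE x in lborel. cmod (m1 x - m2 x) \<le> C1 + C2"
    using C by eventually_elim (rule order.trans[OF norm_triangle_ineq4], simp)
  then show e: "ess_bdd (\<lambda>x. m1 x - m2 x)" using m unfolding ess_bdd_def by auto
  obtain f where f: "f \<in> L2" "F = cls f" by (rule l2_cases)
  show "Mult m1 F - Mult m2 F = Mult (\<lambda>x. m1 x - m2 x) F"
    using cls_diff[OF L2_mult[OF m(1) f(1)] L2_mult[OF m(2) f(1)]]
    by (simp add: f Mult_cls m e left_diff_distrib)
qed

text \<open>The difference of the solutions solves the first equation with the source
  \<open>(a\<^sub>1 - a\<^sub>2) U\<^sub>2 + (b\<^sub>1 - b\<^sub>2) V\<^sub>2\<close>, whose norm is at most \<open>\<eta> K\<close>. The energy estimate for \<open>V\<close> and the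
  fundamental theorem for \<open>\<parallel>W\<parallel>\<^sup>2\<close> combine into a Gronwall inequality for \<open>\<parallel>W\<parallel>\<^sup>2 + \<parallel>V\<parallel>\<^sup>2\<close>.\<close>
lemma stability_estimate:
  fixes U1 V1 U2 V2 :: "real \<Rightarrow> 'a::euclidean_space l2" and \<psi> :: "'a \<Rightarrow> real" and a1 a2 b1 b2 :: "'a \<Rightarrow> real"
  assumes m: "friedrichs_mollifier \<psi>" and s: "s > 0"
    and sol1: "mollified_solution T s a1 b1 U1 V1" and sol2: "mollified_solution T s a2 b2 U2 V2"
    and coeffs: "ess_bdd (\<lambda>x. complex_of_real (a1 x))" "ess_bdd (\<lambda>x. complex_of_real (b1 x))"
      "ess_bdd (\<lambda>x. complex_of_real (a2 x))" "ess_bdd (\<lambda>x. complex_of_real (b2 x))"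
    and C: "AE x in lborel. \<bar>a1 x\<bar> \<le> C" "AE x in lborel. \<bar>b1 x\<bar> \<le> C" "C \<ge> 0"
    and \<eta>: "AE x in lborel. \<bar>a1 x - a2 x\<bar> \<le> \<eta>" "AE x in lborel. \<bar>b1 x - b2 x\<bar> \<le> \<eta>" "\<eta> \<ge> 0"
    and K: "\<And>t. t \<in> {0..T} \<Longrightarrow> norm (U2 t) + norm (V2 t) \<le> K"
    and e: "\<And>\<delta>. \<delta> > 0 \<Longrightarrow> (U1 0 - U2 0) \<bullet> moll_lap s (mollifying_net (autocorr \<psi>) \<delta>) (U1 0 - U2 0) \<le> e"
    and t: "t \<in> {0..T}"
  shows "(norm (U1 t - U2 t))\<^sup>2 \<le> ((norm (U1 0 - U2 0))\<^sup>2 + (norm (V1 0 - V2 0))\<^sup>2 + e + T * (\<eta> * K)\<^sup>2) * exp ((2 + 3 * C) * t)"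
proof -
  define W where "W t = U1 t - U2 t" for t
  define V where "V t = V1 t - V2 t" for t
  let ?a1 = "\<lambda>x. complex_of_real (a1 x)" and ?a2 = "\<lambda>x. complex_of_real (a2 x)"
  let ?b1 = "\<lambda>x. complex_of_real (b1 x)" and ?b2 = "\<lambda>x. complex_of_real (b2 x)"
  define F where "F t = (Mult ?a1 (U1 t) + Mult ?b1 (V1 t)) - (Mult ?a2 (U2 t) + Mult ?b2 (V2 t))" for t
  note U1 = mollified_solutionD(1,2)[OF sol1] and U2 = mollified_solutionD(1,2)[OF sol2]
    and c = mollified_solutionD(3)[OF sol1] mollified_solutionD(3)[OF sol2]
    and eq1 = mollified_solutionD(4)[OF sol1] and eq2 = mollified_solutionD(4)[OF sol2]
  have Wc: "continuous_on {0..T} W" and Vc: "continuous_on {0..T} V"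
    unfolding W_def[abs_def] V_def[abs_def] by (intro continuous_intros c U1 U2)+
  have Fc: "continuous_on {0..T} F"
    unfolding F_def[abs_def]
    by (intro continuous_intros c U1 U2 bounded_linear.continuous_on[OF bounded_linear_Mult[OF coeffs(1)]] 
      bounded_linear.continuous_on[OF bounded_linear_Mult[OF coeffs(2)]] bounded_linear.continuous_on[OF bounded_linear_Mult[OF coeffs(3)]]
      bounded_linear.continuous_on[OF bounded_linear_Mult[OF coeffs(4)]])
  have W': "(W has_vector_derivative V t) (at t within {0..T})" if "t \<in> {0..T}" for t
    unfolding W_def[abs_def] V_def by (intro has_vector_derivative_diff U1 U2 that)
  have eq: "((\<lambda>t. Conv k (V t)) has_vector_derivative - (moll_lap s k (W t) + Conv k (F t))) (at t within {0..T})"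
    if k: "even_kernel k" and t: "t \<in> {0..T}" for k t
  proof -
    interpret J: bounded_linear "Conv k" by (rule bounded_linear_Conv[OF even_kernelD(2)[OF k]])
    interpret A: bounded_linear "moll_lap s k" by (rule bounded_linear_moll_lap[OF k s])
    show ?thesis
      using has_vector_derivative_diff[OF eq1[OF k t] eq2[OF k t]]
      by (simp add: V_def W_def F_def J.diff A.diff algebra_simps)
  qed
  have Fb: "norm (F t) \<le> C * (norm (W t) + norm (V t)) + \<eta> * K" if t: "t \<in> {0..T}" for t
  proof -
    interpret Ma: bounded_linear "Mult ?a1" by (rule bounded_linear_Mult[OF coeffs(1)])
    interpret Mb: bounded_linear "Mult ?b1" by (rule bounded_linear_Mult[OF coeffs(2)])
    have "F t = Mult ?a1 (W t) + Mult ?b1 (V t) + ((Mult ?a1 (U2 t) - Mult ?a2 (U2 t)) + (Mult ?b1 (V2 t) - Mult ?b2 (V2 t)))"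
      by (simp add: F_def W_def V_def Ma.diff Mb.diff)
    also have "\<dots> = Mult ?a1 (W t) + Mult ?b1 (V t) + (Mult (\<lambda>x. ?a1 x - ?a2 x) (U2 t) + Mult (\<lambda>x. ?b1 x - ?b2 x) (V2 t))"
      by (simp only: Mult_diff_symbol(1)[OF coeffs(1,3)] Mult_diff_symbol(1)[OF coeffs(2,4)])
    also have "norm \<dots> \<le> (C * norm (W t) + C * norm (V t)) + (\<eta> * norm (U2 t) + \<eta> * norm (V2 t))"
    proof (intro order.trans[OF norm_triangle_ineq] add_mono norm_Mult_le coeffs Mult_diff_symbol(2))
      show "AE x in lborel. cmod (complex_of_real (a1 x)) \<le> C" "AE x in lborel. cmod (complex_of_real (b1 x)) \<le> C"
        using C by simp_all
      show "AE x in lborel. cmod (complex_of_real (a1 x) - complex_of_real (a2 x)) \<le> \<eta>" 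
        "AE x in lborel. cmod (complex_of_real (b1 x) - complex_of_real (b2 x)) \<le> \<eta>"
        using \<eta> by (simp_all flip: of_real_diff)
    qed (use C \<eta> in auto)
    also have "\<dots> \<le> C * (norm (W t) + norm (V t)) + \<eta> * K"
      using mult_left_mono[OF K[OF t] \<eta>(3)] by (simp add: distrib_left)
    finally show ?thesis .
  qed
  have T0: "0 \<in> {0..T}" using t by auto
  define N where "N t = (norm (W t))\<^sup>2 + (norm (V t))\<^sup>2" for t
  have Nc: "continuous_on {0..T} N" unfolding N_def[abs_def] by (intro continuous_intros Wc Vc)
  define A where "A = N 0 + e + T * (\<eta> * K)\<^sup>2"
  have main: "N t \<le> A + (2 + 3 * C) * integral {0..t} N" if t: "t \<in> {0..T}" for t
  proof -
    have sub: "{0..t} \<subseteq> {0..T}" using t by auto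
    note cs = continuous_on_subset[OF Wc sub] continuous_on_subset[OF Vc sub] continuous_on_subset[OF Fc sub] continuous_on_subset[OF Nc sub]
    have Wn: "(norm (W t))\<^sup>2 = (norm (W 0))\<^sup>2 + integral {0..t} (\<lambda>t. 2 * (V t \<bullet> W t))"
    proof -
      have "((\<lambda>t. 2 * (V t \<bullet> W t)) has_integral W t \<bullet> W t - W 0 \<bullet> W 0) {0..t}"
        by (rule real_FTC_within[where T=T and f="\<lambda>t. W t \<bullet> W t", OF _ t])
           (rule has_derivative_symmetric_form[of "\<lambda>x. x", OF bounded_linear_ident refl Wc _ W'])
      then have "integral {0..t} (\<lambda>t. 2 * (V t \<bullet> W t)) = W t \<bullet> W t - W 0 \<bullet> W 0" by (rule integral_unique)
      then show ?thesis by (simp add: power2_norm_eq_inner)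
    qed
    have Vn: "(norm (V t))\<^sup>2 \<le> (norm (V 0))\<^sup>2 + e + integral {0..t} (\<lambda>t. 2 * (norm (F t) * norm (V t)))"
      by (rule energy_estimate[OF m s W' Vc Fc eq _ t]) (use e in \<open>simp_all add: W_def\<close>)
    have i: "(\<lambda>t. 2 * (V t \<bullet> W t)) integrable_on {0..t}" "(\<lambda>t. 2 * (norm (F t) * norm (V t))) integrable_on {0..t}"
      "(\<lambda>t. (2 + 3 * C) * N t + (\<eta> * K)\<^sup>2) integrable_on {0..t}" "N integrable_on {0..t}"
      by (intro integrable_continuous_real continuous_intros cs)+
    have "N t \<le> N 0 + e + (integral {0..t} (\<lambda>t. 2 * (V t \<bullet> W t)) + integral {0..t} (\<lambda>t. 2 * (norm (F t) * norm (V t))))"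
      using Wn Vn by (simp add: N_def)
    also have "integral {0..t} (\<lambda>t. 2 * (V t \<bullet> W t)) + integral {0..t} (\<lambda>t. 2 * (norm (F t) * norm (V t))) 
      = integral {0..t} (\<lambda>t. 2 * (V t \<bullet> W t) + 2 * (norm (F t) * norm (V t)))"
      by (rule Henstock_Kurzweil_Integration.integral_add[OF i(1,2), symmetric])
    also have "\<dots> \<le> integral {0..t} (\<lambda>t. (2 + 3 * C) * N t + (\<eta> * K)\<^sup>2)"
    proof (rule integral_le[OF integrable_add[OF i(1,2)] i(3)])
      fix r assume r: "r \<in> {0..t}"
      define w v where "w = norm (W r)" and "v = norm (V r)"
      have wv: "w \<ge> 0" "v \<ge> 0" by (auto simp: w_def v_def)
      have n: "N r = w\<^sup>2 + v\<^sup>2" by (simp add: N_def w_def v_def)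
      have 1: "2 * (V r \<bullet> W r) \<le> 2 * (v * w)" using norm_cauchy_schwarz[of "V r" "W r"] by (simp add: v_def w_def)
      have "norm (F r) * norm (V r) \<le> (C * (w + v) + \<eta> * K) * v"
        unfolding w_def v_def by (rule mult_right_mono[OF Fb]) (use r sub in auto)
      then have 2: "2 * (norm (F r) * norm (V r)) \<le> C * (2 * (w * v)) + 2 * (C * v\<^sup>2) + 2 * ((\<eta> * K) * v)"
        by (simp add: algebra_simps power2_eq_square)
      have 3: "2 * (w * v) \<le> w\<^sup>2 + v\<^sup>2" using sum_squares_bound[of w v] by simp
      have 4: "2 * ((\<eta> * K) * v) \<le> (\<eta> * K)\<^sup>2 + v\<^sup>2" using sum_squares_bound[of "\<eta> * K" v] by simp
      have 5: "C * (2 * (w * v)) \<le> C * (w\<^sup>2 + v\<^sup>2)" by (rule mult_left_mono[OF 3 C(3)])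
      have 6: "2 * (C * v\<^sup>2) \<le> 2 * (C * (w\<^sup>2 + v\<^sup>2))" using C(3) by (simp add: mult_left_mono)
      \<comment> \<open>One \<open>N\<close> comes from \<open>2 w v\<close>, one from the source term, and \<open>3 C N\<close> from the coefficients.\<close>
      have 7: "(2 + 3 * C) * N r = 2 * (w\<^sup>2 + v\<^sup>2) + C * (w\<^sup>2 + v\<^sup>2) + 2 * (C * (w\<^sup>2 + v\<^sup>2))" by (simp add: n algebra_simps)
      have 8: "v * w = w * v" "0 \<le> w\<^sup>2" by (simp_all add: mult.commute)
      show "2 * (V r \<bullet> W r) + 2 * (norm (F r) * norm (V r)) \<le> (2 + 3 * C) * N r + (\<eta> * K)\<^sup>2"
      proof -
        have "x1 + x2 \<le> 2 * q + x + 2 * x + h"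
          if "x1 \<le> 2 * p" "x2 \<le> y + 2 * z + 2 * g" "2 * p \<le> q" "2 * g \<le> h + v2" "y \<le> x" "2 * z \<le> 2 * x" "v2 \<le> q"
          for x1 x2 q x h p y z g v2 :: real
          using that by linarith
        from this[OF 1[unfolded 8(1)] 2 3 4 5 6] show ?thesis unfolding 7 using 8(2) by simp
      qed
    qed
    also have "\<dots> = (2 + 3 * C) * integral {0..t} N + t * (\<eta> * K)\<^sup>2"
      using t i(4) by (subst Henstock_Kurzweil_Integration.integral_add) (auto intro!: integrable_on_mult_right)
    also have "t * (\<eta> * K)\<^sup>2 \<le> T * (\<eta> * K)\<^sup>2" using t by (intro mult_right_mono) auto
    finally show ?thesis by (simp add: A_def)
  qed
  have "N t \<le> A * exp ((2 + 3 * C) * t)" using C(3) by (intro gronwall[OF Nc _ t main]) auto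
  then have "(norm (W t))\<^sup>2 \<le> A * exp ((2 + 3 * C) * t)" using zero_le_power2[of "norm (V t)"] unfolding N_def by linarith
  then show ?thesis by (simp add: A_def N_def W_def V_def)
qed

text \<open>The Fourier transform of \<open>u\<^sub>0 * \<psi>\<^sub>\<epsilon> - u\<^sub>0\<close> is \<open>(ksym \<psi> (\<epsilon> \<xi>) - 1)\<close> times that of \<open>u\<^sub>0\<close>. The factor is
  bounded by \<open>2\<close> and tends to \<open>0\<close> pointwise, and \<open>|\<xi>|\<^sup>s\<close> times the transform of \<open>u\<^sub>0\<close> is in \<open>L\<^sup>2\<close>
  because \<open>u\<^sub>0 \<in> Hs s\<close>; dominated convergence gives a bound uniform in \<open>\<delta>\<close>.\<close>
lemma initial_energy_tendsto:
  fixes u0 :: "'a::euclidean_space \<Rightarrow> complex" and \<psi> :: "'a \<Rightarrow> real"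
  assumes m: "friedrichs_mollifier \<psi>" and s: "s > 0" and u0: "u0 \<in> Hs s"
  obtains e where "(e \<longlongrightarrow> 0) (at_right 0)" 
    "\<And>\<epsilon> \<delta>. \<epsilon> > 0 \<Longrightarrow> \<delta> > 0 \<Longrightarrow> (Conv (mollifying_net \<psi> \<epsilon>) (cls u0) - cls u0) \<bullet> moll_lap s (mollifying_net (autocorr \<psi>) \<delta>) (Conv (mollifying_net \<psi> \<epsilon>) (cls u0) - cls u0) \<le> e \<epsilon>"
proof -
  note p = friedrichsD[OF m]
  obtain g where g: "g \<in> L2" "Fourier (cls u0) = cls g" "(\<lambda>\<xi>. of_real (norm \<xi> powr s) * g \<xi>) \<in> L2"
    using u0 unfolding Hs_def has_frac_laplacian_def has_fourier_iff has_inv_fourier_iff by auto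
  define h where "h \<xi> = of_real (norm \<xi> powr s) * g \<xi>" for \<xi>
  have h: "h \<in> L2" using g(3) by (simp add: h_def[abs_def])
  define \<mu> where "\<mu> \<epsilon> \<xi> = ksym \<psi> (\<epsilon> *\<^sub>R \<xi>) - 1" for \<epsilon> and \<xi> :: 'a
  have \<mu>b: "cmod (\<mu> \<epsilon> \<xi>) \<le> 2" for \<epsilon> \<xi>
    using norm_triangle_ineq4[of "ksym \<psi> (\<epsilon> *\<^sub>R \<xi>)" 1] ksym_mollifier_le_1[OF m, of "\<epsilon> *\<^sub>R \<xi>"] by (simp add: \<mu>_def)
  have \<mu>: "ess_bdd (\<mu> \<epsilon>)" for \<epsilon>
  proof (rule ess_bdd_I[OF _ \<mu>b])
    have [measurable]: "ksym \<psi> \<in> borel_measurable borel" by (rule ksym_measurable[OF p(4)])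
    show "\<mu> \<epsilon> \<in> borel_measurable borel" unfolding \<mu>_def[abs_def] by measurable
  qed
  define c where "c = 1 / (2 * pi) ^ DIM('a)"
  show thesis
  proof (rule that[of "\<lambda>\<epsilon>. c * (norm (cls (\<lambda>\<xi>. \<mu> \<epsilon> \<xi> * h \<xi>)))\<^sup>2"])
    have "((\<lambda>i. cls (\<lambda>\<xi>. \<mu> (inverse i) \<xi> * h \<xi>)) \<longlongrightarrow> cls (\<lambda>\<xi>. 0)) at_top"
    proof (rule tendsto_cls_dominated[where h="\<lambda>\<xi>. 2 * h \<xi>"])
      show "(\<lambda>\<xi>. \<mu> (inverse i) \<xi> * h \<xi>) \<in> L2" for i by (rule L2_mult[OF \<mu> h])
      show "(\<lambda>\<xi>. 2 * h \<xi>) \<in> L2" by (rule L2_cmult[OF h])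
      show "AE \<xi> in lborel. ((\<lambda>i. \<mu> (inverse i) \<xi> * h \<xi>) \<longlongrightarrow> 0) at_top"
      proof (rule AE_I2)
        fix \<xi> :: 'a
        have "((\<lambda>i. (ksym \<psi> (inverse i *\<^sub>R \<xi>) - 1) * h \<xi>) \<longlongrightarrow> (1 - 1) * h \<xi>) at_top"
          by (intro tendsto_intros ksym_tendsto_1[OF m])
        then show "((\<lambda>i. \<mu> (inverse i) \<xi> * h \<xi>) \<longlongrightarrow> 0) at_top" by (simp add: \<mu>_def)
      qed
      show "AE \<xi> in lborel. cmod (\<mu> (inverse i) \<xi> * h \<xi>) \<le> cmod (2 * h \<xi>)" for i
        using \<mu>b by (intro AE_I2) (simp add: norm_mult mult_right_mono)
    qed simp
    then have "((\<lambda>\<epsilon>. cls (\<lambda>\<xi>. \<mu> \<epsilon> \<xi> * h \<xi>)) \<longlongrightarrow> 0) (at_right 0)"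
      by (simp add: filterlim_at_right_to_top cls_zero)
    then have "((\<lambda>\<epsilon>. c * (norm (cls (\<lambda>\<xi>. \<mu> \<epsilon> \<xi> * h \<xi>)))\<^sup>2) \<longlongrightarrow> c * (norm (0::'a l2))\<^sup>2) (at_right 0)"
      by (intro tendsto_intros)
    then show "((\<lambda>\<epsilon>. c * (norm (cls (\<lambda>\<xi>. \<mu> \<epsilon> \<xi> * h \<xi>)))\<^sup>2) \<longlongrightarrow> 0) (at_right 0)" by simp
    fix \<epsilon> \<delta> :: real assume e: "\<epsilon> > 0" and d: "\<delta> > 0"
    let ?W = "Conv (mollifying_net \<psi> \<epsilon>) (cls u0) - cls u0"
    have kn: "kernel (mollifying_net \<psi> \<epsilon>)" by (rule mollifying_net_props(1)[OF m e])
    have "Fourier ?W = Mult (ksym (mollifying_net \<psi> \<epsilon>)) (cls g) - Mult (\<lambda>x. 1) (cls g)"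
      by (simp add: linear_simps(2)[OF bounded_linear_Fourier] Fourier_Conv[OF kn] g Mult_cls)
    also have "\<dots> = cls (\<lambda>\<xi>. \<mu> \<epsilon> \<xi> * g \<xi>)"
      using Mult_cls[OF \<mu> g(1)] 
      by (simp add: Mult_diff_symbol(1)[OF ess_bdd_ksym[OF kn]] ksym_mollifying_net[OF e] \<mu>_def[abs_def])
    finally have F: "Fourier ?W = cls (\<lambda>\<xi>. \<mu> \<epsilon> \<xi> * g \<xi>)" .
    have eq: "(\<lambda>\<xi>. of_real (norm \<xi> powr s) * (\<mu> \<epsilon> \<xi> * g \<xi>)) = (\<lambda>\<xi>. \<mu> \<epsilon> \<xi> * h \<xi>)"
      by (auto simp: h_def)
    show "?W \<bullet> moll_lap s (mollifying_net (autocorr \<psi>) \<delta>) ?W \<le> c * (norm (cls (\<lambda>\<xi>. \<mu> \<epsilon> \<xi> * h \<xi>)))\<^sup>2"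
      using moll_lap_form_le[OF m d s L2_mult[OF \<mu> g(1)] F] L2_mult[OF \<mu> h] unfolding eq c_def by blast
  qed
qed

theorem theorem4p1:
  fixes s T :: real
    and \<psi> :: "real ^ 'd \<Rightarrow> real"
    and a b :: "real ^ 'd \<Rightarrow> real"
    and u0 u1 :: "real ^ 'd \<Rightarrow> complex"
    and u\<epsilon> :: "real \<Rightarrow> real \<Rightarrow> real ^ 'd \<Rightarrow> complex"
    and u :: "real \<Rightarrow> real ^ 'd \<Rightarrow> complex"
  assumes "s > 0" and "T > 0"
    and "friedrichs_mollifier \<psi>"
    and "a \<in> Linf" and "AE x in lborel. a x \<ge> 0"
    and "b \<in> Linf" and "AE x in lborel. b x \<ge> 0"
    and "u0 \<in> Hs s" and "u1 \<in> L2"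
    and "((\<lambda>\<epsilon>. Linf_norm (\<lambda>x. convol a (mollifying_net \<psi> \<epsilon>) x - a x)) \<longlongrightarrow> 0) (at_right 0)"
    and "((\<lambda>\<epsilon>. Linf_norm (\<lambda>x. convol b (mollifying_net \<psi> \<epsilon>) x - b x)) \<longlongrightarrow> 0) (at_right 0)"
    and "\<And>\<epsilon>. \<epsilon> \<in> {0<..1} \<Longrightarrow>
      is_solution T s (convol a (mollifying_net \<psi> \<epsilon>)) (convol b (mollifying_net \<psi> \<epsilon>))
        (convol u0 (mollifying_net \<psi> \<epsilon>)) (convol u1 (mollifying_net \<psi> \<epsilon>)) (u\<epsilon> \<epsilon>)"
    and "is_solution T s a b u0 u1 u"
  shows "\<forall>t\<in>{0..T}. L2_lim (\<lambda>\<epsilon>. u\<epsilon> \<epsilon> t) (u t) (at_right 0)"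
proof
  note s = assms(1) and T = assms(2) and m = assms(3)
  let ?n = "mollifying_net \<psi>"
  have u0: "u0 \<in> L2" using assms(8) by (simp add: Hs_def)
  note ab = Linf_ess_bdd[OF assms(4)] Linf_ess_bdd[OF assms(6)]
  obtain V where V: "mollified_solution T s a b (\<lambda>t. cls (u t)) V" "cls (u 0) = cls u0" "V 0 = cls u1"
    using is_solution_mollified[OF assms(13) m T s ab u0 assms(9)] by blast
  have "bounded ((\<lambda>t. norm (cls (u t)) + norm (V t)) ` {0..T})"
    by (rule compact_imp_bounded, intro compact_continuous_image continuous_intros mollified_solutionD(2,3)[OF V(1)]) simp
  then obtain K where "\<forall>y\<in>(\<lambda>t. norm (cls (u t)) + norm (V t)) ` {0..T}. norm y \<le> K"
    unfolding bounded_iff by blast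
  then have K: "norm (cls (u t)) + norm (V t) \<le> K" if "t \<in> {0..T}" for t
    using that by force
  obtain C0 where C0: "AE x in lborel. \<bar>a x\<bar> \<le> C0" "AE x in lborel. \<bar>b x\<bar> \<le> C0" "C0 \<ge> 0"
  proof -
    obtain A B where "AE x in lborel. cmod (complex_of_real (a x)) \<le> A" "AE x in lborel. cmod (complex_of_real (b x)) \<le> B"
      using ab unfolding ess_bdd_def by blast
    then have "AE x in lborel. \<bar>a x\<bar> \<le> max 0 (max A B)" "AE x in lborel. \<bar>b x\<bar> \<le> max 0 (max A B)" by auto
    then show thesis by (rule that) simp
  qed
  define na where "na \<epsilon> = Linf_norm (\<lambda>x. convol a (?n \<epsilon>) x - a x)" for \<epsilon>
  define nb where "nb \<epsilon> = Linf_norm (\<lambda>x. convol b (?n \<epsilon>) x - b x)" for \<epsilon>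
  \<comment> \<open>The moduli make \<open>\<eta>\<close> non-negative by construction; for small \<open>\<epsilon>\<close>, when both norms are finite, it bounds them.\<close>
  define \<eta> where "\<eta> \<epsilon> = \<bar>real_of_ereal (na \<epsilon>)\<bar> + \<bar>real_of_ereal (nb \<epsilon>)\<bar>" for \<epsilon>
  have nlim: "(na \<longlongrightarrow> ereal 0) (at_right 0)" "(nb \<longlongrightarrow> ereal 0) (at_right 0)"
    using assms(10,11) by (simp_all add: na_def[abs_def] nb_def[abs_def] zero_ereal_def)
  have "(\<eta> \<longlongrightarrow> \<bar>0\<bar> + \<bar>0\<bar>) (at_right 0)"
    unfolding \<eta>_def[abs_def] by (intro tendsto_add tendsto_rabs nlim[THEN lim_real_of_ereal])
  then have \<eta>lim: "(\<eta> \<longlongrightarrow> 0) (at_right 0)" by simp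
  obtain e where e: "(e \<longlongrightarrow> 0) (at_right 0)" 
    "\<And>\<epsilon> \<delta>. \<epsilon> > 0 \<Longrightarrow> \<delta> > 0 \<Longrightarrow> (Conv (?n \<epsilon>) (cls u0) - cls u0) \<bullet> moll_lap s (mollifying_net (autocorr \<psi>) \<delta>) (Conv (?n \<epsilon>) (cls u0) - cls u0) \<le> e \<epsilon>"
    using initial_energy_tendsto[OF m s assms(8)] by blast
  fix t assume t: "t \<in> {0..T}"
  have ut: "u t \<in> L2" using assms(13) t unfolding is_solution_def C1_L2_def by blast
  \<comment> \<open>The bound of \<open>stability_estimate\<close>; the coefficients \<open>a\<^sub>\<epsilon>\<close>, \<open>b\<^sub>\<epsilon>\<close> are at most \<open>C0 + 1\<close> for small \<open>\<epsilon>\<close>.\<close>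
  define B where "B \<epsilon> = ((norm (Conv (?n \<epsilon>) (cls u0) - cls u0))\<^sup>2 + (norm (Conv (?n \<epsilon>) (cls u1) - cls u1))\<^sup>2 + e \<epsilon> + T * (\<eta> \<epsilon> * K)\<^sup>2) 
    * exp ((2 + 3 * (C0 + 1)) * t)" for \<epsilon>
  have "(B \<longlongrightarrow> ((norm (cls u0 - cls u0))\<^sup>2 + (norm (cls u1 - cls u1))\<^sup>2 + 0 + T * (0 * K)\<^sup>2) * exp ((2 + 3 * (C0 + 1)) * t)) (at_right 0)"
    unfolding B_def[abs_def] by (intro tendsto_intros Conv_mollifier_tendsto m e(1) \<eta>lim)
  then have Blim: "(B \<longlongrightarrow> 0) (at_right 0)" by simp
  have ev1: "\<forall>\<^sub>F \<epsilon> in at_right 0. \<epsilon> \<in> {0<..1::real}"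
    by (rule eventually_at_rightI[of 0 1]) auto
  have L: "\<forall>\<^sub>F \<epsilon> in at_right 0. u\<epsilon> \<epsilon> t \<in> L2"
    using ev1
  proof eventually_elim
    case (elim \<epsilon>)
    then show ?case using assms(12)[OF elim] t unfolding is_solution_def C1_L2_def by blast
  qed
  have ev2: "\<forall>\<^sub>F \<epsilon> in at_right 0. na \<epsilon> < ereal 1 \<and> nb \<epsilon> < ereal 1 \<and> \<eta> \<epsilon> < 1"
    using order_tendstoD(2)[OF nlim(1), of "ereal 1"] order_tendstoD(2)[OF nlim(2), of "ereal 1"] order_tendstoD(2)[OF \<eta>lim, of 1]
    by (auto intro: eventually_conj)
  have "\<forall>\<^sub>F \<epsilon> in at_right 0. norm ((norm (cls (u\<epsilon> \<epsilon> t) - cls (u t)))\<^sup>2) \<le> B \<epsilon>"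
    using ev1 ev2
  proof eventually_elim
    case (elim \<epsilon>)
    then have \<epsilon>: "\<epsilon> > 0" by simp
    have kn: "kernel (?n \<epsilon>)" by (rule mollifying_net_props(1)[OF m \<epsilon>])
    have ne: "\<eta> \<epsilon> \<ge> 0" unfolding \<eta>_def by (intro add_nonneg_nonneg abs_ge_zero)
    have am: "a \<in> borel_measurable borel" "b \<in> borel_measurable borel" using assms(4,6) by (auto simp: Linf_def)
    have "AE x in lborel. \<bar>convol a (?n \<epsilon>) x - a x\<bar> \<le> real_of_ereal (na \<epsilon>)" "AE x in lborel. \<bar>convol b (?n \<epsilon>) x - b x\<bar> \<le> real_of_ereal (nb \<epsilon>)"
      using elim(2) unfolding na_def nb_def by (auto intro!: Linf_norm_AE intro: less_trans)
    then have d: "AE x in lborel. \<bar>convol a (?n \<epsilon>) x - a x\<bar> \<le> \<eta> \<epsilon>" "AE x in lborel. \<bar>convol b (?n \<epsilon>) x - b x\<bar> \<le> \<eta> \<epsilon>"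
      unfolding \<eta>_def by (eventually_elim; linarith)+
    have \<eta>1: "\<eta> \<epsilon> < 1" using elim(2) by blast
    have bd: "AE x in lborel. \<bar>convol a (?n \<epsilon>) x\<bar> \<le> C0 + 1"
      using d(1) C0(1) by eventually_elim (use \<eta>1 in linarith)
    have bd': "AE x in lborel. \<bar>convol b (?n \<epsilon>) x\<bar> \<le> C0 + 1"
      using d(2) C0(2) by eventually_elim (use \<eta>1 in linarith)
    have [measurable]: "convol a (?n \<epsilon>) \<in> borel_measurable borel" "convol b (?n \<epsilon>) \<in> borel_measurable borel"
      by (intro convol_measurable kernelD(1)[OF kn] am)+
    have ab\<epsilon>: "ess_bdd (\<lambda>x. complex_of_real (convol a (?n \<epsilon>) x))" "ess_bdd (\<lambda>x. complex_of_real (convol b (?n \<epsilon>) x))"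
      unfolding ess_bdd_def using bd bd' by auto
    obtain V\<epsilon> where v: "mollified_solution T s (convol a (?n \<epsilon>)) (convol b (?n \<epsilon>)) (\<lambda>t. cls (u\<epsilon> \<epsilon> t)) V\<epsilon>" 
      "cls (u\<epsilon> \<epsilon> 0) = cls (convol u0 (?n \<epsilon>))" "V\<epsilon> 0 = cls (convol u1 (?n \<epsilon>))"
      using is_solution_mollified[OF assms(12)[OF elim(1)] m T s ab\<epsilon> convol_L2(1)[OF kn u0] convol_L2(1)[OF kn assms(9)]] by blast
    have i: "cls (u\<epsilon> \<epsilon> 0) = Conv (?n \<epsilon>) (cls u0)" "V\<epsilon> 0 = Conv (?n \<epsilon>) (cls u1)"
      using v(2,3) Conv_cls[OF kn u0] Conv_cls[OF kn assms(9)] by auto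
    have "(norm (cls (u\<epsilon> \<epsilon> t) - cls (u t)))\<^sup>2 \<le> ((norm (cls (u\<epsilon> \<epsilon> 0) - cls (u 0)))\<^sup>2 + (norm (V\<epsilon> 0 - V 0))\<^sup>2 + e \<epsilon> + T * (\<eta> \<epsilon> * K)\<^sup>2) * exp ((2 + 3 * (C0 + 1)) * t)"
    proof (rule stability_estimate[OF m s v(1) V(1) ab\<epsilon> ab bd bd' _ d ne K _ t])
      show "(cls (u\<epsilon> \<epsilon> 0) - cls (u 0)) \<bullet> moll_lap s (mollifying_net (autocorr \<psi>) \<delta>) (cls (u\<epsilon> \<epsilon> 0) - cls (u 0)) \<le> e \<epsilon>" if "\<delta> > 0" for \<delta>
        unfolding i V(2) by (rule e(2)[OF \<epsilon> that])
    qed (use C0 in auto)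
    then show ?case unfolding i V(2,3) B_def by simp
  qed
  from Lim_null_comparison[OF this Blim]
  have "((\<lambda>\<epsilon>. sqrt ((norm (cls (u\<epsilon> \<epsilon> t) - cls (u t)))\<^sup>2)) \<longlongrightarrow> sqrt 0) (at_right 0)" by (rule tendsto_real_sqrt)
  then have "((\<lambda>\<epsilon>. norm (cls (u\<epsilon> \<epsilon> t) - cls (u t))) \<longlongrightarrow> 0) (at_right 0)" by simp
  then have "((\<lambda>\<epsilon>. cls (u\<epsilon> \<epsilon> t)) \<longlongrightarrow> cls (u t)) (at_right 0)" by (simp add: LIM_zero_iff tendsto_norm_zero_iff)
  then show "L2_lim (\<lambda>\<epsilon>. u\<epsilon> \<epsilon> t) (u t) (at_right 0)"
    unfolding L2_lim_iff[OF L] using ut by blast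
qed

end
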